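(* Let $\nu$ be a partition of $n$ with $\ell(\nu)=k$. Then $$\mathcal K_{(1^n),\nu}(t)=(-t)^{n-k}\,t^{\,n(\nu)-\binom k2}\,\frac{[k]_t!}{[m_1(\nu)]_t!\,[m_2(\nu)]_t!\cdots[m_n(\nu)]_t!}.$$
   Context: $\mathcal K_{\lambda,\nu}(t)$ is defined by $s_\lambda[(1-t)X]=\sum_\nu\mathcal K_{\lambda,\nu}(t)\,Q_\nu(X;t)$, where $Q_\nu(X;t)$ are the Hall--Littlewood $Q$-functions and $f[(1-t)X]$ denotes the substitution $p_r\mapsto(1-t^r)p_r$. $n(\nu)=\sum_i(i-1)\nu_i$; $m_i(\nu)$ is the multiplicity of the part $i$ in $\nu$; $[r]_t=\frac{1-t^r}{1-t}$ and $[r]_t!=\prod_{i=1}^r[i]_t$. *)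

theory Defs
  imports
    "HOL-Library.Poly_Mapping"
    "HOL-Computational_Algebra.Polynomial_Factorial"
    "HOL-Combinatorics.Permutations"
begin

section \<open>Partitions\<close>

text \<open>
  A partition is the weakly decreasing list of its nonzero parts; lists are indexed from 0, so
  the part \<open>\<nu>\<^sub>i\<close> is \<^term>\<open>\<nu> ! (i - 1)\<close>.
\<close>

definition is_partition :: "nat list \<Rightarrow> bool" where
  "is_partition \<nu> \<longleftrightarrow> sorted_wrt (\<ge>) \<nu> \<and> 0 \<notin> set \<nu>"

definition partition_of :: "nat \<Rightarrow> nat list \<Rightarrow> bool" where
  "partition_of n \<nu> \<longleftrightarrow> is_partition \<nu> \<and> sum_list \<nu> = n"

definition mult_part :: "nat \<Rightarrow> nat list \<Rightarrow> nat" where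
  "mult_part i \<nu> = count_list \<nu> i"

definition n_stat :: "nat list \<Rightarrow> nat" where
  "n_stat \<nu> = (\<Sum>i<length \<nu>. i * \<nu> ! i)"

definition t_int :: "'a::field \<Rightarrow> nat \<Rightarrow> 'a" where
  "t_int t r = (1 - t ^ r) / (1 - t)"

definition t_fact :: "'a::field \<Rightarrow> nat \<Rightarrow> 'a" where
  "t_fact t r = (\<Prod>i=1..r. t_int t i)"

section \<open>Formal power series in countably many variables\<close>

text \<open>
  A series in \<open>x\<^sub>0, x\<^sub>1, \<dots>\<close> is the family of its coefficients; the finitely supported
  exponent vector \<open>m\<close> stands for the monomial \<open>\<Prod>\<^sub>i x\<^sub>i\<^bsup>m i\<^esup>\<close>.  Symmetric functions are the
  symmetric series of bounded degree.
\<close>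

typedef 'a mseries = "UNIV :: ((nat \<Rightarrow>\<^sub>0 nat) \<Rightarrow> 'a) set"
  morphisms mcoeff MSeries by simp

setup_lifting type_definition_mseries

lemma mseries_eqI: "(\<And>m. mcoeff f m = mcoeff g m) \<Longrightarrow> f = g"
  by transfer auto

lemma finite_splits: "finite {(a, b). a + b = (m :: nat \<Rightarrow>\<^sub>0 nat)}"
proof -
  let ?F = "{f. \<forall>x.
    (x \<in> Poly_Mapping.keys m \<longrightarrow> f x \<in> {..Max (Poly_Mapping.lookup m ` Poly_Mapping.keys m)}) \<and>
    (x \<notin> Poly_Mapping.keys m \<longrightarrow> f x = (0::nat))}"
  have fin: "finite ?F"
    by (rule finite_set_of_finite_funs) auto
  have "Poly_Mapping.lookup a \<in> ?F" if "a + b = m" for a b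
  proof -
    have le: "Poly_Mapping.lookup a x \<le> Poly_Mapping.lookup m x" for x
      using that by (auto simp: lookup_add)
    show ?thesis
    proof safe
      fix x assume "x \<in> Poly_Mapping.keys m"
      hence "Poly_Mapping.lookup m x \<le> Max (Poly_Mapping.lookup m ` Poly_Mapping.keys m)" by (intro Max_ge) auto
      with le[of x] show "Poly_Mapping.lookup a x \<le> Max (Poly_Mapping.lookup m ` Poly_Mapping.keys m)" by simp
    next
      fix x assume "x \<notin> Poly_Mapping.keys m"
      hence "Poly_Mapping.lookup m x = 0" by (simp add: in_keys_iff)
      with le[of x] show "Poly_Mapping.lookup a x = 0" by simp
    qed
  qed
  hence "{a. \<exists>b. a + b = m} \<subseteq> Poly_Mapping.lookup -` ?F" by auto
  moreover have "finite (Poly_Mapping.lookup -` ?F)"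
    by (rule finite_vimageI[OF fin]) (simp add: inj_on_def lookup_inject)
  ultimately have A: "finite {a. \<exists>b. a + b = m}" by (rule finite_subset)
  have "{(a, b). a + b = m} \<subseteq> (\<lambda>a. (a, m - a)) ` {a. \<exists>b. a + b = m}"
    by auto
  thus ?thesis using A by (meson finite_imageI finite_subset)
qed

instantiation mseries :: (comm_ring_1) comm_ring_1
begin

lift_definition zero_mseries :: "'a mseries" is "\<lambda>_. 0" .
lift_definition one_mseries :: "'a mseries" is "\<lambda>m. if m = 0 then 1 else 0" .
lift_definition plus_mseries :: "'a mseries \<Rightarrow> 'a mseries \<Rightarrow> 'a mseries"
  is "\<lambda>f g m. f m + g m" .
lift_definition minus_mseries :: "'a mseries \<Rightarrow> 'a mseries \<Rightarrow> 'a mseries"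
  is "\<lambda>f g m. f m - g m" .
lift_definition uminus_mseries :: "'a mseries \<Rightarrow> 'a mseries" is "\<lambda>f m. - f m" .
lift_definition times_mseries :: "'a mseries \<Rightarrow> 'a mseries \<Rightarrow> 'a mseries"
  is "\<lambda>f g m. \<Sum>(a, b) | a + b = m. f a * g b" .

instance
proof
  fix f g h :: "'a mseries"
  show "f * g * h = f * (g * h)"
  proof (transfer, rule ext)
    fix f g h :: "(nat \<Rightarrow>\<^sub>0 nat) \<Rightarrow> 'a" and m :: "nat \<Rightarrow>\<^sub>0 nat"
    let ?D = "\<lambda>m::nat \<Rightarrow>\<^sub>0 nat. {(a, b). a + b = m}"
    have "(\<Sum>(a, b)\<in>?D m. (\<Sum>(c, d)\<in>?D a. f c * g d) * h b) =
        (\<Sum>p\<in>?D m. \<Sum>q\<in>?D (fst p). f (fst q) * g (snd q) * h (snd p))"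
      by (simp add: case_prod_unfold sum_distrib_right)
    also have "\<dots> = (\<Sum>(p, q)\<in>(SIGMA p:?D m. ?D (fst p)). f (fst q) * g (snd q) * h (snd p))"
      by (rule sum.Sigma) (simp_all add: finite_splits)
    also have "\<dots> = (\<Sum>(p, q)\<in>(SIGMA p:?D m. ?D (snd p)). f (fst p) * (g (fst q) * h (snd q)))"
      by (rule sum.reindex_bij_witness[of _
            "\<lambda>(p, q). ((fst p + fst q, snd q), (fst p, fst q))"
            "\<lambda>(p, q). ((fst q, snd q + snd p), (snd q, snd p))"])
        (auto simp: ac_simps)
    also have "\<dots> = (\<Sum>p\<in>?D m. \<Sum>q\<in>?D (snd p). f (fst p) * (g (fst q) * h (snd q)))"
      by (rule sum.Sigma[symmetric]) (simp_all add: finite_splits)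
    also have "\<dots> = (\<Sum>(a, b)\<in>?D m. f a * (\<Sum>(c, d)\<in>?D b. g c * h d))"
      by (simp add: case_prod_unfold sum_distrib_left)
    finally show "(\<Sum>(a, b)\<in>?D m. (\<Sum>(c, d)\<in>?D a. f c * g d) * h b) =
      (\<Sum>(a, b)\<in>?D m. f a * (\<Sum>(c, d)\<in>?D b. g c * h d))" .
  qed
  show "f * g = g * f"
  proof (transfer, rule ext)
    fix f g :: "(nat \<Rightarrow>\<^sub>0 nat) \<Rightarrow> 'a" and m :: "nat \<Rightarrow>\<^sub>0 nat"
    show "(\<Sum>(a, b) | a + b = m. f a * g b) = (\<Sum>(a, b) | a + b = m. g a * f b)"
      by (rule sum.reindex_bij_witness[of _ prod.swap prod.swap]) (auto simp: ac_simps)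
  qed
  show "1 * f = f"
  proof (transfer, rule ext)
    fix f :: "(nat \<Rightarrow>\<^sub>0 nat) \<Rightarrow> 'a" and m :: "nat \<Rightarrow>\<^sub>0 nat"
    have "(\<Sum>(a, b) | a + b = m. (if a = 0 then 1 else 0) * f b) =
        (\<Sum>(a, b)\<in>{(0 :: nat \<Rightarrow>\<^sub>0 nat, m)}. (if a = 0 then 1 else 0) * f b)"
      by (rule sum.mono_neutral_right[OF finite_splits]) (auto split: if_split_asm)
    thus "(\<Sum>(a, b) | a + b = m. (if a = 0 then 1 else 0) * f b) = f m" by simp
  qed
  show "(f + g) * h = f * h + g * h"
    by transfer (simp add: case_prod_unfold distrib_right sum.distrib)
  show "(0 :: 'a mseries) \<noteq> 1"
    by transfer (auto simp: fun_eq_iff)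
qed (transfer; simp add: fun_eq_iff algebra_simps)+

end

lift_definition mconst :: "'a::zero \<Rightarrow> 'a mseries" is "\<lambda>c m. if m = 0 then c else 0" .

section \<open>Polynomials in countably many variables\<close>

type_synonym 'a mpol = "(nat \<Rightarrow>\<^sub>0 nat) \<Rightarrow>\<^sub>0 'a"

definition mp_var :: "nat \<Rightarrow> 'a::comm_ring_1 mpol" where
  "mp_var i = Poly_Mapping.single (Poly_Mapping.single i 1) 1"

definition mp_const :: "'a::comm_ring_1 \<Rightarrow> 'a mpol" where
  "mp_const c = Poly_Mapping.single 0 c"

definition mp_eval :: "(nat \<Rightarrow> 'a mseries) \<Rightarrow> 'a::comm_ring_1 mpol \<Rightarrow> 'a mseries" where
  "mp_eval y F =
     (\<Sum>m\<in>Poly_Mapping.keys F. mconst (Poly_Mapping.lookup F m) *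
       (\<Prod>r\<in>Poly_Mapping.keys m. y r ^ Poly_Mapping.lookup m r))"

section \<open>Power sums and the substitution \<open>f \<mapsto> f[(1 - t)X]\<close>\<close>

lift_definition power_sum :: "nat \<Rightarrow> 'a::comm_ring_1 mseries" is
  "\<lambda>r m. if \<exists>i. m = Poly_Mapping.single i r then 1 else 0" .

text \<open>
  Over a field of characteristic 0 every symmetric function is a unique polynomial \<open>F\<close> in
  \<open>p\<^sub>1, p\<^sub>2, \<dots>\<close>.  The variables of \<open>F\<close> are numbered from 0, hence the shift.
\<close>

definition pleth_1mt :: "'a::field \<Rightarrow> 'a mseries \<Rightarrow> 'a mseries" where
  "pleth_1mt t f = (THE g. \<exists>F.
     f = mp_eval (\<lambda>r. power_sum (Suc r)) F \<and>
     g = mp_eval (\<lambda>r. mconst (1 - t ^ Suc r) * power_sum (Suc r)) F)"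

section \<open>Schur functions\<close>

definition diagram :: "nat list \<Rightarrow> (nat \<times> nat) set" where
  "diagram \<mu> = {(i, j). i < length \<mu> \<and> j < \<mu> ! i}"

text \<open>Tableaux vanish outside their diagram, so that distinct functions are distinct tableaux.\<close>

definition ssyt :: "nat list \<Rightarrow> (nat \<times> nat \<Rightarrow> nat) set" where
  "ssyt \<mu> = {T.
     (\<forall>c. c \<notin> diagram \<mu> \<longrightarrow> T c = 0) \<and>
     (\<forall>i j. (i, Suc j) \<in> diagram \<mu> \<longrightarrow> T (i, j) \<le> T (i, Suc j)) \<and>
     (\<forall>i j. (Suc i, j) \<in> diagram \<mu> \<longrightarrow> T (i, j) < T (Suc i, j))}"

lift_definition schur :: "nat list \<Rightarrow> 'a::comm_ring_1 mseries" is
  "\<lambda>\<mu> m. of_nat (card {T \<in> ssyt \<mu>.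
     \<forall>k. card {c \<in> diagram \<mu>. T c = k} = Poly_Mapping.lookup m k})" .

section \<open>Hall--Littlewood functions\<close>

text \<open>
  The symmetrization
  \<open>\<Sum>\<^bsub>w \<in> S\<^sub>N\<^esub> w(x\<^sup>\<mu> \<Prod>\<^bsub>i<j\<^esub> (x\<^sub>i - t x\<^sub>j) / (x\<^sub>i - x\<^sub>j))\<close> in \<open>N \<ge> \<ell>(\<mu>)\<close> variables, a
  priori a rational function.
\<close>

definition HL_sym :: "'a::field \<Rightarrow> nat \<Rightarrow> nat list \<Rightarrow> 'a mpol fract" where
  "HL_sym t N \<mu> = (\<Sum>w | w permutes {..<N}.
     (\<Prod>i<length \<mu>. to_fract (mp_var (w i)) ^ (\<mu> ! i)) *
     (\<Prod>(i, j) | i < j \<and> j < N.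
        to_fract (mp_var (w i) - mp_const t * mp_var (w j)) /
        to_fract (mp_var (w i) - mp_var (w j))))"

text \<open>
  \<open>v\<^sub>\<mu>(t) = \<Prod>\<^bsub>i\<ge>0\<^esub> v\<^bsub>m\<^sub>i\<^esub>(t)\<close> with \<open>v\<^sub>m(t) = \<Prod>\<^bsub>i=1..m\<^esub> (1 - t\<^sup>i) / (1 - t)\<close>; the number
  of zero parts of \<open>\<mu>\<close> is \<open>m\<^sub>0 = N - \<ell>(\<mu>)\<close>.
\<close>

definition HL_v :: "'a::field \<Rightarrow> nat \<Rightarrow> nat list \<Rightarrow> 'a" where
  "HL_v t N \<mu> = t_fact t (N - length \<mu>) * (\<Prod>i\<in>set \<mu>. t_fact t (mult_part i \<mu>))"

definition HL_P_fin :: "'a::field \<Rightarrow> nat \<Rightarrow> nat list \<Rightarrow> 'a mpol" where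
  "HL_P_fin t N \<mu> = (THE F. to_fract F = HL_sym t N \<mu> / to_fract (mp_const (HL_v t N \<mu>)))"

text \<open>
  The polynomials \<open>P\<^sub>\<mu>(x\<^sub>0, \<dots>, x\<^bsub>N-1\<^esub>; t)\<close>, \<open>N \<ge> \<ell>(\<mu>)\<close>, are stable under setting the last
  variable to 0, so a coefficient of their limit can be read off as soon as all variables of
  its monomial are present.
\<close>

lift_definition HL_P :: "'a::field \<Rightarrow> nat list \<Rightarrow> 'a mseries" is
  "\<lambda>t \<mu> m. Poly_Mapping.lookup
     (HL_P_fin t (LEAST N. length \<mu> \<le> N \<and> Poly_Mapping.keys m \<subseteq> {..<N}) \<mu>) m" .

definition HL_b :: "'a::field \<Rightarrow> nat list \<Rightarrow> 'a" where
  "HL_b t \<mu> = (\<Prod>i\<in>set \<mu>. \<Prod>j=1..mult_part i \<mu>. 1 - t ^ j)"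

definition HL_Q :: "'a::field \<Rightarrow> nat list \<Rightarrow> 'a mseries" where
  "HL_Q t \<mu> = mconst (HL_b t \<mu>) * HL_P t \<mu>"

section \<open>The coefficients \<open>\<K>\<^bsub>\<lambda>,\<nu>\<^esub>(t)\<close>\<close>

text \<open>
  The family \<open>(\<K>\<^bsub>\<lambda>,\<nu>\<^esub>(t))\<^sub>\<nu>\<close> of coefficients in the basis of Hall--Littlewood \<open>Q\<close>-functions,
  extended by 0 to lists \<open>\<nu>\<close> that are not partitions.
\<close>

definition HL_K :: "'a::field \<Rightarrow> nat list \<Rightarrow> nat list \<Rightarrow> 'a" where
  "HL_K t \<mu> = (THE c.
     finite {\<nu>. c \<nu> \<noteq> 0} \<and> (\<forall>\<nu>. c \<nu> \<noteq> 0 \<longrightarrow> is_partition \<nu>) \<and>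
     pleth_1mt t (schur \<mu>) = (\<Sum>\<nu> | c \<nu> \<noteq> 0. mconst (c \<nu>) * HL_Q t \<nu>))"

text \<open>The indeterminate \<open>t\<close> of the coefficient field \<open>\<rat>(t)\<close>.\<close>

definition t_var :: "rat poly fract" where
  "t_var = to_fract [:0, 1:]"

end

(*
  For a set A of variables put W(S, A - S) = prod (x_a - t x_b) / (x_a - x_b) over a in S and b in A - S.
  Symmetrizing first over the variables that carry the first column of nu gives, with k the length of nu,
    P_nu(A) = sum over S in A with |S| = k of (prod_{a in S} x_a) W(S, A - S) P_mu(S),
  where mu is nu without its first column.  Together with the identity
    sum over S in A of prod_{j < |S|} (t^j - y) W(S, A - S) prod_{a in S} x_a prod_{b in A - S} (1 - x_b)
      = prod_{a in A} (1 - y x_a)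
  this yields, by induction on the degree,
    sum over nu of t^n(nu) prod_{j < l(nu)} (1 - y t^(-j)) P_nu = prod_a (1 - y x_a) / (1 - x_a).
  At y = 1/t and x_a replaced by -t x_a the right side is prod_a (1 + x_a) / (1 + t x_a), which is the
  generating function of e_n[(1 - t) X] by the Newton identities, and e_n is the Schur function of (1^n).
  The case y = t shows that the rows Q_(m) are polynomials that are stable in the number of variables;
  removing a variable a from Q_(m) costs only powers of x_a, so all P_nu lie in the algebra they generate.
*)

theory Submission
  imports Defs "HOL-Combinatorics.Multiset_Permutations" "HOL-Computational_Algebra.Computational_Algebra"
begin

text \<open>The polynomials P, the substitution and the coefficients K are all given by definite
  descriptions, so beside the generating function four facts are needed: the symmetrization divided
  by v_\<mu> is a polynomial, its coefficients do not depend on the number of variables, the power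
  sums are algebraically independent, and the Q_\<nu> are linearly independent. The weights W have
  denominators, so the computation takes place in the fraction field, with finite sets of variables
  as arguments instead of a number N: deleting a variable or passing to a subset S is then a change
  of argument. The relation \<open>represents\<close> carries results over to series.

  The parameter y stays free because three values occur. For y = 0 the sum over \<nu> has the shape
  of the sums over \<mu> that remain after the first column is removed, which closes the induction.
  The value t isolates single rows. The value 1/t is the one of the theorem: up to a power of -1/t
  and the factor (1 - t)^k, which is part of b_\<nu>, the product of the t^j - 1/t is the
  t-factorial of k, the numerator of the formula.\<close>

section \<open>Partial fractions and the subset identity\<close>

text \<open>As a function of X the product has simple poles only and tends to
  \<open>\<alpha> ^ card S\<close> at infinity; the sum collects its polar parts. The numerators are
  general so that both t X - x s and X - t x s are covered.\<close>

lemma partial_fractions: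
  fixes x \<beta> :: "'i \<Rightarrow> 'b::field"
  assumes "finite S" "inj_on x S" "X \<notin> x ` S"
  shows "(\<Prod>s\<in>S. (\<alpha> * X + \<beta> s) / (X - x s)) = \<alpha> ^ card S +
    (\<Sum>s\<in>S. (\<alpha> * x s + \<beta> s) / (X - x s) * (\<Prod>r\<in>S - {s}. (\<alpha> * x s + \<beta> r) / (x s - x r)))"
  using assms
proof (induction S arbitrary: X rule: finite_induct)
  case empty
  then show ?case by simp
next
  case (insert c S)
  define R where "R s = (\<alpha> * x s + \<beta> s) * (\<Prod>r\<in>S - {s}. (\<alpha> * x s + \<beta> r) / (x s - x r))" for s
  \<comment> \<open>The hypothesis is needed at two points: at X itself, and at \<open>x c\<close>,
    where it gives the residue at the new pole.\<close>
  have IH: "(\<Prod>s\<in>S. (\<alpha> * Y + \<beta> s) / (Y - x s)) = \<alpha> ^ card S + (\<Sum>s\<in>S. R s / (Y - x s))"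
    if "Y \<notin> x ` S" for Y
    using insert.IH[of Y] that insert.prems by (simp add: R_def inj_on_insert)
  have xc: "x c \<notin> x ` S" and Xc: "X \<noteq> x c" and XS: "X \<notin> x ` S"
    using insert.prems insert.hyps by (auto simp: inj_on_def)
  let ?g = "\<alpha> * x c + \<beta> c"
  have step: "(\<alpha> * X + \<beta> c) / (X - x c) * (R s / (X - x s)) =
      R s * ((\<alpha> * x s + \<beta> c) / (x s - x c)) / (X - x s) + ?g / (X - x c) * (R s / (x c - x s))"
    if "s \<in> S" for s
  proof -
    have ne: "X - x s \<noteq> 0" "x c - x s \<noteq> 0" "X - x c \<noteq> 0"
      using that xc XS Xc by auto
    have e: "x s - x c = - (x c - x s)" by simp
    show ?thesis using ne unfolding e
      by (simp add: divide_simps del: minus_diff_eq) (simp add: algebra_simps)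
  qed
  have lead: "(\<alpha> * X + \<beta> c) / (X - x c) = \<alpha> + ?g / (X - x c)"
    using Xc by (simp add: divide_simps) (simp add: algebra_simps)
  have "(\<Prod>s\<in>insert c S. (\<alpha> * X + \<beta> s) / (X - x s)) =
      (\<alpha> * X + \<beta> c) / (X - x c) * (\<alpha> ^ card S + (\<Sum>s\<in>S. R s / (X - x s)))"
    using insert.hyps IH[OF XS] by simp
  also have "\<dots> = (\<alpha> * X + \<beta> c) / (X - x c) * \<alpha> ^ card S +
      (\<Sum>s\<in>S. (\<alpha> * X + \<beta> c) / (X - x c) * (R s / (X - x s)))"
    by (simp add: distrib_left sum_distrib_left)
  also have "(\<Sum>s\<in>S. (\<alpha> * X + \<beta> c) / (X - x c) * (R s / (X - x s))) =
      (\<Sum>s\<in>S. R s * ((\<alpha> * x s + \<beta> c) / (x s - x c)) / (X - x s)) +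
      ?g / (X - x c) * (\<Sum>s\<in>S. R s / (x c - x s))"
    unfolding sum_distrib_left sum.distrib[symmetric] by (intro sum.cong refl step)
  also have "(\<alpha> * X + \<beta> c) / (X - x c) * \<alpha> ^ card S + \<dots> = \<alpha> ^ Suc (card S) +
      ?g / (X - x c) * (\<alpha> ^ card S + (\<Sum>s\<in>S. R s / (x c - x s))) +
      (\<Sum>s\<in>S. R s * ((\<alpha> * x s + \<beta> c) / (x s - x c)) / (X - x s))"
    unfolding lead by (simp only: distrib_left distrib_right power_Suc add_ac)
  also have "\<alpha> ^ card S + (\<Sum>s\<in>S. R s / (x c - x s)) = (\<Prod>s\<in>S. (\<alpha> * x c + \<beta> s) / (x c - x s))"
    using IH[OF xc] by simp
  also have "(\<Sum>s\<in>S. R s * ((\<alpha> * x s + \<beta> c) / (x s - x c)) / (X - x s)) =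
     (\<Sum>s\<in>S. (\<alpha> * x s + \<beta> s) / (X - x s) * (\<Prod>r\<in>insert c S - {s}. (\<alpha> * x s + \<beta> r) / (x s - x r)))"
  proof (rule sum.cong[OF refl])
    fix s assume "s \<in> S"
    then have "insert c S - {s} = insert c (S - {s})" "c \<notin> S - {s}" using insert.hyps by auto
    then show "R s * ((\<alpha> * x s + \<beta> c) / (x s - x c)) / (X - x s) =
      (\<alpha> * x s + \<beta> s) / (X - x s) * (\<Prod>r\<in>insert c S - {s}. (\<alpha> * x s + \<beta> r) / (x s - x r))"
      using insert.hyps by (simp add: R_def mult_ac)
  qed
  finally show ?case using insert.hyps by (simp add: insert_Diff_if)
qed

section \<open>Weights between two sets of variables and their sums\<close>

definition hl_weight :: "'b::field \<Rightarrow> ('i \<Rightarrow> 'b) \<Rightarrow> 'i set \<Rightarrow> 'i set \<Rightarrow> 'b" where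
  "hl_weight t x S T = (\<Prod>a\<in>S. \<Prod>b\<in>T. (x a - t * x b) / (x a - x b))"

lemma hl_weight_empty [simp]: "hl_weight t x {} T = 1" "hl_weight t x S {} = 1"
  by (simp_all add: hl_weight_def)

lemma hl_weight_insert_left:
  "finite S \<Longrightarrow> a \<notin> S \<Longrightarrow> hl_weight t x (insert a S) T = hl_weight t x {a} T * hl_weight t x S T"
  by (simp add: hl_weight_def)

lemma hl_weight_insert_right:
  "finite T \<Longrightarrow> b \<notin> T \<Longrightarrow> hl_weight t x S (insert b T) = hl_weight t x S {b} * hl_weight t x S T"
  unfolding hl_weight_def prod.distrib[symmetric] by (intro prod.cong refl) simp

lemma hl_weight_union_right:
  "finite T \<Longrightarrow> finite T' \<Longrightarrow> T \<inter> T' = {} \<Longrightarrow>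
    hl_weight t x S (T \<union> T') = hl_weight t x S T * hl_weight t x S T'"
  by (simp add: hl_weight_def prod.union_disjoint prod.distrib)

text \<open>The constant is the limit for X at infinity, where every factor tends to t; in the
  mirrored lemma below every factor tends to 1. The residues are again weights, now within
  S.\<close>

lemma hl_weight_partial_fractions_left:
  assumes "finite S" "inj_on x S" "X \<notin> x ` S"
  shows "(\<Prod>s\<in>S. (x s - t * X) / (x s - X)) =
    t ^ card S + (\<Sum>s\<in>S. (1 - t) * x s / (x s - X) * hl_weight t x (S - {s}) {s})"
proof -
  have "(\<Prod>s\<in>S. (x s - t * X) / (x s - X)) = (\<Prod>s\<in>S. (t * X + - x s) / (X - x s))"
    by (intro prod.cong refl) (simp add: divide_simps, simp add: algebra_simps)
  also have "\<dots> = t ^ card S + (\<Sum>s\<in>S. (t * x s + - x s) / (X - x s) *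
      (\<Prod>r\<in>S - {s}. (t * x s + - x r) / (x s - x r)))"
    by (rule partial_fractions[OF assms])
  also have "(\<Sum>s\<in>S. (t * x s + - x s) / (X - x s) * (\<Prod>r\<in>S - {s}. (t * x s + - x r) / (x s - x r))) =
      (\<Sum>s\<in>S. (1 - t) * x s / (x s - X) * hl_weight t x (S - {s}) {s})"
  proof (rule sum.cong[OF refl])
    fix s assume "s \<in> S"
    have "(t * x s + - x s) / (X - x s) = (1 - t) * x s / (x s - X)"
      by (simp add: divide_simps, simp add: algebra_simps)
    moreover have "(\<Prod>r\<in>S - {s}. (t * x s + - x r) / (x s - x r)) = hl_weight t x (S - {s}) {s}"
      unfolding hl_weight_def
      by (intro prod.cong refl) (simp add: divide_simps, simp add: algebra_simps)
    ultimately show "(t * x s + - x s) / (X - x s) * (\<Prod>r\<in>S - {s}. (t * x s + - x r) / (x s - x r)) =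
      (1 - t) * x s / (x s - X) * hl_weight t x (S - {s}) {s}" by simp
  qed
  finally show ?thesis .
qed

lemma hl_weight_partial_fractions_right:
  assumes "finite S" "inj_on x S" "X \<notin> x ` S"
  shows "(\<Prod>s\<in>S. (X - t * x s) / (X - x s)) =
    1 + (\<Sum>s\<in>S. (1 - t) * x s / (X - x s) * hl_weight t x {s} (S - {s}))"
proof -
  have "(\<Prod>s\<in>S. (1 * X + - (t * x s)) / (X - x s)) = 1 ^ card S +
      (\<Sum>s\<in>S. (1 * x s + - (t * x s)) / (X - x s) * (\<Prod>r\<in>S - {s}. (1 * x s + - (t * x r)) / (x s - x r)))"
    by (rule partial_fractions[OF assms])
  then show ?thesis by (simp add: hl_weight_def left_diff_distrib)
qed

text \<open>Evaluation of the partial fractions at X = 0, where every factor of the product is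
  1.\<close>

lemma sum_hl_weight_right:
  assumes "finite S" "inj_on x S" "0 \<notin> x ` S"
  shows "(1 - t) * (\<Sum>s\<in>S. hl_weight t x (S - {s}) {s}) = 1 - t ^ card S"
proof -
  have "(\<Prod>s\<in>S. (x s - t * 0) / (x s - 0)) =
    t ^ card S + (\<Sum>s\<in>S. (1 - t) * x s / (x s - 0) * hl_weight t x (S - {s}) {s})"
    by (rule hl_weight_partial_fractions_left[OF assms])
  moreover have "(\<Prod>s\<in>S. (x s - t * 0) / (x s - 0)) = 1"
    using assms by (intro prod.neutral) auto
  moreover have "(\<Sum>s\<in>S. (1 - t) * x s / (x s - 0) * hl_weight t x (S - {s}) {s}) =
     (\<Sum>s\<in>S. (1 - t) * hl_weight t x (S - {s}) {s})"
    using assms by (intro sum.cong) auto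
  ultimately show ?thesis by (simp add: sum_distrib_left algebra_simps)
qed

text \<open>Evaluation at X = 0, where every factor of the product is t. For t \<noteq> 1 the sum is
  therefore the t-integer of \<open>card S\<close>; iterated, it produces the t-factorials of
  v_\<mu>.\<close>

lemma sum_hl_weight_left:
  assumes "finite S" "inj_on x S" "0 \<notin> x ` S"
  shows "(1 - t) * (\<Sum>s\<in>S. hl_weight t x {s} (S - {s})) = 1 - t ^ card S"
proof -
  have "(\<Prod>s\<in>S. (0 - t * x s) / (0 - x s)) =
    1 + (\<Sum>s\<in>S. (1 - t) * x s / (0 - x s) * hl_weight t x {s} (S - {s}))"
    by (rule hl_weight_partial_fractions_right[OF assms])
  moreover have "(\<Prod>s\<in>S. (0 - t * x s) / (0 - x s)) = (\<Prod>s\<in>S. t)"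
    using assms by (intro prod.cong) auto
  moreover have "(\<Sum>s\<in>S. (1 - t) * x s / (0 - x s) * hl_weight t x {s} (S - {s})) =
     - (\<Sum>s\<in>S. (1 - t) * hl_weight t x {s} (S - {s}))"
    using assms unfolding sum_negf[symmetric] by (intro sum.cong) auto
  ultimately show ?thesis by (simp add: sum_distrib_left algebra_simps)
qed

text \<open>This is t^(k choose 2) times the product of the 1 - y t^(-j) over j < k, freed of
  negative powers. The factor t^(k choose 2) is what a first column of length k contributes to
  \<open>t ^ n_stat \<nu>\<close>.\<close>

definition subset_coeff :: "'b::field \<Rightarrow> 'b \<Rightarrow> nat \<Rightarrow> 'b" where
  "subset_coeff t y k = (\<Prod>j<k. t ^ j - y)"

lemma subset_coeff_0 [simp]: "subset_coeff t y 0 = 1"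
  and subset_coeff_Suc: "subset_coeff t y (Suc k) = subset_coeff t y k * (t ^ k - y)"
  by (simp_all add: subset_coeff_def)

lemma sum_Pow_insert:
  assumes "finite B" "a \<notin> B"
  shows "(\<Sum>S\<in>Pow (insert a B). f S) = (\<Sum>S\<in>Pow B. f S) + (\<Sum>S\<in>Pow B. f (insert a S))"
proof -
  have "(\<Sum>S\<in>Pow (insert a B). f S) = (\<Sum>S\<in>Pow B. f S) + (\<Sum>S\<in>insert a ` Pow B. f S)"
    unfolding Pow_insert using assms by (intro sum.union_disjoint) auto
  also have "(\<Sum>S\<in>insert a ` Pow B. f S) = (\<Sum>S\<in>Pow B. f (insert a S))"
    using assms(2) by (subst sum.reindex) (auto simp: inj_on_def dest!: insert_ident[THEN iffD1, rotated -1])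
  finally show ?thesis .
qed

text \<open>
  Regarded as a function of one variable \<open>x\<^sub>a = X\<close>, the left side is evaluated by partial
  fractions.  The pole at \<open>X = x\<^sub>b\<close> of the term of \<open>S \<ni> b\<close> cancels that of the term of
  \<open>S - {b} \<union> {a}\<close>, leaving a constant.
\<close>

lemma hl_weight_subset_identity:
  fixes x :: "'i \<Rightarrow> 'b::field"
  assumes "finite A" "inj_on x A" "0 \<notin> x ` A"
  shows "(\<Sum>S\<in>Pow A. subset_coeff t y (card S) * hl_weight t x S (A - S) *
      (\<Prod>a\<in>S. x a) * (\<Prod>b\<in>A - S. 1 - x b)) = (\<Prod>a\<in>A. 1 - y * x a)"
  using assms
proof (induction A rule: finite_induct)
  case empty
  then show ?case by simp
next
  case (insert a B)
  define X where "X = x a"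
  have injB: "inj_on x B" and nzB: "0 \<notin> x ` B" and XB: "X \<notin> x ` B"
    using insert.prems insert.hyps by (auto simp: X_def inj_on_def)
  define c where "c k = subset_coeff t y k" for k
  define W where "W = hl_weight t x"
  define M where "M S = (\<Prod>a\<in>S. x a) * (\<Prod>b\<in>B - S. 1 - x b)" for S
  define G where "G S = W S (B - S) * M S" for S
  \<comment> \<open>Polar parts at X = x b: \<open>f S b\<close> for b in S comes from the term of
    S, and \<open>g S b\<close> for b outside S from the term of \<open>insert a S\<close>.\<close>
  define f where "f S b = c (card S) * (1 - X) * G S * ((1 - t) * x b / (x b - X) * W (S - {b}) {b})" for S b
  define g where "g S b = c (Suc (card S)) * X * G S * ((1 - t) * x b / (X - x b) * W {b} (B - S - {b}))" for S b
  let ?L = "\<lambda>A S. subset_coeff t y (card S) * hl_weight t x S (A - S) *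
      (\<Prod>a\<in>S. x a) * (\<Prod>b\<in>A - S. 1 - x b)"
  have finB: "finite S" if "S \<in> Pow B" for S using that insert.hyps finite_subset by auto
  have t1: "?L (insert a B) S = c (card S) * (1 - X) * G S * t ^ card S + (\<Sum>b\<in>S. f S b)"
    if S: "S \<in> Pow B" for S
  proof -
    have e: "insert a B - S = insert a (B - S)" and n: "a \<notin> B - S" "finite (B - S)"
      using S insert.hyps by auto
    have "W S {a} = t ^ card S + (\<Sum>s\<in>S. (1 - t) * x s / (x s - X) * W (S - {s}) {s})"
      using hl_weight_partial_fractions_left[OF finB[OF S], of x X t] S injB XB
      by (auto simp: W_def hl_weight_def X_def inj_on_subset)
    then have "c (card S) * (1 - X) * G S * W S {a} =
        c (card S) * (1 - X) * G S * t ^ card S + (\<Sum>b\<in>S. f S b)"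
      by (simp only: distrib_left f_def sum_distrib_left)
    moreover have "?L (insert a B) S = c (card S) * (1 - X) * G S * W S {a}"
      unfolding e G_def M_def W_def hl_weight_insert_right[OF n(2,1)] using n
      by (simp add: c_def X_def)
    ultimately show ?thesis by simp
  qed
  have t2: "?L (insert a B) (insert a S) = c (Suc (card S)) * X * G S + (\<Sum>b\<in>B - S. g S b)"
    if S: "S \<in> Pow B" for S
  proof -
    have e: "insert a B - insert a S = B - S" and n: "a \<notin> S"
      using S insert.hyps by auto
    have "W {a} (B - S) = 1 + (\<Sum>b\<in>B - S. (1 - t) * x b / (X - x b) * W {b} (B - S - {b}))"
      using hl_weight_partial_fractions_right[of "B - S" x X t] S insert.hyps injB XB
      by (auto simp: W_def hl_weight_def X_def inj_on_diff)
    then have "c (Suc (card S)) * X * G S * W {a} (B - S) =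
        c (Suc (card S)) * X * G S + (\<Sum>b\<in>B - S. g S b)"
      by (simp only: distrib_left g_def sum_distrib_left mult_1_right)
    moreover have "?L (insert a B) (insert a S) = c (Suc (card S)) * X * G S * W {a} (B - S)"
      unfolding e G_def M_def W_def hl_weight_insert_left[OF finB[OF S] n] using n finB[OF S]
      by (simp add: c_def X_def)
    ultimately show ?thesis by simp
  qed
  have pair: "f S b + g (S - {b}) b = c (card S) * G S * ((1 - t) * W (S - {b}) {b})"
    if S: "S \<in> Pow B" and b: "b \<in> S" for S b
  proof -
    note fS = finB[OF S]
    define N where "N = W (S - {b}) {b} * W {b} (B - S) * W (S - {b}) (B - S) *
      ((\<Prod>a\<in>S - {b}. x a) * (\<Prod>b\<in>B - S. 1 - x b))"
    have S1: "S = insert b (S - {b})" and S2: "B - (S - {b}) = insert b (B - S)"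
      and n: "b \<notin> S - {b}" "b \<notin> B - S" and S3: "B - (S - {b}) - {b} = B - S" using b S by auto
    have fin: "finite (S - {b})" "finite (B - S)" using fS insert.hyps by auto
    have cS: "Suc (card (S - {b})) = card S" by (rule card_Suc_Diff1[OF fS b])
    have W1: "W S (B - S) = W {b} (B - S) * W (S - {b}) (B - S)"
      unfolding W_def by (subst S1, rule hl_weight_insert_left) (use fin n in auto)
    have W2: "W (S - {b}) (B - (S - {b})) = W (S - {b}) {b} * W (S - {b}) (B - S)"
      unfolding W_def S2 by (rule hl_weight_insert_right) (use fin n in auto)
    have p1: "(\<Prod>a\<in>S. x a) = x b * (\<Prod>a\<in>S - {b}. x a)"
      using b fS by (simp add: prod.remove)
    have p2: "(\<Prod>b\<in>B - (S - {b}). 1 - x b) = (1 - x b) * (\<Prod>b\<in>B - S. 1 - x b)"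
      unfolding S2 using n fin by simp
    have G1: "G S * W (S - {b}) {b} = N * x b"
      by (simp add: G_def M_def W1 p1 N_def)
    have G2: "G (S - {b}) * W {b} (B - S) = N * (1 - x b)"
      by (simp add: G_def M_def W2 p2 N_def)
    have ne: "x b - X \<noteq> 0" "X - x b \<noteq> 0" using S b XB by auto
    have key: "(1 - X) * x b / (x b - X) + X * (1 - x b) / (X - x b) = 1"
    proof -
      have "X * (1 - x b) / (X - x b) = - (X * (1 - x b)) / (x b - X)"
        by (metis minus_diff_eq minus_divide_divide minus_minus)
      then have "(1 - X) * x b / (x b - X) + X * (1 - x b) / (X - x b) =
          ((1 - X) * x b - X * (1 - x b)) / (x b - X)"
        by (simp add: add_divide_distrib diff_divide_distrib)
      also have "(1 - X) * x b - X * (1 - x b) = x b - X" by (simp add: algebra_simps)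
      finally show ?thesis using ne by simp
    qed
    have "f S b = c (card S) * (1 - X) * ((1 - t) * x b / (x b - X)) * (G S * W (S - {b}) {b})"
      by (simp add: f_def ac_simps)
    also have "\<dots> = c (card S) * (1 - t) * (N * x b) * ((1 - X) * x b / (x b - X))"
      unfolding G1 by (simp add: ac_simps)
    finally have F: "f S b = c (card S) * (1 - t) * (N * x b) * ((1 - X) * x b / (x b - X))" .
    have "g (S - {b}) b = c (card S) * X * ((1 - t) * x b / (X - x b)) * (G (S - {b}) * W {b} (B - S))"
      by (simp add: g_def cS S3 ac_simps)
    also have "\<dots> = c (card S) * (1 - t) * (N * x b) * (X * (1 - x b) / (X - x b))"
      unfolding G2 by (simp add: ac_simps)
    finally have "f S b + g (S - {b}) b = c (card S) * (1 - t) * (N * x b) *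
       ((1 - X) * x b / (x b - X) + X * (1 - x b) / (X - x b))"
      unfolding F by (simp only: distrib_left)
    also have "\<dots> = c (card S) * (1 - t) * (G S * W (S - {b}) {b})"
      unfolding key G1 by simp
    finally show ?thesis by (simp add: ac_simps)
  qed
  have reindex: "(\<Sum>S\<in>Pow B. \<Sum>b\<in>B - S. g S b) = (\<Sum>S\<in>Pow B. \<Sum>b\<in>S. g (S - {b}) b)"
  proof -
    have "(\<Sum>S\<in>Pow B. \<Sum>b\<in>B - S. g S b) = (\<Sum>(S, b)\<in>(SIGMA S:Pow B. B - S). g S b)"
      using insert.hyps by (intro sum.Sigma) auto
    also have "\<dots> = (\<Sum>(S, b)\<in>(SIGMA S:Pow B. S). g (S - {b}) b)"
      by (rule sum.reindex_bij_witness[where i = "\<lambda>(S, b). (S - {b}, b)" and j = "\<lambda>(S, b). (insert b S, b)"])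
        auto
    also have "\<dots> = (\<Sum>S\<in>Pow B. \<Sum>b\<in>S. g (S - {b}) b)"
      using insert.hyps finB by (intro sum.Sigma[symmetric]) auto
    finally show ?thesis .
  qed
  have "(\<Sum>S\<in>Pow (insert a B). ?L (insert a B) S) =
     (\<Sum>S\<in>Pow B. ?L (insert a B) S) + (\<Sum>S\<in>Pow B. ?L (insert a B) (insert a S))"
    by (rule sum_Pow_insert[OF insert.hyps])
  also have "\<dots> = (\<Sum>S\<in>Pow B. c (card S) * (1 - X) * G S * t ^ card S) + (\<Sum>S\<in>Pow B. c (Suc (card S)) * X * G S)
     + (\<Sum>S\<in>Pow B. \<Sum>b\<in>S. f S b + g (S - {b}) b)"
    by (simp only: t1 t2 sum.distrib reindex sum.cong[OF refl t1] sum.cong[OF refl t2] add_ac cong: sum.cong)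
  also have "(\<Sum>S\<in>Pow B. \<Sum>b\<in>S. f S b + g (S - {b}) b) =
     (\<Sum>S\<in>Pow B. c (card S) * G S * (1 - t ^ card S))"
  proof (rule sum.cong[OF refl])
    fix S assume S: "S \<in> Pow B"
    have "(1 - t) * (\<Sum>s\<in>S. W (S - {s}) {s}) = 1 - t ^ card S"
      unfolding W_def using S injB nzB finB[OF S] by (intro sum_hl_weight_right) (auto intro: inj_on_subset)
    then show "(\<Sum>b\<in>S. f S b + g (S - {b}) b) = c (card S) * G S * (1 - t ^ card S)"
      by (simp only: pair[OF S] sum_distrib_left[symmetric] cong: sum.cong)
  qed
  \<comment> \<open>With k = card S the terms in t^k cancel: (1 - X) t^k + (t^k - y) X + (1 - t^k) =
    1 - y X. This is what dictates the factors of \<open>subset_coeff\<close>.\<close>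
  also have "(\<Sum>S\<in>Pow B. c (card S) * (1 - X) * G S * t ^ card S) + (\<Sum>S\<in>Pow B. c (Suc (card S)) * X * G S)
     + (\<Sum>S\<in>Pow B. c (card S) * G S * (1 - t ^ card S)) = (\<Sum>S\<in>Pow B. (1 - y * X) * ?L B S)"
    unfolding sum.distrib[symmetric]
    by (intro sum.cong refl) (simp add: c_def subset_coeff_Suc G_def M_def W_def algebra_simps)
  also have "\<dots> = (1 - y * X) * (\<Prod>a\<in>B. 1 - y * x a)"
    using insert.IH[OF injB nzB] by (simp add: sum_distrib_left[symmetric])
  finally show ?case using insert.hyps by (simp add: X_def)
qed

section \<open>The Hall--Littlewood symmetrization\<close>

text \<open>The symmetrization carried out one part at a time: a receives the first part and is
  weighted against all variables that are still free. Variables left without a part are not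
  permuted, so no division by the t-factorial for the zero parts is necessary.\<close>

primrec hl_sum :: "'b::field \<Rightarrow> ('i \<Rightarrow> 'b) \<Rightarrow> nat list \<Rightarrow> 'i set \<Rightarrow> 'b" where
  "hl_sum t x [] A = 1"
| "hl_sum t x (m # \<mu>) A =
     (\<Sum>a\<in>A. x a ^ m * hl_weight t x {a} (A - {a}) * hl_sum t x \<mu> (A - {a}))"

lemma hl_sum_eq_0:
  "finite A \<Longrightarrow> card A < length \<mu> \<Longrightarrow> hl_sum t x \<mu> A = 0"
proof (induction \<mu> arbitrary: A)
  case (Cons m \<mu>)
  have "hl_sum t x \<mu> (A - {a}) = 0" if "a \<in> A" for a
    using Cons.prems that card_Suc_Diff1[OF Cons.prems(1) that] by (intro Cons.IH) auto
  then show ?case by simp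
qed simp

lemma prod_pairs_Cons:
  fixes w :: "'i \<Rightarrow> 'i \<Rightarrow> 'b::comm_monoid_mult"
  assumes "distinct (d # ds)"
  shows "(\<Prod>(i, j) | i < j \<and> j < length (d # ds). w ((d # ds) ! i) ((d # ds) ! j)) =
    (\<Prod>b\<in>set ds. w d b) * (\<Prod>(i, j) | i < j \<and> j < length ds. w (ds ! i) (ds ! j))"
proof -
  let ?f = "\<lambda>(i, j). w ((d # ds) ! i) ((d # ds) ! j)"
  let ?P = "{(i, j). i < j \<and> j < length ds}"
  have fin: "finite ?P"
    by (rule finite_subset[of _ "{..<length ds} \<times> {..<length ds}"]) auto
  have "{(i, j). i < j \<and> j < length (d # ds)} =
      (\<lambda>j. (0, Suc j)) ` {..<length ds} \<union> (\<lambda>(i, j). (Suc i, Suc j)) ` ?P" (is "?L = ?A \<union> ?B")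
  proof (intro set_eqI iffI)
    fix p assume "p \<in> ?L"
    then obtain i j where p: "p = (i, Suc j)" "i < Suc j" "j < length ds"
      by (cases p; cases "snd p") auto
    show "p \<in> ?A \<union> ?B"
      using p by (cases i) (auto intro!: image_eqI[of _ _ "(i - 1, j)"])
  qed auto
  moreover have "prod ?f (?A \<union> ?B) = prod ?f ?A * prod ?f ?B"
    by (rule prod.union_disjoint) (use fin in auto)
  moreover have "prod ?f ?A = (\<Prod>j<length ds. w d (ds ! j))"
    by (subst prod.reindex) (auto simp: inj_on_def)
  moreover have "\<dots> = (\<Prod>b\<in>set ds. w d b)"
    using assms by (intro prod.reindex_bij_betw bij_betw_nth) auto
  moreover have "prod ?f ?B = (\<Prod>(i, j)\<in>?P. w (ds ! i) (ds ! j))"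
    by (subst prod.reindex) (auto simp: inj_on_def intro!: prod.cong)
  ultimately show ?thesis by simp
qed

text \<open>The successive choices of the recursion form a list without repetitions. With as many
  parts as variables these lists are all the orderings of A.\<close>

lemma hl_sum_eq_sum_permutations:
  assumes "finite A" "length \<nu> = card A"
  shows "hl_sum t x \<nu> A = (\<Sum>ds\<in>permutations_of_set A.
    (\<Prod>i<length \<nu>. x (ds ! i) ^ (\<nu> ! i)) *
    (\<Prod>(i, j) | i < j \<and> j < card A. (x (ds ! i) - t * x (ds ! j)) / (x (ds ! i) - x (ds ! j))))"
  using assms
proof (induction \<nu> arbitrary: A)
  case Nil
  then show ?case by simp
next
  case (Cons m \<nu>)
  let ?w = "\<lambda>a b. (x a - t * x b) / (x a - x b)"
  let ?term = "\<lambda>\<nu> N ds. (\<Prod>i<length \<nu>. x (ds ! i) ^ (\<nu> ! i)) *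
    (\<Prod>(i, j) | i < j \<and> j < N. ?w (ds ! i) (ds ! j))"
  have ne: "A \<noteq> {}" using Cons.prems by auto
  have "(\<Sum>ds\<in>permutations_of_set A. ?term (m # \<nu>) (card A) ds) =
      (\<Sum>a\<in>A. \<Sum>ds\<in>(#) a ` permutations_of_set (A - {a}). ?term (m # \<nu>) (card A) ds)"
    unfolding permutations_of_set_nonempty[OF ne]
    by (rule sum.UNION_disjoint) (use Cons.prems in auto)
  also have "\<dots> = (\<Sum>a\<in>A. \<Sum>ds\<in>permutations_of_set (A - {a}). ?term (m # \<nu>) (card A) (a # ds))"
    by (rule sum.cong[OF refl], subst sum.reindex) auto
  also have "\<dots> = (\<Sum>a\<in>A. x a ^ m * hl_weight t x {a} (A - {a}) * hl_sum t x \<nu> (A - {a}))"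
  proof (rule sum.cong[OF refl])
    fix a assume a: "a \<in> A"
    have c: "card (A - {a}) = length \<nu>" using Cons.prems a by simp
    have IH: "hl_sum t x \<nu> (A - {a}) =
        (\<Sum>ds\<in>permutations_of_set (A - {a}). ?term \<nu> (card (A - {a})) ds)"
      using Cons.prems c by (intro Cons.IH) auto
    have "?term (m # \<nu>) (card A) (a # ds) =
        x a ^ m * hl_weight t x {a} (A - {a}) * ?term \<nu> (card (A - {a})) ds"
      if ds: "ds \<in> permutations_of_set (A - {a})" for ds
    proof -
      have d: "set ds = A - {a}" "distinct ds" using permutations_of_setD[OF ds] by auto
      then have l: "length ds = card (A - {a})" "length (a # ds) = card A"
        using distinct_card[of ds] a Cons.prems c by auto
      have p: "(\<Prod>(i, j) | i < j \<and> j < length (a # ds). ?w ((a # ds) ! i) ((a # ds) ! j)) =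
        (\<Prod>b\<in>set ds. ?w a b) * (\<Prod>(i, j) | i < j \<and> j < length ds. ?w (ds ! i) (ds ! j))"
        using d by (intro prod_pairs_Cons) auto
      have q: "(\<Prod>i<length (m # \<nu>). x ((a # ds) ! i) ^ ((m # \<nu>) ! i)) =
        x a ^ m * (\<Prod>i<length \<nu>. x (ds ! i) ^ (\<nu> ! i))"
        unfolding length_Cons prod.lessThan_Suc_shift by simp
      show ?thesis unfolding q p[unfolded l] d(1) by (simp add: hl_weight_def ac_simps)
    qed
    then show "(\<Sum>ds\<in>permutations_of_set (A - {a}). ?term (m # \<nu>) (card A) (a # ds)) =
      x a ^ m * hl_weight t x {a} (A - {a}) * hl_sum t x \<nu> (A - {a})"
      unfolding IH sum_distrib_left by (intro sum.cong refl)
  qed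
  finally show ?case by simp
qed

lemma t_fact_Suc: "t_fact t (Suc j) = t_fact t j * t_int t (Suc j)"
  by (simp add: t_fact_def)

lemma t_fact_0 [simp]: "t_fact t 0 = 1"
  by (simp add: t_fact_def)

text \<open>When \<mu> is used up, exactly j variables are free, and handing a zero part to one of i
  free variables contributes the t-integer of i by \<open>sum_hl_weight_left\<close>.\<close>

lemma hl_sum_append_zeros:
  assumes "finite A" "inj_on x A" "0 \<notin> x ` A" "t \<noteq> 1" "card A = length \<mu> + j"
  shows "hl_sum t x (\<mu> @ replicate j 0) A = t_fact t j * hl_sum t x \<mu> A"
  using assms
proof (induction \<mu> arbitrary: A)
  case Nil
  then show ?case
  proof (induction j arbitrary: A)
    case 0
    then show ?case by simp
  next
    case (Suc j)
    have "hl_sum t x ([] @ replicate (Suc j) 0) A =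
        (\<Sum>a\<in>A. hl_weight t x {a} (A - {a}) * t_fact t j)"
      unfolding replicate_Suc append_Nil hl_sum.simps power_0 mult_1_left
    proof (intro sum.cong refl)
      fix a assume "a \<in> A"
      then have "hl_sum t x ([] @ replicate j 0) (A - {a}) = t_fact t j * hl_sum t x [] (A - {a})"
        using Suc.prems by (intro Suc.IH) (auto simp: inj_on_diff)
      then show "hl_weight t x {a} (A - {a}) * hl_sum t x (replicate j 0) (A - {a}) =
        hl_weight t x {a} (A - {a}) * t_fact t j" by simp
    qed
    also have "\<dots> = (\<Sum>a\<in>A. hl_weight t x {a} (A - {a})) * t_fact t j"
      by (simp add: sum_distrib_right)
    also have "(\<Sum>a\<in>A. hl_weight t x {a} (A - {a})) = t_int t (Suc j)"
      using sum_hl_weight_left[of A x t] Suc.prems by (simp add: t_int_def field_simps)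
    finally show ?case by (simp add: t_fact_Suc)
  qed
next
  case (Cons m \<mu>)
  have "hl_sum t x (\<mu> @ replicate j 0) (A - {a}) = t_fact t j * hl_sum t x \<mu> (A - {a})"
    if "a \<in> A" for a
    using Cons.prems that by (intro Cons.IH) (auto simp: inj_on_diff)
  then show ?case by (simp add: sum_distrib_left ac_simps)
qed

text \<open>S is the set of variables that receive a part. Their weights against the variables
  outside S do not depend on the order of choice and factor out, leaving the symmetrization inside
  S.\<close>

lemma hl_sum_map_Suc:
  assumes "finite A"
  shows "hl_sum t x (map Suc \<mu>) A = (\<Sum>S | S \<subseteq> A \<and> card S = length \<mu>.
    (\<Prod>a\<in>S. x a) * hl_weight t x S (A - S) * hl_sum t x \<mu> S)"
  using assms
proof (induction \<mu> arbitrary: A)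
  case Nil
  have "{S. S \<subseteq> A \<and> card S = length []} = {{}}"
    using Nil finite_subset by fastforce
  then show ?case by simp
next
  case (Cons m \<mu>)
  let ?w = "hl_weight t x"
  let ?g = "\<lambda>a S. x a ^ m * (x a * (\<Prod>a\<in>S. x a)) * (?w {a} (A - {a}) * ?w S (A - {a} - S)) * hl_sum t x \<mu> S"
  have finS: "finite S" if "S \<subseteq> A" for S using that Cons.prems finite_subset by auto
  have "hl_sum t x (map Suc (m # \<mu>)) A =
      (\<Sum>a\<in>A. \<Sum>S | S \<subseteq> A - {a} \<and> card S = length \<mu>. ?g a S)"
    using Cons.prems by (simp add: Cons.IH sum_distrib_left ac_simps)
  also have "\<dots> = (\<Sum>(a, S)\<in>(SIGMA a:A. {S. S \<subseteq> A - {a} \<and> card S = length \<mu>}). ?g a S)"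
    using Cons.prems by (intro sum.Sigma) auto
  \<comment> \<open>The pair of the first chosen variable and the set of the later ones is traded
    for the set of all chosen variables with its first one marked.\<close>
  also have "\<dots> = (\<Sum>(S, a)\<in>(SIGMA S:{S. S \<subseteq> A \<and> card S = length (m # \<mu>)}. S). ?g a (S - {a}))"
  proof (rule sum.reindex_bij_witness[where j = "\<lambda>(a, S). (insert a S, a)" and i = "\<lambda>(S, a). (a, S - {a})"])
    fix p assume "p \<in> (SIGMA a:A. {S. S \<subseteq> A - {a} \<and> card S = length \<mu>})"
    then obtain a S where p: "p = (a, S)" "a \<in> A" "S \<subseteq> A" "a \<notin> S" "card S = length \<mu>" by auto
    then have i: "insert a S - {a} = S" by auto
    with p finS[of S] show "(case case p of (a, S) \<Rightarrow> (insert a S, a) of (S, a) \<Rightarrow> (a, S - {a})) = p"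
      "(case p of (a, S) \<Rightarrow> (insert a S, a)) \<in> (SIGMA S:{S. S \<subseteq> A \<and> card S = length (m # \<mu>)}. S)"
      "(case case p of (a, S) \<Rightarrow> (insert a S, a) of (S, a) \<Rightarrow> ?g a (S - {a})) = (case p of (a, S) \<Rightarrow> ?g a S)"
      by auto
  next
    fix p assume "p \<in> (SIGMA S:{S. S \<subseteq> A \<and> card S = length (m # \<mu>)}. S)"
    then obtain a S where p: "p = (S, a)" "a \<in> S" "S \<subseteq> A" "card S = Suc (length \<mu>)" by auto
    with finS[of S] show "(case case p of (S, a) \<Rightarrow> (a, S - {a}) of (a, S) \<Rightarrow> (insert a S, a)) = p"
      "(case p of (S, a) \<Rightarrow> (a, S - {a})) \<in> (SIGMA a:A. {S. S \<subseteq> A - {a} \<and> card S = length \<mu>})"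
      by auto
  qed
  also have "\<dots> = (\<Sum>S | S \<subseteq> A \<and> card S = length (m # \<mu>). \<Sum>a\<in>S. ?g a (S - {a}))"
    using Cons.prems finS by (intro sum.Sigma[symmetric]) auto
  also have "\<dots> = (\<Sum>S | S \<subseteq> A \<and> card S = length (m # \<mu>).
    (\<Prod>a\<in>S. x a) * ?w S (A - S) * hl_sum t x (m # \<mu>) S)"
  proof (rule sum.cong[OF refl])
    fix S assume "S \<in> {S. S \<subseteq> A \<and> card S = length (m # \<mu>)}"
    then have S: "S \<subseteq> A" and fS: "finite S" using finS by auto
    have k: "?g a (S - {a}) = (\<Prod>a\<in>S. x a) * ?w S (A - S) *
        (x a ^ m * ?w {a} (S - {a}) * hl_sum t x \<mu> (S - {a}))" if a: "a \<in> S" for a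
    proof -
      have e: "A - {a} = (S - {a}) \<union> (A - S)" "A - {a} - (S - {a}) = A - S" using a S by auto
      have f: "?w {a} ((S - {a}) \<union> (A - S)) = ?w {a} (S - {a}) * ?w {a} (A - S)"
        by (rule hl_weight_union_right) (use fS Cons.prems in auto)
      have g: "?w S (A - S) = ?w {a} (A - S) * ?w (S - {a}) (A - S)"
        using hl_weight_insert_left[of "S - {a}" a t x "A - S"] a fS by (simp add: insert_absorb)
      have h: "(\<Prod>a\<in>S. x a) = x a * (\<Prod>a\<in>S - {a}. x a)"
        using a fS by (simp add: prod.remove)
      show ?thesis unfolding e(2) unfolding e(1) f g h by (simp add: ac_simps)
    qed
    show "(\<Sum>a\<in>S. ?g a (S - {a})) =
      (\<Prod>a\<in>S. x a) * ?w S (A - S) * hl_sum t x (m # \<mu>) S"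
      unfolding hl_sum.simps sum_distrib_left by (rule sum.cong[OF refl k])
  qed
  finally show ?case .
qed

section \<open>Partitions and their first column\<close>

text \<open>On diagrams this puts a column of height k to the left of \<mu>, for
  \<open>length \<mu> \<le> k\<close>; the missing rows of \<mu> count as zero parts.\<close>

definition add_column :: "nat \<Rightarrow> nat list \<Rightarrow> nat list" where
  "add_column k \<mu> = map Suc (\<mu> @ replicate (k - length \<mu>) 0)"

lemma decreasing_eq_append_zeros:
  "sorted_wrt (\<ge>) l \<Longrightarrow>
    l = filter (\<lambda>i. i \<noteq> 0) l @ replicate (length l - length (filter (\<lambda>i. i \<noteq> 0) l)) (0::nat)"
proof (induction l)
  case (Cons a l)
  show ?case
  proof (cases "a = 0")
    case True
    then have "\<forall>i\<in>set l. i = 0" using Cons.prems by auto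
    then have "filter (\<lambda>i. i \<noteq> 0) l = []" "l = replicate (length l) 0"
      by (auto simp: filter_empty_conv replicate_length_same)
    with True show ?thesis by simp
  next
    case False
    then show ?thesis using Cons by simp
  qed
qed simp

lemma length_le_sum_list: "0 \<notin> set \<nu> \<Longrightarrow> length \<nu> \<le> sum_list (\<nu> :: nat list)"
  by (induction \<nu>) auto

lemma partition_of_length_le: "partition_of n \<nu> \<Longrightarrow> length \<nu> \<le> n"
  unfolding partition_of_def is_partition_def using length_le_sum_list by auto

lemma finite_partition_of: "finite {\<nu>. partition_of n \<nu>}"
proof (rule finite_subset)
  show "{\<nu>. partition_of n \<nu>} \<subseteq> {\<nu>. set \<nu> \<subseteq> {..n} \<and> length \<nu> \<le> n}"
    using partition_of_length_le by (auto simp: partition_of_def member_le_sum_list)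
  show "finite {\<nu>. set \<nu> \<subseteq> {..n} \<and> length \<nu> \<le> n}"
    by (rule finite_lists_length_le) simp
qed

lemma partition_of_0_iff: "partition_of 0 \<nu> \<longleftrightarrow> \<nu> = []"
  using partition_of_length_le[of 0 \<nu>] by (auto simp: partition_of_def is_partition_def)

lemma length_add_column: "length \<mu> \<le> k \<Longrightarrow> length (add_column k \<mu>) = k"
  by (simp add: add_column_def)

lemma sum_list_map_Suc: "sum_list (map Suc l) = sum_list l + length l"
  by (induction l) auto

lemma sorted_wrt_replicate_same: "sorted_wrt (\<ge>) (replicate j (a :: nat))"
  by (induction j) auto

lemma partition_of_add_column:
  assumes "partition_of m \<mu>" "length \<mu> \<le> k"
  shows "partition_of (m + k) (add_column k \<mu>)"
  using assms
  by (auto simp: partition_of_def is_partition_def add_column_def sorted_wrt_map sorted_wrt_append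
      sorted_wrt_replicate_same sum_list_map_Suc simp del: map_append)

lemma partition_eq_add_column:
  assumes "partition_of n \<nu>"
  obtains \<mu> where "\<nu> = add_column (length \<nu>) \<mu>" "partition_of (n - length \<nu>) \<mu>" "length \<mu> \<le> length \<nu>"
proof -
  define l where "l = map (\<lambda>i. i - 1) \<nu>"
  \<comment> \<open>The parts equal to 1 have become 0 and stand at the end of the decreasing list
    l, so dropping them loses only their number.\<close>
  define \<mu> where "\<mu> = filter (\<lambda>i. i \<noteq> 0) l"
  have \<nu>: "sorted_wrt (\<ge>) \<nu>" "0 \<notin> set \<nu>" "sum_list \<nu> = n"
    using assms by (auto simp: partition_of_def is_partition_def)
  have "Suc (i - 1) = i" if "i \<in> set \<nu>" for i
  proof -
    have "i \<noteq> 0" using that \<nu>(2) by metis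
    then show ?thesis by simp
  qed
  then have l: "map Suc l = \<nu>" by (simp add: l_def map_idI)
  have s: "sorted_wrt (\<ge>) l"
    unfolding l_def sorted_wrt_map by (rule sorted_wrt_mono_rel[OF _ \<nu>(1)]) auto
  have len: "length l = length \<nu>" by (simp add: l_def)
  have e: "l = \<mu> @ replicate (length \<nu> - length \<mu>) 0"
    using decreasing_eq_append_zeros[OF s] by (simp add: \<mu>_def len)
  have 1: "length \<mu> \<le> length \<nu>" unfolding \<mu>_def using len length_filter_le[of _ l] by metis
  have "sum_list l + length \<nu> = n" using sum_list_map_Suc[of l] l \<nu>(3) len by simp
  moreover have "sum_list l = sum_list \<mu>" by (subst e) simp
  ultimately have "sum_list \<mu> = n - length \<nu>" by simp
  then have 2: "partition_of (n - length \<nu>) \<mu>"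
    using s by (auto simp: partition_of_def is_partition_def \<mu>_def sorted_wrt_filter)
  have "\<nu> = add_column (length \<nu>) \<mu>"
    unfolding add_column_def e[symmetric] l ..
  with 1 2 that show ?thesis by blast
qed

lemma add_column_inject:
  assumes "add_column k \<mu> = add_column k \<mu>'" "0 \<notin> set \<mu>" "0 \<notin> set \<mu>'"
  shows "\<mu> = \<mu>'"
proof -
  have f: "\<mu> = filter (\<lambda>i. i \<noteq> 0) (\<mu> @ replicate j 0)" if "0 \<notin> set \<mu>" for \<mu> :: "nat list" and j
    using that by (induction \<mu>) auto
  have "\<mu> @ replicate (k - length \<mu>) 0 = \<mu>' @ replicate (k - length \<mu>') 0"
    using assms(1) unfolding add_column_def inj_map_eq_map[OF inj_Suc] .
  then show ?thesis using f[OF assms(2)] f[OF assms(3)] by metis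
qed

lemma bij_betw_add_column:
  assumes "k \<le> n"
  shows "bij_betw (add_column k) {\<mu>. partition_of (n - k) \<mu> \<and> length \<mu> \<le> k}
    {\<nu>. partition_of n \<nu> \<and> length \<nu> = k}"
  unfolding bij_betw_def
proof (intro conjI set_eqI iffI)
  show "inj_on (add_column k) {\<mu>. partition_of (n - k) \<mu> \<and> length \<mu> \<le> k}"
    by (rule inj_onI, rule add_column_inject) (auto simp: partition_of_def is_partition_def)
next
  fix \<nu> assume "\<nu> \<in> add_column k ` {\<mu>. partition_of (n - k) \<mu> \<and> length \<mu> \<le> k}"
  then show "\<nu> \<in> {\<nu>. partition_of n \<nu> \<and> length \<nu> = k}"
    using assms partition_of_add_column[of "n - k" _ k] by (auto simp: length_add_column)
next
  fix \<nu> assume "\<nu> \<in> {\<nu>. partition_of n \<nu> \<and> length \<nu> = k}"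
  then have \<nu>: "partition_of n \<nu>" "length \<nu> = k" by auto
  from partition_eq_add_column[OF \<nu>(1)] obtain \<mu> where
    "\<nu> = add_column k \<mu>" "partition_of (n - k) \<mu>" "length \<mu> \<le> k" unfolding \<nu>(2) by blast
  then show "\<nu> \<in> add_column k ` {\<mu>. partition_of (n - k) \<mu> \<and> length \<mu> \<le> k}" by blast
qed

text \<open>The new column has one box in every row i < k, and a box in row i weighs i.\<close>

lemma n_stat_add_column:
  assumes "length \<mu> \<le> k"
  shows "n_stat (add_column k \<mu>) = n_stat \<mu> + (k choose 2)"
proof -
  let ?l = "\<mu> @ replicate (k - length \<mu>) 0"
  have "n_stat (add_column k \<mu>) = (\<Sum>i<k. i + i * ?l ! i)"
    unfolding n_stat_def length_add_column[OF assms]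
    by (intro sum.cong refl) (use assms in \<open>auto simp: add_column_def nth_append\<close>)
  also have "\<dots> = (\<Sum>i<k. i) + (\<Sum>i<k. i * ?l ! i)" by (rule sum.distrib)
  also have "(\<Sum>i<k. i * ?l ! i) = n_stat \<mu>"
    unfolding n_stat_def
    by (rule sum.mono_neutral_cong_right) (use assms in \<open>auto simp: nth_append\<close>)
  also have "(\<Sum>i<k. i) = (k choose 2)"
    by (induction k) (auto simp: numeral_2_eq_2)
  finally show ?thesis by simp
qed

text \<open>The factor of v_\<mu>(t) that belongs to the nonzero parts; \<open>hl_sum\<close> has to
  be divided by it to become P.\<close>

definition part_norm :: "'b::field \<Rightarrow> nat list \<Rightarrow> 'b" where
  "part_norm t \<nu> = (\<Prod>i\<in>set \<nu>. t_fact t (mult_part i \<nu>))"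

lemma part_norm_superset:
  assumes "finite B" "set \<nu> \<subseteq> B"
  shows "part_norm t \<nu> = (\<Prod>i\<in>B. t_fact t (mult_part i \<nu>))"
  unfolding part_norm_def
  by (rule prod.mono_neutral_left) (use assms in \<open>auto simp: mult_part_def\<close>)

text \<open>The zeros appended to \<mu> become the parts 1, and the multiplicity of each i moves to
  i + 1.\<close>

lemma part_norm_add_column:
  assumes "0 \<notin> set \<mu>"
  shows "part_norm t (add_column k \<mu>) = t_fact t (k - length \<mu>) * part_norm t \<mu>"
proof -
  have c: "count_list (add_column k \<mu>) (Suc i) = count_list \<mu> i + (if i = 0 then k - length \<mu> else 0)" for i
    unfolding add_column_def
    unfolding count_list_map_conv[OF inj_Suc] count_list_append by (auto simp: count_list_eq_length_filter)
  have "part_norm t (add_column k \<mu>) = (\<Prod>i\<in>Suc ` insert 0 (set \<mu>). t_fact t (mult_part i (add_column k \<mu>)))"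
    by (rule part_norm_superset) (auto simp: add_column_def)
  also have "\<dots> = (\<Prod>i\<in>insert 0 (set \<mu>). t_fact t (mult_part i \<mu> + (if i = 0 then k - length \<mu> else 0)))"
    by (subst prod.reindex) (auto simp: mult_part_def c)
  also have "\<dots> = t_fact t (k - length \<mu>) * (\<Prod>i\<in>set \<mu>. t_fact t (mult_part i \<mu> + (if i = 0 then k - length \<mu> else 0)))"
    using assms by (simp add: mult_part_def)
  also have "(\<Prod>i\<in>set \<mu>. t_fact t (mult_part i \<mu> + (if i = 0 then k - length \<mu> else 0))) = part_norm t \<mu>"
    unfolding part_norm_def using assms by (intro prod.cong) auto
  finally show ?thesis .
qed

section \<open>The generating function over all partitions\<close>

text \<open>The power series of (1 - y c X) / (1 - c X).\<close>

definition h_factor :: "'b::field \<Rightarrow> 'b \<Rightarrow> 'b fps" where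
  "h_factor y c = Abs_fps (\<lambda>n. if n = 0 then 1 else (1 - y) * c ^ n)"

lemma h_factor_nth [simp]: "h_factor y c $ n = (if n = 0 then 1 else (1 - y) * c ^ n)"
  by (simp add: h_factor_def)

lemma h_factor_mult: "(1 - fps_const c * fps_X) * h_factor y c = 1 - fps_const (y * c) * fps_X"
proof (rule fps_ext)
  fix n
  have "((1 - fps_const c * fps_X) * h_factor y c) $ n =
      h_factor y c $ n - c * (if n = 0 then 0 else h_factor y c $ (n - 1))"
    by (simp add: left_diff_distrib mult.assoc)
  then show "((1 - fps_const c * fps_X) * h_factor y c) $ n = (1 - fps_const (y * c) * fps_X) $ n"
    by (cases n; cases "n - 1") (auto simp: algebra_simps)
qed

text \<open>The variables are only required to be distinct and nonzero elements of a field, so the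
  weights make sense. As there are infinitely many, polynomials over this field are determined by
  their values. The condition on t makes all t-factorials invertible.\<close>

locale hl_variables =
  fixes t :: "'b::field" and x :: "nat \<Rightarrow> 'b"
  assumes inj_x: "inj x" and x_nonzero: "x a \<noteq> 0" and t_power: "0 < i \<Longrightarrow> t ^ i \<noteq> 1"
begin

lemma t_fact_nonzero: "t_fact t k \<noteq> 0"
  using t_power t_power[of 1] by (auto simp: t_fact_def t_int_def)

lemma part_norm_nonzero: "part_norm t \<nu> \<noteq> 0"
  by (simp add: part_norm_def t_fact_nonzero)

definition h_series :: "'b \<Rightarrow> nat set \<Rightarrow> 'b fps" where
  "h_series y A = (\<Prod>a\<in>A. h_factor y (x a))"

text \<open>The subset identity for the values z * x a, read as an identity of polynomials in z: the
  weights are homogeneous of degree 0 and do not see z. Division by the product of all 1 - x a X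
  leaves \<open>h_series 0 S\<close> in the term of S.\<close>

lemma h_series_subsets:
  assumes A: "finite A"
  shows "(\<Sum>S\<in>Pow A. fps_const (subset_coeff t y (card S) * hl_weight t x S (A - S) * (\<Prod>a\<in>S. x a)) *
    fps_X ^ card S * h_series 0 S) = h_series y A"
proof -
  define C where "C S = subset_coeff t y (card S) * hl_weight t x S (A - S) * (\<Prod>a\<in>S. x a)" for S
  define p where "p = (\<Sum>S\<in>Pow A. smult (C S) (monom 1 (card S)) * (\<Prod>b\<in>A - S. [:1, - x b:]))"
  define q where "q = (\<Prod>a\<in>A. [:1, - (y * x a):])"
  have ev: "poly (p - q) z = 0" if "z \<noteq> 0" for z
  proof -
    let ?z = "\<lambda>a. z * x a"
    have w: "hl_weight t ?z S T = hl_weight t x S T" for S T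
    proof -
      have "(z * x a - t * (z * x b)) / (z * x a - z * x b) = (x a - t * x b) / (x a - x b)" for a b
      proof -
        have "z * x a - t * (z * x b) = z * (x a - t * x b)" by (simp add: algebra_simps)
        then show ?thesis using that by (simp add: right_diff_distrib[symmetric])
      qed
      then show ?thesis by (simp add: hl_weight_def)
    qed
    have "(\<Sum>S\<in>Pow A. subset_coeff t y (card S) * hl_weight t ?z S (A - S) *
      (\<Prod>a\<in>S. ?z a) * (\<Prod>b\<in>A - S. 1 - ?z b)) = (\<Prod>a\<in>A. 1 - y * ?z a)"
      by (rule hl_weight_subset_identity) (use A that inj_x x_nonzero in \<open>auto simp: inj_on_def\<close>)
    then show ?thesis
      by (simp add: p_def q_def C_def poly_sum poly_prod w poly_monom prod.distrib ac_simps)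
  qed
  \<comment> \<open>The identity is known for nonzero z only; the values x a already provide
    infinitely many of these.\<close>
  have "p - q = 0"
  proof (rule ccontr)
    assume "p - q \<noteq> 0"
    then have "finite {z. poly (p - q) z = 0}" by (rule poly_roots_finite)
    moreover have "range x \<subseteq> {z. poly (p - q) z = 0}" using ev x_nonzero by auto
    ultimately have "finite (range x)" by (rule rev_finite_subset)
    then show False using inj_x finite_imageD by auto
  qed
  then have pq: "fps_of_poly p = fps_of_poly q" by simp
  have lin: "fps_of_poly [:1, - c:] = 1 - fps_const c * fps_X" for c :: 'b
    by (rule fps_ext) (auto simp: coeff_pCons split: nat.splits)
  have inv: "(1 - fps_const (x b) * fps_X) * h_factor 0 (x b) = 1" for b
    using h_factor_mult[of "x b" 0] by simp
  have hy: "h_factor y (x b) = (1 - fps_const (y * x b) * fps_X) * h_factor 0 (x b)" for b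
  proof -
    have "(1 - fps_const (y * x b) * fps_X) * h_factor 0 (x b) =
      ((1 - fps_const (x b) * fps_X) * h_factor 0 (x b)) * h_factor y (x b)"
      unfolding h_factor_mult[of "x b" y, symmetric] by (simp only: ac_simps)
    then show ?thesis unfolding inv by simp
  qed
  have "h_series y A = fps_of_poly q * h_series 0 A"
    by (simp add: h_series_def hy prod.distrib q_def fps_of_poly_prod lin)
  also have "fps_of_poly q = (\<Sum>S\<in>Pow A. fps_const (C S) * fps_X ^ card S *
      (\<Prod>b\<in>A - S. 1 - fps_const (x b) * fps_X))"
    unfolding pq[symmetric] p_def
    by (simp add: fps_of_poly_sum fps_of_poly_mult fps_of_poly_smult fps_of_poly_monom' fps_of_poly_prod lin mult.assoc)
  also have "\<dots> * h_series 0 A = (\<Sum>S\<in>Pow A. fps_const (C S) * fps_X ^ card S * h_series 0 S)"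
    unfolding sum_distrib_right
  proof (rule sum.cong[OF refl])
    fix S assume S: "S \<in> Pow A"
    have "h_series 0 A = h_series 0 (A - S) * h_series 0 S"
      unfolding h_series_def using S A by (intro prod.subset_diff) auto
    moreover have "(\<Prod>b\<in>A - S. 1 - fps_const (x b) * fps_X) * h_series 0 (A - S) = 1"
      by (simp add: h_series_def prod.distrib[symmetric] inv)
    ultimately show "fps_const (C S) * fps_X ^ card S * (\<Prod>b\<in>A - S. 1 - fps_const (x b) * fps_X) * h_series 0 A =
        fps_const (C S) * fps_X ^ card S * h_series 0 S"
      by (metis (no_types, lifting) mult.assoc mult.right_neutral mult.left_commute)
  qed
  finally show ?thesis by (simp add: C_def)
qed

lemma h_series_nth:
  assumes "finite A"
  shows "h_series y A $ n = (\<Sum>S | S \<subseteq> A \<and> card S \<le> n.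
    subset_coeff t y (card S) * hl_weight t x S (A - S) * (\<Prod>a\<in>S. x a) * h_series 0 S $ (n - card S))"
proof -
  have "h_series y A $ n = (\<Sum>S\<in>Pow A. if n < card S then 0 else
    subset_coeff t y (card S) * hl_weight t x S (A - S) * (\<Prod>a\<in>S. x a) * h_series 0 S $ (n - card S))"
    unfolding h_series_subsets[OF assms, symmetric] fps_sum_nth
    by (intro sum.cong refl) (simp add: mult.assoc fps_X_power_mult_nth del: fps_const_mult)
  also have "\<dots> = (\<Sum>S | S \<subseteq> A \<and> card S \<le> n.
    subset_coeff t y (card S) * hl_weight t x S (A - S) * (\<Prod>a\<in>S. x a) * h_series 0 S $ (n - card S))"
    using assms by (intro sum.mono_neutral_cong_right) auto
  finally show ?thesis .
qed

text \<open>At y = t the coefficient of every S with at least two elements contains the factor t^1 -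
  t, and the empty set contributes to degree 0 only. The one-element sets remain.\<close>

lemma h_series_row:
  assumes "finite A" "0 < m"
  shows "(1 - t) * (\<Sum>a\<in>A. x a ^ m * hl_weight t x {a} (A - {a})) = h_series t A $ m"
proof -
  have sc: "subset_coeff t t k = 0" if "2 \<le> k" for k
    unfolding subset_coeff_def using that by (intro prod_zero) (auto intro!: bexI[of _ 1])
  have "h_series t A $ m = (\<Sum>S\<in>(\<lambda>a. {a}) ` A.
    subset_coeff t t (card S) * hl_weight t x S (A - S) * (\<Prod>a\<in>S. x a) * h_series 0 S $ (m - card S))"
    unfolding h_series_nth[OF assms(1)]
  proof (rule sum.mono_neutral_right)
    show "\<forall>S\<in>{S. S \<subseteq> A \<and> card S \<le> m} - (\<lambda>a. {a}) ` A.
      subset_coeff t t (card S) * hl_weight t x S (A - S) * (\<Prod>a\<in>S. x a) * h_series 0 S $ (m - card S) = 0"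
    proof
      fix S assume S: "S \<in> {S. S \<subseteq> A \<and> card S \<le> m} - (\<lambda>a. {a}) ` A"
      then have fS: "finite S" using assms finite_subset by auto
      have "card S \<noteq> 1" using S by (auto simp: card_1_singleton_iff)
      then consider "card S = 0" | "2 \<le> card S" by linarith
      then show "subset_coeff t t (card S) * hl_weight t x S (A - S) * (\<Prod>a\<in>S. x a) *
        h_series 0 S $ (m - card S) = 0"
        using fS assms(2) by cases (auto simp: h_series_def sc)
    qed
  qed (use assms in auto)
  also have "\<dots> = (\<Sum>a\<in>A. (1 - t) * (x a ^ m * hl_weight t x {a} (A - {a})))"
    by (subst sum.reindex) (use assms(2) in \<open>auto simp: h_series_def subset_coeff_def
      power_eq_if[of _ m] intro!: sum.cong\<close>)
  finally show ?thesis by (simp add: sum_distrib_left)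
qed

text \<open>P_\<nu> in the variables of A. It also makes sense for fewer variables than parts, where
  it is 0.\<close>

definition hl_p :: "nat list \<Rightarrow> nat set \<Rightarrow> 'b" where
  "hl_p \<nu> A = hl_sum t x \<nu> A / part_norm t \<nu>"

lemma hl_p_Nil [simp]: "hl_p [] A = 1"
  by (simp add: hl_p_def part_norm_def)

lemma hl_p_eq_0: "finite A \<Longrightarrow> card A < length \<nu> \<Longrightarrow> hl_p \<nu> A = 0"
  by (simp add: hl_p_def hl_sum_eq_0)

text \<open>The zeros that pad \<mu> produce the same t-factorial in \<open>hl_sum\<close> and in
  \<open>part_norm\<close>, so the normalized functions satisfy a recursion without extra
  factors.\<close>

lemma hl_p_add_column:
  assumes "finite A" "0 \<notin> set \<mu>" "length \<mu> \<le> k"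
  shows "hl_p (add_column k \<mu>) A = (\<Sum>S | S \<subseteq> A \<and> card S = k.
    (\<Prod>a\<in>S. x a) * hl_weight t x S (A - S) * hl_p \<mu> S)"
proof -
  have t1: "t \<noteq> 1" using t_power[of 1] by simp
  have "hl_sum t x (\<mu> @ replicate (k - length \<mu>) 0) S = t_fact t (k - length \<mu>) * hl_sum t x \<mu> S"
    if "S \<subseteq> A" "card S = k" for S
    by (rule hl_sum_append_zeros)
       (use that assms finite_subset[of S A] inj_x x_nonzero t1 in \<open>auto simp: inj_on_def\<close>)
  then have "hl_sum t x (add_column k \<mu>) A = (\<Sum>S | S \<subseteq> A \<and> card S = k.
    (\<Prod>a\<in>S. x a) * hl_weight t x S (A - S) * (t_fact t (k - length \<mu>) * hl_sum t x \<mu> S))"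
    unfolding add_column_def hl_sum_map_Suc[OF assms(1)] using assms(3) by simp
  then show ?thesis
    using t_fact_nonzero[of "k - length \<mu>"]
    by (simp add: hl_p_def part_norm_add_column[OF assms(2)] sum_divide_distrib mult.assoc)
qed

text \<open>Partitions are grouped by length k and lose their first column, which turns the exponent
  on the left into \<open>n_stat \<mu>\<close>. The bound of k on the length of \<mu> can then be
  dropped, because P_\<mu> vanishes on the k variables of S for longer \<mu>.\<close>

lemma sum_partitions_hl_p_rec:
  assumes "finite A"
  shows "(\<Sum>\<nu> | partition_of n \<nu>. subset_coeff t y (length \<nu>) *
      t ^ (n_stat \<nu> - (length \<nu> choose 2)) * hl_p \<nu> A) =
    (\<Sum>S | S \<subseteq> A \<and> card S \<le> n. subset_coeff t y (card S) * hl_weight t x S (A - S) * (\<Prod>a\<in>S. x a) *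
      (\<Sum>\<mu> | partition_of (n - card S) \<mu>. t ^ n_stat \<mu> * hl_p \<mu> S))"
proof -
  let ?F = "\<lambda>\<nu>. subset_coeff t y (length \<nu>) * t ^ (n_stat \<nu> - (length \<nu> choose 2)) * hl_p \<nu> A"
  let ?W = "\<lambda>S. subset_coeff t y (card S) * hl_weight t x S (A - S) * (\<Prod>a\<in>S. x a)"
  let ?T = "\<lambda>n S. \<Sum>\<mu> | partition_of n \<mu>. t ^ n_stat \<mu> * hl_p \<mu> S"
  have "(\<Sum>\<nu> | partition_of n \<nu>. ?F \<nu>) = (\<Sum>k\<le>n. \<Sum>\<nu> | \<nu> \<in> {\<nu>. partition_of n \<nu>} \<and> length \<nu> = k. ?F \<nu>)"
    by (rule sum.group[symmetric]) (use finite_partition_of partition_of_length_le in auto)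
  also have "\<dots> = (\<Sum>k\<le>n. \<Sum>S | S \<in> {S. S \<subseteq> A \<and> card S \<le> n} \<and> card S = k. ?W S * ?T (n - card S) S)"
  proof (rule sum.cong[OF refl])
    fix k assume "k \<in> {..n}"
    then have k: "k \<le> n" by simp
    let ?M = "{\<mu>. partition_of (n - k) \<mu> \<and> length \<mu> \<le> k}"
    have fM: "finite ?M" by (rule finite_subset[OF _ finite_partition_of]) auto
    have "(\<Sum>\<nu> | \<nu> \<in> {\<nu>. partition_of n \<nu>} \<and> length \<nu> = k. ?F \<nu>) = (\<Sum>\<mu>\<in>?M. ?F (add_column k \<mu>))"
      using sum.reindex_bij_betw[OF bij_betw_add_column[OF k], of ?F] by simp
    also have "\<dots> = (\<Sum>\<mu>\<in>?M. \<Sum>S | S \<subseteq> A \<and> card S = k. ?W S * (t ^ n_stat \<mu> * hl_p \<mu> S))"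
    proof (rule sum.cong[OF refl])
      fix \<mu> assume \<mu>: "\<mu> \<in> ?M"
      then have "hl_p (add_column k \<mu>) A = (\<Sum>S | S \<subseteq> A \<and> card S = k.
          (\<Prod>a\<in>S. x a) * hl_weight t x S (A - S) * hl_p \<mu> S)"
        using assms by (intro hl_p_add_column) (auto simp: partition_of_def is_partition_def)
      then show "?F (add_column k \<mu>) = (\<Sum>S | S \<subseteq> A \<and> card S = k. ?W S * (t ^ n_stat \<mu> * hl_p \<mu> S))"
        using \<mu> by (simp add: n_stat_add_column length_add_column sum_distrib_left ac_simps cong: conj_cong)
    qed
    also have "\<dots> = (\<Sum>S | S \<subseteq> A \<and> card S = k. \<Sum>\<mu>\<in>?M. ?W S * (t ^ n_stat \<mu> * hl_p \<mu> S))"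
      by (rule sum.swap)
    also have "\<dots> = (\<Sum>S | S \<subseteq> A \<and> card S = k. ?W S * ?T (n - card S) S)"
    proof (rule sum.cong[OF refl])
      fix S assume S: "S \<in> {S. S \<subseteq> A \<and> card S = k}"
      then have "finite S" using assms finite_subset by auto
      then have "(\<Sum>\<mu>\<in>?M. t ^ n_stat \<mu> * hl_p \<mu> S) = ?T (n - k) S"
        using S by (intro sum.mono_neutral_left finite_partition_of) (auto simp: hl_p_eq_0)
      then show "(\<Sum>\<mu>\<in>?M. ?W S * (t ^ n_stat \<mu> * hl_p \<mu> S)) = ?W S * ?T (n - card S) S"
        using S by (simp add: sum_distrib_left[symmetric])
    qed
    also have "{S. S \<subseteq> A \<and> card S = k} = {S. S \<in> {S. S \<subseteq> A \<and> card S \<le> n} \<and> card S = k}"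
      using k by auto
    finally show "(\<Sum>\<nu> | \<nu> \<in> {\<nu>. partition_of n \<nu>} \<and> length \<nu> = k. ?F \<nu>) =
      (\<Sum>S | S \<in> {S. S \<subseteq> A \<and> card S \<le> n} \<and> card S = k. ?W S * ?T (n - card S) S)" .
  qed
  also have "\<dots> = (\<Sum>S | S \<subseteq> A \<and> card S \<le> n. ?W S * ?T (n - card S) S)"
    by (rule sum.group) (use assms in auto)
  finally show ?thesis .
qed

text \<open>For y = 0 the coefficient \<open>subset_coeff t 0 k\<close> is t^(k choose 2), which
  restores the full power of t on the left of the recursion. Outer and inner sums are then of the
  same kind.\<close>

lemma sum_partitions_hl_p_0:
  assumes "finite A"
  shows "(\<Sum>\<mu> | partition_of n \<mu>. t ^ n_stat \<mu> * hl_p \<mu> A) = h_series 0 A $ n"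
  using assms
proof (induction n arbitrary: A rule: less_induct)
  case (less n)
  show ?case
  proof (cases "n = 0")
    case True
    have "h_series 0 A $ 0 = 1"
      using less.prems unfolding h_series_def by (induction A rule: finite_induct) auto
    then show ?thesis using True by (simp add: partition_of_0_iff n_stat_def)
  next
    case False
    have sc: "subset_coeff t 0 k = t ^ (k choose 2)" for k
    proof (induction k)
      case (Suc k)
      have "Suc k choose 2 = (k choose 2) + k" by (simp add: numeral_2_eq_2)
      then show ?case by (simp only: subset_coeff_Suc Suc power_add diff_zero)
    qed (simp add: numeral_2_eq_2)
    have "(\<Sum>\<mu> | partition_of n \<mu>. t ^ n_stat \<mu> * hl_p \<mu> A) =
      (\<Sum>\<mu> | partition_of n \<mu>. subset_coeff t 0 (length \<mu>) * t ^ (n_stat \<mu> - (length \<mu> choose 2)) * hl_p \<mu> A)"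
    proof (rule sum.cong[OF refl])
      fix \<mu> assume "\<mu> \<in> {\<mu>. partition_of n \<mu>}"
      then obtain \<rho> where "\<mu> = add_column (length \<mu>) \<rho>" "length \<rho> \<le> length \<mu>"
        using partition_eq_add_column by blast
      then have "n_stat \<mu> = n_stat \<rho> + (length \<mu> choose 2)"
        using n_stat_add_column[of \<rho> "length \<mu>"] by simp
      then have "t ^ (length \<mu> choose 2) * t ^ (n_stat \<mu> - (length \<mu> choose 2)) = t ^ n_stat \<mu>"
        by (simp add: power_add[symmetric] add.commute)
      then show "t ^ n_stat \<mu> * hl_p \<mu> A =
        subset_coeff t 0 (length \<mu>) * t ^ (n_stat \<mu> - (length \<mu> choose 2)) * hl_p \<mu> A"
        unfolding sc by simp
    qed
    also have "\<dots> = h_series 0 A $ n"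
      unfolding sum_partitions_hl_p_rec[OF less.prems] h_series_nth[OF less.prems, of 0]
    proof (rule sum.cong[OF refl])
      fix S assume S: "S \<in> {S. S \<subseteq> A \<and> card S \<le> n}"
      then have fS: "finite S" using less.prems finite_subset by auto
      have "(\<Sum>\<mu> | partition_of (n - card S) \<mu>. t ^ n_stat \<mu> * hl_p \<mu> S) = h_series 0 S $ (n - card S)"
      proof (cases "S = {}")
        case True
        have "hl_p \<mu> {} = 0" if "partition_of n \<mu>" for \<mu>
          using that False by (cases \<mu>) (auto simp: partition_of_def hl_p_eq_0)
        then show ?thesis using True False by (simp add: h_series_def)
      next
        case False
        then have "card S > 0" using fS by (simp add: card_gt_0_iff)
        then show ?thesis using S fS \<open>n \<noteq> 0\<close> by (intro less.IH) auto
      qed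
      then show "subset_coeff t 0 (card S) * hl_weight t x S (A - S) * (\<Prod>a\<in>S. x a) *
          (\<Sum>\<mu> | partition_of (n - card S) \<mu>. t ^ n_stat \<mu> * hl_p \<mu> S) =
        subset_coeff t 0 (card S) * hl_weight t x S (A - S) * (\<Prod>a\<in>S. x a) *
          h_series 0 S $ (n - card S)" by simp
    qed
    finally show ?thesis .
  qed
qed

text \<open>The parameter y enters the recursion only through its first step, the inner sums being
  those of y = 0. No second induction is required.\<close>

lemma sum_partitions_hl_p:
  assumes "finite A"
  shows "(\<Sum>\<nu> | partition_of n \<nu>. subset_coeff t y (length \<nu>) *
      t ^ (n_stat \<nu> - (length \<nu> choose 2)) * hl_p \<nu> A) = h_series y A $ n"
  unfolding sum_partitions_hl_p_rec[OF assms] h_series_nth[OF assms, of y]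
proof (rule sum.cong[OF refl])
  fix S assume "S \<in> {S. S \<subseteq> A \<and> card S \<le> n}"
  then have "finite S" using assms finite_subset by auto
  then show "subset_coeff t y (card S) * hl_weight t x S (A - S) * (\<Prod>a\<in>S. x a) *
      (\<Sum>\<mu> | partition_of (n - card S) \<mu>. t ^ n_stat \<mu> * hl_p \<mu> S) =
    subset_coeff t y (card S) * hl_weight t x S (A - S) * (\<Prod>a\<in>S. x a) * h_series 0 S $ (n - card S)"
    by (simp only: sum_partitions_hl_p_0)
qed

end

section \<open>Series and their restrictions to finitely many variables\<close>

lemma lookup_mult_splits:
  fixes F G :: "'a::comm_ring_1 mpol"
  shows "Poly_Mapping.lookup (F * G) m = (\<Sum>(a, b) | a + b = m. Poly_Mapping.lookup F a * Poly_Mapping.lookup G b)"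
proof -
  have "Poly_Mapping.lookup (F * G) m = prod_fun (Poly_Mapping.lookup F) (Poly_Mapping.lookup G) m"
    by (simp add: lookup_mult prod_fun_def)
  also have "\<dots> = Sum_any (\<lambda>(a, b). Poly_Mapping.lookup F a * Poly_Mapping.lookup G b when m = a + b)"
    by (rule prod_fun_unfold_prod) auto
  also have "\<dots> = (\<Sum>(a, b) | a + b = m. Poly_Mapping.lookup F a * Poly_Mapping.lookup G b when m = a + b)"
    by (rule Sum_any.expand_superset) (auto simp: finite_splits split: if_splits)
  also have "\<dots> = (\<Sum>(a, b) | a + b = m. Poly_Mapping.lookup F a * Poly_Mapping.lookup G b)"
    by (rule sum.cong) auto
  finally show ?thesis .
qed

lemma lookup_single_mult:
  fixes F :: "'a::comm_ring_1 mpol"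
  shows "Poly_Mapping.lookup (Poly_Mapping.single k c * F) m = (if \<exists>m'. m = k + m' then c * Poly_Mapping.lookup F (m - k) else 0)"
proof (cases "\<exists>m'. m = k + m'")
  case True
  then obtain m' where m': "m = k + m'" by blast
  have "Poly_Mapping.lookup (Poly_Mapping.single k c * F) m =
      (\<Sum>(a, b)\<in>{(k, m')}. Poly_Mapping.lookup (Poly_Mapping.single k c) a * Poly_Mapping.lookup F b)"
    unfolding lookup_mult_splits
  proof (rule sum.mono_neutral_right[OF finite_splits])
    show "\<forall>p\<in>{(a, b). a + b = m} - {(k, m')}.
      (case p of (a, b) \<Rightarrow> Poly_Mapping.lookup (Poly_Mapping.single k c) a * Poly_Mapping.lookup F b) = 0"
    proof
      fix p assume p: "p \<in> {(a, b). a + b = m} - {(k, m')}"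
      show "(case p of (a, b) \<Rightarrow> Poly_Mapping.lookup (Poly_Mapping.single k c) a * Poly_Mapping.lookup F b) = 0"
      proof (cases p)
        case (Pair a b)
        with p have e: "a + b = k + m'" and n: "(a, b) \<noteq> (k, m')" using m' by simp_all
        have "k \<noteq> a"
        proof
          assume "k = a"
          with e have "b = m'" using add_left_cancel by metis
          with n \<open>k = a\<close> show False by simp
        qed
        then show ?thesis by (simp add: Pair lookup_single_not_eq)
      qed
    qed
    show "{(k, m')} \<subseteq> {(a, b). a + b = m}" using m' by simp
  qed
  then have "Poly_Mapping.lookup (Poly_Mapping.single k c * F) m = c * Poly_Mapping.lookup F m'" by simp
  moreover have "m - k = m'" by (simp add: m')
  ultimately show ?thesis using True by simp
next
  case False
  have "(case p of (a, b) \<Rightarrow> Poly_Mapping.lookup (Poly_Mapping.single k c) a * Poly_Mapping.lookup F b) = 0"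
    if "p \<in> {(a, b). a + b = m}" for p
  proof (cases p)
    case (Pair a b)
    with that False have "k \<noteq> a" by auto
    then show ?thesis by (simp add: Pair lookup_single_not_eq)
  qed
  then show ?thesis using False unfolding lookup_mult_splits by (simp add: sum.neutral)
qed

lemma mcoeff_mult: "mcoeff (f * g) m = (\<Sum>(a, b) | a + b = m. mcoeff f a * mcoeff g b)"
  by (simp only: times_mseries.rep_eq)

lemma mcoeff_add [simp]: "mcoeff (f + g) m = mcoeff f m + mcoeff g m"
  by transfer simp

lemma mcoeff_zero [simp]: "mcoeff 0 m = 0"
  by transfer simp

lemma mcoeff_sum: "mcoeff (sum f I) m = (\<Sum>i\<in>I. mcoeff (f i) m)"
  by (induction I rule: infinite_finite_induct) auto

lemma mcoeff_mconst_mult [simp]: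
  fixes f :: "'a::comm_ring_1 mseries"
  shows "mcoeff (mconst c * f) m = c * mcoeff f m"
proof -
  have "mcoeff (mconst c * f) m = (\<Sum>(a, b) \<in> {(0 :: nat \<Rightarrow>\<^sub>0 nat, m)}. mcoeff (mconst c) a * mcoeff f b)"
    unfolding mcoeff_mult by (rule sum.mono_neutral_right[OF finite_splits]) (auto simp: mconst.rep_eq split: if_splits)
  then show ?thesis by (simp add: mconst.rep_eq)
qed

lemma keys_plus_nat: "Poly_Mapping.keys (a + b) = Poly_Mapping.keys a \<union> Poly_Mapping.keys (b :: 'b \<Rightarrow>\<^sub>0 nat)"
  by (auto simp: in_keys_iff lookup_add)

section \<open>Constants and variables inside the fraction field of polynomials\<close>

definition fconst :: "'a::field \<Rightarrow> 'a mpol fract" where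
  "fconst c = to_fract (mp_const c)"

definition fvar :: "nat \<Rightarrow> 'a::field mpol fract" where
  "fvar i = to_fract (mp_var i)"

lemma fconst_simps [simp]:
  "fconst 0 = 0" "fconst 1 = 1"
  "fconst (a + b) = fconst a + fconst b" "fconst (a - b) = fconst a - fconst b"
  "fconst (a * b) = fconst a * fconst b"
  by (simp_all add: fconst_def mp_const_def single_add single_diff flip: to_fract_add to_fract_diff to_fract_mult)
     (simp add: mult_single flip: to_fract_mult)

lemma fconst_eq_iff [simp]: "fconst a = fconst b \<longleftrightarrow> a = b"
proof
  assume "fconst a = fconst b"
  then have "Poly_Mapping.lookup (mp_const a) 0 = Poly_Mapping.lookup (mp_const b) 0" by (simp add: fconst_def)
  then show "a = b" by (simp add: mp_const_def)
qed simp

lemma fconst_power [simp]: "fconst (a ^ n) = fconst a ^ n"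
  by (induction n) auto

lemma fconst_divide [simp]: "fconst (a / b) = fconst a / fconst b"
proof (cases "b = 0")
  case False
  then have "fconst (a / b) * fconst b = fconst a" by (simp flip: fconst_simps(5))
  moreover have "fconst b \<noteq> fconst 0" using False by (simp del: fconst_simps)
  ultimately show ?thesis by (simp add: eq_divide_eq)
qed simp

lemma fconst_prod [simp]: "fconst (prod f I) = (\<Prod>i\<in>I. fconst (f i))"
  by (induction I rule: infinite_finite_induct) auto

lemma fconst_t_fact [simp]: "fconst (t_fact t k) = t_fact (fconst t) k"
  by (simp add: t_fact_def t_int_def)

lemma inj_fvar: "inj (fvar :: nat \<Rightarrow> 'a::field mpol fract)"
proof (rule injI)
  fix x y :: nat
  assume "fvar x = (fvar y :: 'a mpol fract)"
  then have "Poly_Mapping.keys (mp_var x :: 'a mpol) = Poly_Mapping.keys (mp_var y :: 'a mpol)"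
    by (simp add: fvar_def)
  then have "Poly_Mapping.single x (1 :: nat) = Poly_Mapping.single y 1" by (simp add: mp_var_def)
  then have "Poly_Mapping.keys (Poly_Mapping.single x (1 :: nat)) = Poly_Mapping.keys (Poly_Mapping.single y (1 :: nat))"
    by (rule arg_cong)
  then show "x = y" by simp
qed

lemma fvar_nonzero [simp]: "fvar i \<noteq> 0"
  by (auto simp: fvar_def mp_var_def dest: arg_cong[of _ _ Poly_Mapping.keys])

text \<open>
  The function \<open>g\<close> gives, for each finite set of variables, the result of setting all other
  variables of the series \<open>f\<close> to 0.
\<close>

definition represents :: "(nat set \<Rightarrow> 'a::field mpol fract) \<Rightarrow> 'a mseries \<Rightarrow> bool" where
  "represents g f \<longleftrightarrow> (\<forall>A. finite A \<longrightarrow> (\<exists>F. to_fract F = g A \<and>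
     (\<forall>m. Poly_Mapping.lookup F m = (if Poly_Mapping.keys m \<subseteq> A then mcoeff f m else 0))))"

lemma representsE:
  assumes "represents g f" "finite A"
  obtains F where "to_fract F = g A"
    "\<And>m. Poly_Mapping.lookup F m = (if Poly_Mapping.keys m \<subseteq> A then mcoeff f m else 0)"
  using assms unfolding represents_def by blast

lemma represents_cong:
  "represents g f \<Longrightarrow> (\<And>A. finite A \<Longrightarrow> g A = g' A) \<Longrightarrow> represents g' f"
  by (auto simp: represents_def)

lemma represents_const: "represents (\<lambda>A. fconst c) (mconst c)"
  unfolding represents_def fconst_def
  by (auto simp: mp_const_def lookup_single mconst.rep_eq when_def intro!: exI[of _ "mp_const c"])

lemma represents_add:
  assumes "represents g f" "represents g' f'"
  shows "represents (\<lambda>A. g A + g' A) (f + f')"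
  unfolding represents_def
proof (intro allI impI)
  fix A :: "nat set" assume A: "finite A"
  obtain F where F: "to_fract F = g A" "\<And>m. Poly_Mapping.lookup F m = (if Poly_Mapping.keys m \<subseteq> A then mcoeff f m else 0)"
    using representsE[OF assms(1) A] by blast
  obtain F' where F': "to_fract F' = g' A" "\<And>m. Poly_Mapping.lookup F' m = (if Poly_Mapping.keys m \<subseteq> A then mcoeff f' m else 0)"
    using representsE[OF assms(2) A] by blast
  show "\<exists>H. to_fract H = g A + g' A \<and>
    (\<forall>m. Poly_Mapping.lookup H m = (if Poly_Mapping.keys m \<subseteq> A then mcoeff (f + f') m else 0))"
    by (rule exI[of _ "F + F'"]) (simp add: F F' lookup_add)
qed

lemma represents_mult:
  assumes "represents g f" "represents g' f'"
  shows "represents (\<lambda>A. g A * g' A) (f * f')"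
  unfolding represents_def
proof (intro allI impI)
  fix A :: "nat set" assume A: "finite A"
  obtain F where F: "to_fract F = g A" "\<And>m. Poly_Mapping.lookup F m = (if Poly_Mapping.keys m \<subseteq> A then mcoeff f m else 0)"
    using representsE[OF assms(1) A] by blast
  obtain F' where F': "to_fract F' = g' A" "\<And>m. Poly_Mapping.lookup F' m = (if Poly_Mapping.keys m \<subseteq> A then mcoeff f' m else 0)"
    using representsE[OF assms(2) A] by blast
  have "Poly_Mapping.lookup (F * F') m = (if Poly_Mapping.keys m \<subseteq> A then mcoeff (f * f') m else 0)" for m
  proof (cases "Poly_Mapping.keys m \<subseteq> A")
    case True
    then show ?thesis unfolding lookup_mult_splits mcoeff_mult
      by (auto simp: F F' keys_plus_nat intro!: sum.cong)
  next
    case False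
    then show ?thesis unfolding lookup_mult_splits
      by (auto simp: F F' keys_plus_nat intro!: sum.neutral)
  qed
  then show "\<exists>H. to_fract H = g A * g' A \<and>
    (\<forall>m. Poly_Mapping.lookup H m = (if Poly_Mapping.keys m \<subseteq> A then mcoeff (f * f') m else 0))"
    using F(1) F'(1) by (intro exI[of _ "F * F'"]) simp
qed

lemma represents_sum:
  assumes "finite I" "\<And>i. i \<in> I \<Longrightarrow> represents (g i) (f i)"
  shows "represents (\<lambda>A. \<Sum>i\<in>I. g i A) (\<Sum>i\<in>I. f i)"
  using assms
proof (induction I rule: finite_induct)
  case empty
  then show ?case using represents_const[of 0] by (simp add: represents_def mconst.rep_eq)
next
  case (insert i I)
  then have "represents (\<lambda>A. g i A + (\<Sum>i\<in>I. g i A)) (f i + (\<Sum>i\<in>I. f i))"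
    by (intro represents_add) auto
  then show ?case using insert.hyps by simp
qed

text \<open>The coefficient at m is visible as soon as the variables of m are present, so A =
  \<open>keys m\<close> suffices.\<close>

lemma represents_unique:
  assumes "represents g f" "represents g f'"
  shows "f = f'"
proof (rule mseries_eqI)
  fix m :: "nat \<Rightarrow>\<^sub>0 nat"
  let ?A = "Poly_Mapping.keys m"
  obtain F where F: "to_fract F = g ?A"
    "\<And>m. Poly_Mapping.lookup F m = (if Poly_Mapping.keys m \<subseteq> ?A then mcoeff f m else 0)"
    using representsE[OF assms(1) finite_keys] by blast
  obtain F' where F': "to_fract F' = g ?A"
    "\<And>m. Poly_Mapping.lookup F' m = (if Poly_Mapping.keys m \<subseteq> ?A then mcoeff f' m else 0)"
    using representsE[OF assms(2) finite_keys] by blast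
  have "to_fract F = to_fract F'" using F(1) F'(1) by simp
  then have "F = F'" by (simp only: to_fract_eq_iff)
  then show "mcoeff f m = mcoeff f' m" using F(2)[of m] F'(2)[of m] by simp
qed

text \<open>g B is obtained from g A by setting the variables outside B to 0.\<close>

lemma represents_eq_0_subset:
  assumes "represents g f" "finite A" "g A = 0" "B \<subseteq> A"
  shows "g B = 0"
proof -
  have B: "finite B" using assms(2,4) by (rule rev_finite_subset)
  obtain F where F: "to_fract F = g A" "\<And>m. Poly_Mapping.lookup F m = (if Poly_Mapping.keys m \<subseteq> A then mcoeff f m else 0)"
    using representsE[OF assms(1,2)] by blast
  obtain G where G: "to_fract G = g B" "\<And>m. Poly_Mapping.lookup G m = (if Poly_Mapping.keys m \<subseteq> B then mcoeff f m else 0)"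
    using representsE[OF assms(1) B] by blast
  have F0: "F = 0" using F(1) assms(3) by simp
  have "Poly_Mapping.lookup G m = Poly_Mapping.lookup 0 m" for m
  proof (cases "Poly_Mapping.keys m \<subseteq> B")
    case True
    then have "Poly_Mapping.lookup F m = mcoeff f m" using F(2)[of m] assms(4) by auto
    then show ?thesis using G(2)[of m] True F0 by simp
  next
    case False
    then show ?thesis using G(2)[of m] by simp
  qed
  then have "G = 0" by (rule poly_mapping_eqI)
  then show ?thesis using G(1) by simp
qed

section \<open>Total degree and the limit of \<open>h_series\<close> in infinitely many
  variables\<close>

definition mdegree :: "(nat \<Rightarrow>\<^sub>0 nat) \<Rightarrow> nat" where
  "mdegree m = (\<Sum>i\<in>Poly_Mapping.keys m. Poly_Mapping.lookup m i)"

lemma mdegree_superset: "finite B \<Longrightarrow> Poly_Mapping.keys m \<subseteq> B \<Longrightarrow> mdegree m = (\<Sum>i\<in>B. Poly_Mapping.lookup m i)"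
  unfolding mdegree_def by (rule sum.mono_neutral_left) (auto simp: in_keys_iff)

lemma mdegree_add: "mdegree (m + m') = mdegree m + mdegree m'"
proof -
  let ?B = "Poly_Mapping.keys m \<union> Poly_Mapping.keys m'"
  have "mdegree (m + m') = (\<Sum>i\<in>?B. Poly_Mapping.lookup (m + m') i)"
    by (rule mdegree_superset) (auto simp: keys_plus_nat)
  also have "\<dots> = mdegree m + mdegree m'"
    using mdegree_superset[of ?B m] mdegree_superset[of ?B m'] by (simp add: lookup_add sum.distrib)
  finally show ?thesis .
qed

lemma mdegree_single [simp]: "mdegree (Poly_Mapping.single i j) = j"
  by (simp add: mdegree_def)

text \<open>The part of degree n of the product of (1 - y x) / (1 - x) over all variables: each
  variable that occurs contributes the coefficient 1 - y.\<close>

definition h_mseries :: "'a::field \<Rightarrow> nat \<Rightarrow> 'a mseries" where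
  "h_mseries y n = MSeries (\<lambda>m. if mdegree m = n then (1 - y) ^ card (Poly_Mapping.keys m) else 0)"

lemma mcoeff_h_mseries:
  "mcoeff (h_mseries y n) m = (if mdegree m = n then (1 - y) ^ card (Poly_Mapping.keys m) else 0)"
  by (simp add: h_mseries_def MSeries_inverse)

locale hl_parameter =
  fixes t :: "'a::field"
  assumes t_nonzero: "t \<noteq> 0" and t_power_neq_1: "0 < i \<Longrightarrow> t ^ i \<noteq> 1"
begin

sublocale hl_variables "fconst t" fvar
proof
  show "fconst t ^ i \<noteq> 1" if "0 < i" for i
  proof -
    have "fconst (t ^ i) \<noteq> fconst 1" using t_power_neq_1[OF that] by (simp del: fconst_power fconst_simps)
    then show ?thesis by simp
  qed
qed (auto simp: inj_fvar)

lemma represents_h_series: "represents (\<lambda>A. h_series (fconst y) A $ n) (h_mseries y n)"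
  unfolding represents_def
proof (intro allI impI)
  fix A :: "nat set" assume "finite A"
  then show "\<exists>F. to_fract F = h_series (fconst y) A $ n \<and>
     (\<forall>m. Poly_Mapping.lookup F m = (if Poly_Mapping.keys m \<subseteq> A then mcoeff (h_mseries y n) m else 0))"
  proof (induction A arbitrary: n rule: finite_induct)
    case empty
    show ?case
      by (rule exI[of _ "mp_const (if n = 0 then 1 else 0)"])
         (auto simp: h_series_def mp_const_def lookup_single mcoeff_h_mseries mdegree_def when_def)
  next
    case (insert a A)
    define \<phi> where "\<phi> j = (if j = 0 then 1 else 1 - y)" for j :: nat
    obtain F where F: "\<And>n. to_fract (F n) = h_series (fconst y) A $ n"
      "\<And>n m. Poly_Mapping.lookup (F n) m = (if Poly_Mapping.keys m \<subseteq> A then mcoeff (h_mseries y n) m else 0)"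
      using insert.IH by metis
    \<comment> \<open>The Cauchy product with the factor of the new variable, where j is the
      exponent of a.\<close>
    define G where "G = (\<Sum>j = 0..n. Poly_Mapping.single (Poly_Mapping.single a j) (\<phi> j) * F (n - j))"
    have s: "to_fract (Poly_Mapping.single (Poly_Mapping.single a j) c) = fconst c * fvar a ^ j" for j and c :: 'a
    proof -
      have "Poly_Mapping.single (Poly_Mapping.single a j) 1 = (mp_var a :: 'a mpol) ^ j"
      proof (induction j)
        case (Suc j)
        have "Poly_Mapping.single (Poly_Mapping.single a (Suc j)) 1 =
            (mp_var a :: 'a mpol) * Poly_Mapping.single (Poly_Mapping.single a j) 1"
          by (simp add: mp_var_def mult_single flip: single_add)
        then show ?case by (simp only: Suc power_Suc)
      qed simp
      then have "Poly_Mapping.single (Poly_Mapping.single a j) c = mp_const c * mp_var a ^ j"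
        unfolding mp_const_def by (simp add: mult_single flip: \<open>_ = mp_var a ^ j\<close>)
      moreover have "to_fract (mp_var a ^ j :: 'a mpol) = fvar a ^ j"
        by (induction j) (auto simp: fvar_def)
      ultimately show ?thesis by (simp add: fconst_def)
    qed
    have "to_fract G = (\<Sum>j = 0..n. h_factor (fconst y) (fvar a) $ j * h_series (fconst y) A $ (n - j))"
      unfolding G_def to_fract_sum to_fract_mult s F(1)
      by (intro sum.cong refl) (auto simp: \<phi>_def)
    also have "\<dots> = h_series (fconst y) (insert a A) $ n"
      unfolding h_series_def using insert.hyps by (simp add: fps_mult_nth)
    finally have G1: "to_fract G = h_series (fconst y) (insert a A) $ n" .
    have "Poly_Mapping.lookup G m = (if Poly_Mapping.keys m \<subseteq> insert a A then mcoeff (h_mseries y n) m else 0)" for m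
    proof -
      let ?j = "Poly_Mapping.lookup m a"
      define m' where "m' = m - Poly_Mapping.single a ?j"
      have m': "m = Poly_Mapping.single a ?j + m'"
        by (rule poly_mapping_eqI) (auto simp: m'_def lookup_add lookup_minus lookup_single when_def)
      have a_m': "a \<notin> Poly_Mapping.keys m'"
        by (simp add: m'_def in_keys_iff lookup_minus)
      \<comment> \<open>The polynomials F do not involve a, so only the summand with the exact
        exponent of a in m can reach m.\<close>
      have summand: "Poly_Mapping.lookup (Poly_Mapping.single (Poly_Mapping.single a j) (\<phi> j) * F (n - j)) m =
          (if j = ?j then \<phi> j * Poly_Mapping.lookup (F (n - j)) m' else 0)" for j
      proof (cases "\<exists>m''. m = Poly_Mapping.single a j + m''")
        case True
        then obtain m'' where m'': "m = Poly_Mapping.single a j + m''" by auto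
        then have "?j = j + Poly_Mapping.lookup m'' a" by (simp add: lookup_add)
        then have "a \<in> Poly_Mapping.keys m''" if "j \<noteq> ?j" using that by (auto simp: in_keys_iff)
        then have "Poly_Mapping.lookup (F (n - j)) m'' = 0" if "j \<noteq> ?j" using that insert.hyps by (auto simp: F(2))
        moreover have "m - Poly_Mapping.single a j = m''" using m'' by simp
        ultimately show ?thesis using True by (auto simp: lookup_single_mult m'_def)
      next
        case False
        then show ?thesis using m' by (auto simp: lookup_single_mult)
      qed
      have "Poly_Mapping.lookup G m = (if ?j \<le> n then \<phi> ?j * Poly_Mapping.lookup (F (n - ?j)) m' else 0)"
        unfolding G_def lookup_sum summand by (simp add: sum.delta)
      moreover have "Poly_Mapping.keys m' = Poly_Mapping.keys m - {a}"
        by (auto simp: m'_def in_keys_iff lookup_minus lookup_single when_def split: if_splits)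
      then have "Poly_Mapping.keys m' \<subseteq> A \<longleftrightarrow> Poly_Mapping.keys m \<subseteq> insert a A" by auto
      moreover have "mdegree m = ?j + mdegree m'"
        by (subst m', subst mdegree_add) simp
      moreover have "(1 - y) ^ card (Poly_Mapping.keys m) = \<phi> ?j * (1 - y) ^ card (Poly_Mapping.keys m')"
      proof (cases "?j = 0")
        case True
        then show ?thesis by (simp add: m'_def \<phi>_def)
      next
        case False
        then have "Poly_Mapping.keys m = insert a (Poly_Mapping.keys m')"
          by (subst m') (simp add: keys_plus_nat)
        then show ?thesis using a_m' False by (simp add: \<phi>_def)
      qed
      ultimately show ?thesis by (auto simp: F(2) mcoeff_h_mseries)
    qed
    with G1 show ?case by blast
  qed
qed

end

section \<open>Stability and independence of the Hall--Littlewood functions\<close>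

text \<open>The inverse (1 - c X) / (1 - y c X) has the same form, with 1 / y in place of y and y c
  in place of c.\<close>

lemma h_factor_inverse:
  assumes "y \<noteq> 0"
  shows "h_factor (1 / y) (y * c) * h_factor y c = 1"
proof -
  let ?u = "1 - fps_const c * fps_X" and ?v = "1 - fps_const (y * c) * fps_X"
  have "?v * h_factor (1 / y) (y * c) = ?u"
    using h_factor_mult[of "y * c" "1 / y"] assms by simp
  moreover have "(?u * ?v) * (h_factor (1 / y) (y * c) * h_factor y c) =
      (?v * h_factor (1 / y) (y * c)) * (?u * h_factor y c)"
    by (simp only: ac_simps)
  ultimately have e: "(?u * ?v) * (h_factor (1 / y) (y * c) * h_factor y c) = (?u * ?v) * 1"
    by (simp only: h_factor_mult mult_1_right)
  have "(?u * ?v) $ 0 = 1" by simp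
  then have "?u * ?v \<noteq> 0" by (metis fps_zero_nth zero_neq_one)
  then show ?thesis using e by (simp only: mult_cancel_left) simp
qed

lemma sum_list_product:
  fixes f g :: "_ \<Rightarrow> 'b::comm_ring_1"
  shows "(\<Sum>p\<leftarrow>I. f p) * (\<Sum>q\<leftarrow>J. g q) = (\<Sum>(p, q)\<leftarrow>List.product I J. f p * g q)"
  by (induction I) (simp_all add: distrib_right sum_list_const_mult o_def)

section \<open>Stability through the algebra of the rows\<close>

context hl_parameter
begin

text \<open>The algebra generated by the rows \<open>Q\<^bsub>(m)\<^esub>\<close>, as functions of the set of variables.\<close>

inductive row_alg :: "(nat set \<Rightarrow> 'a mpol fract) \<Rightarrow> bool" where
  row_alg_const: "row_alg (\<lambda>A. fconst c)"
| row_alg_row: "row_alg (\<lambda>A. h_series (fconst t) A $ m)"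
| row_alg_add: "row_alg g \<Longrightarrow> row_alg g' \<Longrightarrow> row_alg (\<lambda>A. g A + g' A)"
| row_alg_mult: "row_alg g \<Longrightarrow> row_alg g' \<Longrightarrow> row_alg (\<lambda>A. g A * g' A)"

lemma row_alg_represents: "row_alg g \<Longrightarrow> \<exists>f. represents g f"
  by (induction rule: row_alg.induct)
     (blast intro: represents_const represents_h_series represents_add represents_mult)+

lemma row_alg_sum_list: "(\<And>p. p \<in> set I \<Longrightarrow> row_alg (g p)) \<Longrightarrow> row_alg (\<lambda>A. \<Sum>p\<leftarrow>I. g p A)"
proof (induction I)
  case Nil
  then show ?case using row_alg_const[of 0] by simp
next
  case (Cons p I)
  then show ?case using row_alg_add[of "g p" "\<lambda>A. \<Sum>p\<leftarrow>I. g p A"] by simp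
qed

text \<open>The list I depends neither on A nor on a. Later the sum over a can therefore be taken
  inside it, where the powers of the removed variable are absorbed into longer rows.\<close>

lemma row_alg_remove:
  assumes "row_alg g"
  shows "\<exists>I. (\<forall>p\<in>set I. row_alg (snd p)) \<and>
    (\<forall>A a. finite A \<longrightarrow> a \<in> A \<longrightarrow> g (A - {a}) = (\<Sum>p\<leftarrow>I. fvar a ^ fst p * snd p A))"
  using assms
proof (induction rule: row_alg.induct)
  case (row_alg_const c)
  show ?case
    by (rule exI[of _ "[(0, \<lambda>A. fconst c)]"]) (simp add: row_alg.row_alg_const)
next
  case (row_alg_row m)
  \<comment> \<open>The coefficients of (1 - x) / (1 - t x), the inverse of the factor of a removed
    variable.\<close>
  define d where "d j = (if j = 0 then 1 else (1 - 1 / t) * t ^ j)" for j :: nat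
  define I where "I = map (\<lambda>j. (j, \<lambda>A. fconst (d j) * h_series (fconst t) A $ (m - j))) [0..<Suc m]"
  have "h_series (fconst t) (A - {a}) $ m = (\<Sum>p\<leftarrow>I. fvar a ^ fst p * snd p A)"
    if "finite A" "a \<in> A" for A and a :: nat
  proof -
    let ?x = "fvar a :: 'a mpol fract"
    have t0: "fconst t \<noteq> 0" using t_nonzero fconst_eq_iff[of t 0] by (simp del: fconst_eq_iff)
    have "h_series (fconst t) A = h_factor (fconst t) ?x * h_series (fconst t) (A - {a})"
      unfolding h_series_def using that by (simp add: prod.remove)
    then have "h_series (fconst t) (A - {a}) = h_factor (1 / fconst t) (fconst t * ?x) * h_series (fconst t) A"
      using h_factor_inverse[OF t0, of ?x] by (simp flip: mult.assoc)
    then have "h_series (fconst t) (A - {a}) $ m =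
        (\<Sum>j = 0..m. h_factor (1 / fconst t) (fconst t * ?x) $ j * h_series (fconst t) A $ (m - j))"
      by (simp add: fps_mult_nth)
    also have "\<dots> = (\<Sum>j = 0..m. ?x ^ j * (fconst (d j) * h_series (fconst t) A $ (m - j)))"
      by (intro sum.cong refl) (auto simp: d_def power_mult_distrib)
    also have "\<dots> = (\<Sum>p\<leftarrow>I. ?x ^ fst p * snd p A)"
      by (simp add: I_def o_def interv_sum_list_conv_sum_set_nat atLeast0LessThan lessThan_Suc_atMost atLeast0AtMost del: upt_Suc)
    finally show ?thesis .
  qed
  moreover have "\<forall>p\<in>set I. row_alg (snd p)"
    by (auto simp: I_def simp del: upt_Suc intro!: row_alg.row_alg_mult row_alg.row_alg_const row_alg.row_alg_row)
  ultimately show ?case by blast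
next
  case (row_alg_add g g')
  obtain I where I: "\<forall>p\<in>set I. row_alg (snd p)"
    "\<And>A a. finite A \<Longrightarrow> a \<in> A \<Longrightarrow> g (A - {a}) = (\<Sum>p\<leftarrow>I. fvar a ^ fst p * snd p A)"
    using row_alg_add.IH(1) by blast
  obtain J where J: "\<forall>p\<in>set J. row_alg (snd p)"
    "\<And>A a. finite A \<Longrightarrow> a \<in> A \<Longrightarrow> g' (A - {a}) = (\<Sum>p\<leftarrow>J. fvar a ^ fst p * snd p A)"
    using row_alg_add.IH(2) by blast
  show ?case
    by (rule exI[of _ "I @ J"]) (use I J in auto)
next
  case (row_alg_mult g g')
  obtain I where I: "\<forall>p\<in>set I. row_alg (snd p)"
    "\<And>A a. finite A \<Longrightarrow> a \<in> A \<Longrightarrow> g (A - {a}) = (\<Sum>p\<leftarrow>I. fvar a ^ fst p * snd p A)"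
    using row_alg_mult.IH(1) by blast
  obtain J where J: "\<forall>p\<in>set J. row_alg (snd p)"
    "\<And>A a. finite A \<Longrightarrow> a \<in> A \<Longrightarrow> g' (A - {a}) = (\<Sum>p\<leftarrow>J. fvar a ^ fst p * snd p A)"
    using row_alg_mult.IH(2) by blast
  let ?K = "map (\<lambda>(p, q). (fst p + fst q, \<lambda>A. snd p A * snd q A)) (List.product I J)"
  have "\<forall>p\<in>set ?K. row_alg (snd p)"
    using I(1) J(1) by (auto intro!: row_alg.row_alg_mult)
  moreover have "g (A - {a}) * g' (A - {a}) = (\<Sum>p\<leftarrow>?K. fvar a ^ fst p * snd p A)"
    if "finite A" "a \<in> A" for A a
    unfolding I(2)[OF that] J(2)[OF that] sum_list_product map_map
    by (intro arg_cong[of _ _ sum_list] map_cong refl) (auto simp: power_add)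
  ultimately show ?case by blast
qed

text \<open>After the choice of a, the induction hypothesis on A - {a} becomes a combination of
  powers of x_a with coefficients that depend on A alone. Summing x_a^(m + j) times the weight of a
  over all a gives a row by \<open>h_series_row\<close>; this requires m > 0, hence the assumption
  on 0.\<close>

lemma hl_sum_row_alg:
  "0 \<notin> set \<nu> \<Longrightarrow> \<exists>g. row_alg g \<and> (\<forall>A. finite A \<longrightarrow> hl_sum (fconst t) fvar \<nu> A = g A)"
proof (induction \<nu>)
  case Nil
  then show ?case using row_alg_const[of 1] by auto
next
  case (Cons m \<nu>)
  then obtain g where g: "row_alg g" "\<And>A. finite A \<Longrightarrow> hl_sum (fconst t) fvar \<nu> A = g A" by auto
  obtain I where I: "\<forall>p\<in>set I. row_alg (snd p)"
    "\<And>A a. finite A \<Longrightarrow> a \<in> A \<Longrightarrow> g (A - {a}) = (\<Sum>p\<leftarrow>I. fvar a ^ fst p * snd p A)"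
    using row_alg_remove[OF g(1)] by blast
  define G where "G A = (\<Sum>p\<leftarrow>I. fconst (1 / (1 - t)) * h_series (fconst t) A $ (m + fst p) * snd p A)" for A
  have "row_alg G" unfolding G_def
    by (rule row_alg_sum_list, intro row_alg_mult row_alg_const row_alg_row) (use I(1) in blast)
  moreover have "hl_sum (fconst t) fvar (m # \<nu>) A = G A" if A: "finite A" for A
  proof -
    have t1: "1 - fconst t \<noteq> 0" using t_power[of 1] by simp
    have row: "(\<Sum>a\<in>A. fvar a ^ (m + j) * hl_weight (fconst t) fvar {a} (A - {a})) =
        fconst (1 / (1 - t)) * h_series (fconst t) A $ (m + j)" for j
      using h_series_row[OF A, of "m + j"] Cons.prems t1 by (simp add: field_simps)
    have "hl_sum (fconst t) fvar (m # \<nu>) A = (\<Sum>a\<in>A. \<Sum>p\<leftarrow>I.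
        fvar a ^ (m + fst p) * hl_weight (fconst t) fvar {a} (A - {a}) * snd p A)"
      using A by (auto simp: g(2) I(2) sum_list_const_mult[symmetric] power_add mult_ac
          intro!: sum.cong)
    also have "\<dots> = (\<Sum>p\<leftarrow>I. \<Sum>a\<in>A.
        fvar a ^ (m + fst p) * hl_weight (fconst t) fvar {a} (A - {a}) * snd p A)"
      by (induction I) (auto simp: sum.distrib)
    also have "\<dots> = G A"
      unfolding G_def by (simp only: row sum_distrib_right[symmetric])
    finally show ?thesis .
  qed
  ultimately show ?case by blast
qed

lemma fconst_part_norm: "fconst (part_norm t \<nu>) = part_norm (fconst t) \<nu>"
  by (simp add: part_norm_def)

text \<open>This is the stability of P_\<nu>, together with its being a polynomial: one series
  serves all finite sets of variables.\<close>

lemma ex_represents_hl_p: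
  assumes "0 \<notin> set \<nu>"
  shows "\<exists>f. represents (hl_p \<nu>) f"
proof -
  obtain g where g: "row_alg g" "\<And>A. finite A \<Longrightarrow> hl_sum (fconst t) fvar \<nu> A = g A"
    using hl_sum_row_alg[OF assms] by blast
  obtain f where "represents g f" using row_alg_represents[OF g(1)] by blast
  then have "represents (\<lambda>A. fconst (1 / part_norm t \<nu>) * g A) (mconst (1 / part_norm t \<nu>) * f)"
    by (intro represents_mult represents_const)
  then have "represents (hl_p \<nu>) (mconst (1 / part_norm t \<nu>) * f)"
    by (rule represents_cong) (simp add: hl_p_def g(2) fconst_part_norm)
  then show ?thesis by blast
qed

section \<open>Agreement with the definitions of P and Q by symmetrization\<close>

lemma HL_sym_eq_hl_sum:
  assumes "length \<mu> \<le> N"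
  shows "HL_sym t N \<mu> = t_fact (fconst t) (N - length \<mu>) * hl_sum (fconst t) fvar \<mu> {..<N}"
proof -
  let ?x = "fvar :: nat \<Rightarrow> 'a mpol fract"
  let ?\<nu> = "\<mu> @ replicate (N - length \<mu>) 0"
  have len: "length ?\<nu> = N" using assms by simp
  have bij: "bij_betw (\<lambda>w. map w [0..<N]) {w. w permutes {..<N}} (permutations_of_set {..<N})"
  proof (rule bij_betwI'[where f = "\<lambda>w. map w [0..<N]"])
    fix w v assume "w \<in> {w. w permutes {..<N}}" "v \<in> {w. w permutes {..<N}}"
    then have wv: "w permutes {..<N}" "v permutes {..<N}" by auto
    show "(map w [0..<N] = map v [0..<N]) \<longleftrightarrow> w = v"
    proof
      assume e: "map w [0..<N] = map v [0..<N]"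
      show "w = v"
      proof
        fix i show "w i = v i"
          using e wv by (cases "i < N") (auto simp: map_eq_conv permutes_def)
      qed
    qed simp
  next
    fix w assume "w \<in> {w. w permutes {..<N}}"
    then have w: "w permutes {..<N}" by simp
    have "inj_on w {0..<N}" using permutes_inj_on[OF w] by (simp add: inj_on_def)
    moreover have "w ` {0..<N} = {..<N}" using permutes_image[OF w] by (simp add: atLeast0LessThan)
    ultimately show "map w [0..<N] \<in> permutations_of_set {..<N}"
      by (intro permutations_of_setI) (auto simp: distinct_map)
  next
    fix ds assume "ds \<in> permutations_of_set {..<N}"
    then have ds: "set ds = {..<N}" "distinct ds" by (auto dest: permutations_of_setD)
    then have l: "length ds = N" using distinct_card[of ds] by simp
    define w where "w i = (if i < N then ds ! i else i)" for i
    have "bij_betw ((!) ds) {..<N} {..<N}"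
      by (rule bij_betw_nth[OF ds(2)]) (simp_all only: ds l)
    moreover have "bij_betw w {..<N} {..<N} = bij_betw ((!) ds) {..<N} {..<N}"
      by (rule bij_betw_cong) (simp add: w_def)
    ultimately have "bij_betw w {..<N} {..<N}" by (simp only:)
    then have "w permutes {..<N}" by (rule bij_imp_permutes) (simp add: w_def)
    moreover have "ds = map w [0..<N]"
      by (rule nth_equalityI) (auto simp: l w_def)
    ultimately show "\<exists>w\<in>{w. w permutes {..<N}}. ds = map w [0..<N]" by blast
  qed
  have "hl_sum (fconst t) ?x ?\<nu> {..<N} = (\<Sum>ds\<in>permutations_of_set {..<N}.
    (\<Prod>i<length ?\<nu>. ?x (ds ! i) ^ (?\<nu> ! i)) *
    (\<Prod>(i, j) | i < j \<and> j < card {..<N}. (?x (ds ! i) - fconst t * ?x (ds ! j)) / (?x (ds ! i) - ?x (ds ! j))))"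
    by (rule hl_sum_eq_sum_permutations) (use len in auto)
  also have "\<dots> = (\<Sum>w | w permutes {..<N}.
    (\<Prod>i<length ?\<nu>. ?x (map w [0..<N] ! i) ^ (?\<nu> ! i)) *
    (\<Prod>(i, j) | i < j \<and> j < card {..<N}. (?x (map w [0..<N] ! i) - fconst t * ?x (map w [0..<N] ! j)) /
      (?x (map w [0..<N] ! i) - ?x (map w [0..<N] ! j))))"
    by (rule sum.reindex_bij_betw[OF bij, symmetric])
  also have "\<dots> = HL_sym t N \<mu>"
    unfolding HL_sym_def
  proof (rule sum.cong[OF refl], rule arg_cong2[of _ _ _ _ "(*)"])
    fix w :: "nat \<Rightarrow> nat"
    show "(\<Prod>i<length ?\<nu>. ?x (map w [0..<N] ! i) ^ (?\<nu> ! i)) =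
      (\<Prod>i<length \<mu>. to_fract (mp_var (w i)) ^ (\<mu> ! i))"
      by (rule prod.mono_neutral_cong_right) (use assms in \<open>auto simp: nth_append fvar_def\<close>)
    show "(\<Prod>(i, j) | i < j \<and> j < card {..<N}. (?x (map w [0..<N] ! i) - fconst t * ?x (map w [0..<N] ! j)) /
      (?x (map w [0..<N] ! i) - ?x (map w [0..<N] ! j))) =
      (\<Prod>(i, j) | i < j \<and> j < N. to_fract (mp_var (w i) - mp_const t * mp_var (w j)) /
        to_fract (mp_var (w i) - mp_var (w j)))"
      by (rule prod.cong) (auto simp: fvar_def fconst_def)
  qed
  moreover have "hl_sum (fconst t) ?x ?\<nu> {..<N} =
      t_fact (fconst t) (N - length \<mu>) * hl_sum (fconst t) ?x \<mu> {..<N}"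
    using t_power[of 1] inj_x x_nonzero assms
    by (intro hl_sum_append_zeros) (auto intro: inj_on_subset)
  ultimately show ?thesis by simp
qed

text \<open>A stable limit f exists already. The definition reads the coefficient at m off the least
  admissible N, and f has the same coefficient there because the variables of m are among the first
  N.\<close>

lemma represents_HL_P:
  assumes "0 \<notin> set \<mu>"
  shows "represents (hl_p \<mu>) (HL_P t \<mu>)"
proof -
  obtain f where f: "represents (hl_p \<mu>) f" using ex_represents_hl_p[OF assms] by blast
  have "mcoeff (HL_P t \<mu>) m = mcoeff f m" for m
  proof -
    let ?P = "\<lambda>N. length \<mu> \<le> N \<and> Poly_Mapping.keys m \<subseteq> {..<N}"
    define N where "N = (LEAST N. ?P N)"
    obtain b where "Poly_Mapping.keys m \<subseteq> {..<b}"
      using finite_nat_set_iff_bounded[of "Poly_Mapping.keys m"] by auto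
    then have "?P (max b (length \<mu>))" by auto
    then have N: "?P N" unfolding N_def by (rule LeastI)
    obtain F where F: "to_fract F = hl_p \<mu> {..<N}"
      "\<And>m. Poly_Mapping.lookup F m = (if Poly_Mapping.keys m \<subseteq> {..<N} then mcoeff f m else 0)"
      using f finite_lessThan unfolding represents_def by metis
    have "to_fract (mp_const (HL_v t N \<mu>)) = t_fact (fconst t) (N - length \<mu>) * part_norm (fconst t) \<mu>"
      by (simp add: HL_v_def part_norm_def flip: fconst_def)
    then have "HL_sym t N \<mu> / to_fract (mp_const (HL_v t N \<mu>)) = to_fract F"
      using HL_sym_eq_hl_sum[of \<mu> N] N t_fact_nonzero by (simp add: F(1) hl_p_def)
    then have "HL_P_fin t N \<mu> = F" unfolding HL_P_fin_def by simp
    then show ?thesis using N by (simp add: HL_P.rep_eq N_def[symmetric] F(2))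
  qed
  then have "HL_P t \<mu> = f" by (rule mseries_eqI)
  with f show ?thesis by simp
qed

lemma represents_HL_Q:
  "0 \<notin> set \<mu> \<Longrightarrow> represents (\<lambda>A. fconst (HL_b t \<mu>) * hl_p \<mu> A) (HL_Q t \<mu>)"
  unfolding HL_Q_def by (intro represents_mult represents_const represents_HL_P)

lemma HL_b_eq: "HL_b t \<mu> = (1 - t) ^ length \<mu> * part_norm t \<mu>"
proof -
  have t1: "1 - t \<noteq> 0" using t_power_neq_1[of 1] by simp
  have p: "(\<Prod>j = 1..k. 1 - t ^ j) = (1 - t) ^ k * t_fact t k" for k
    using t1 by (induction k) (auto simp: t_fact_Suc t_int_def prod.nat_ivl_Suc' simp flip: prod.ub_add_nat)
  have "(\<Prod>i\<in>set \<mu>. (1 - t) ^ mult_part i \<mu>) = (1 - t) ^ length \<mu>"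
    by (simp add: mult_part_def sum_count_set flip: power_sum)
  then show ?thesis
    unfolding HL_b_def p prod.distrib part_norm_def by simp
qed

lemma HL_b_nonzero: "HL_b t \<mu> \<noteq> 0"
proof -
  have "part_norm t \<mu> \<noteq> 0" using part_norm_nonzero[of \<mu>] fconst_part_norm[of \<mu>] fconst_simps(1) by metis
  moreover have "1 - t \<noteq> 0" using t_power_neq_1[of 1] by simp
  ultimately show ?thesis by (simp add: HL_b_eq)
qed

text \<open>
  With as many variables as the longest partitions have parts, only these contribute monomials
  divisible by all variables.  Dividing by their product removes a column.
\<close>

lemma hl_p_independent:
  assumes "finite V" "\<And>\<nu>. \<nu> \<in> V \<Longrightarrow> is_partition \<nu> \<and> length \<nu> \<le> k \<and> sum_list \<nu> \<le> s"
    "finite A" "card A = k" "(\<Sum>\<nu>\<in>V. fconst (c \<nu>) * hl_p \<nu> A) = 0" "\<nu> \<in> V"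
  shows "c \<nu> = 0"
  using assms
\<comment> \<open>Deleting a variable lowers k; deleting a column lowers the bound s on the sizes by
  k.\<close>
proof (induction "k + s" arbitrary: k s V A c \<nu> rule: less_induct)
  case less
  note fV = less.prems(1) and V = less.prems(2) and A = less.prems(3,4) and eq = less.prems(5)
  show ?case
  proof (cases "k = 0")
    case True
    then have "V = {[]}" using V less.prems(6) by fastforce
    with eq less.prems(6) show ?thesis using fconst_eq_iff[of "c \<nu>" 0] by simp
  next
    case False
    then obtain a where a: "a \<in> A" using A by fastforce
    define V0 where "V0 = {\<nu>\<in>V. length \<nu> < k}"
    define V1 where "V1 = {\<nu>\<in>V. length \<nu> = k}"
    have VV: "V = V0 \<union> V1" "V0 \<inter> V1 = {}" using V by (auto simp: V0_def V1_def le_less)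
    have f01: "finite V0" "finite V1" using fV by (auto simp: V0_def V1_def)
    \<comment> \<open>With one variable fewer, the functions of the partitions of length k vanish,
      and a relation among the shorter ones is left.\<close>
    have V0: "c \<mu> = 0" if "\<mu> \<in> V0" for \<mu>
    proof (rule less.hyps[of "k - 1" s V0 "A - {a}" c])
      show "k - 1 + s < k + s" using False by simp
      show "is_partition \<nu> \<and> length \<nu> \<le> k - 1 \<and> sum_list \<nu> \<le> s" if "\<nu> \<in> V0" for \<nu>
        using that V by (auto simp: V0_def)
      have rep: "represents (\<lambda>A. \<Sum>\<nu>\<in>V. fconst (c \<nu>) * hl_p \<nu> A) (\<Sum>\<nu>\<in>V. mconst (c \<nu>) * HL_P t \<nu>)"
        using fV V by (intro represents_sum represents_mult represents_const represents_HL_P)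
          (auto simp: is_partition_def)
      have "(\<Sum>\<nu>\<in>V. fconst (c \<nu>) * hl_p \<nu> (A - {a})) = 0"
        by (rule represents_eq_0_subset[OF rep A(1) eq]) auto
      moreover have "(\<Sum>\<nu>\<in>V1. fconst (c \<nu>) * hl_p \<nu> (A - {a})) = 0"
        using A a False by (intro sum.neutral) (auto simp: V1_def intro!: hl_p_eq_0)
      ultimately show "(\<Sum>\<nu>\<in>V0. fconst (c \<nu>) * hl_p \<nu> (A - {a})) = 0"
        using VV f01 by (simp add: sum.union_disjoint)
    qed (use that f01 A a in auto)
    have V1: "c \<mu> = 0" if \<mu>: "\<mu> \<in> V1" for \<mu>
    proof -
      have "\<exists>\<rho>. \<nu> = add_column k \<rho> \<and> partition_of (sum_list \<nu> - k) \<rho> \<and> length \<rho> \<le> k" if "\<nu> \<in> V1" for \<nu>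
      proof -
        have "partition_of (sum_list \<nu>) \<nu>" and l: "length \<nu> = k"
          using that V by (auto simp: V1_def partition_of_def)
        from partition_eq_add_column[OF this(1)] show ?thesis unfolding l by metis
      qed
      then obtain r where r: "\<And>\<nu>. \<nu> \<in> V1 \<Longrightarrow> \<nu> = add_column k (r \<nu>)"
        "\<And>\<nu>. \<nu> \<in> V1 \<Longrightarrow> partition_of (sum_list \<nu> - k) (r \<nu>)"
        "\<And>\<nu>. \<nu> \<in> V1 \<Longrightarrow> length (r \<nu>) \<le> k" by metis
      have inj: "inj_on r V1" by (rule inj_onI) (metis r(1))
      have size: "k \<le> sum_list \<nu>" "sum_list \<nu> \<le> s" if "\<nu> \<in> V1" for \<nu>
        using that V length_le_sum_list[of \<nu>] by (auto simp: V1_def is_partition_def)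
      \<comment> \<open>Only S = A is possible, with an empty weight, so the column recursion
        reduces to a single product.\<close>
      have "{S. S \<subseteq> A \<and> card S = k} = {A}" using A card_subset_eq by auto
      then have col: "hl_p \<nu> A = (\<Prod>a\<in>A. fvar a) * hl_p (r \<nu>) A" if "\<nu> \<in> V1" for \<nu>
        using hl_p_add_column[of A "r \<nu>" k] r[OF that] A
        by (simp add: partition_of_def is_partition_def flip: r(1)[OF that])
      have "(\<Sum>\<nu>\<in>V0. fconst (c \<nu>) * hl_p \<nu> A) = 0" by (intro sum.neutral) (auto simp: V0)
      then have "0 = (\<Sum>\<nu>\<in>V1. fconst (c \<nu>) * hl_p \<nu> A)"
        using eq VV f01 by (simp add: sum.union_disjoint)
      also have "\<dots> = (\<Prod>a\<in>A. fvar a) * (\<Sum>\<nu>\<in>V1. fconst (c \<nu>) * hl_p (r \<nu>) A)"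
        unfolding sum_distrib_left by (intro sum.cong refl) (simp add: col)
      also have "(\<Sum>\<nu>\<in>V1. fconst (c \<nu>) * hl_p (r \<nu>) A) =
          (\<Sum>\<rho>\<in>r ` V1. fconst (c (add_column k \<rho>)) * hl_p \<rho> A)"
        by (subst sum.reindex[OF inj]) (auto simp flip: r(1) intro!: sum.cong)
      finally have "(\<Sum>\<rho>\<in>r ` V1. fconst (c (add_column k \<rho>)) * hl_p \<rho> A) = 0"
        using A by simp
      then have "c (add_column k (r \<mu>)) = 0"
      proof (rule less.hyps[of k "s - k" "r ` V1" A "\<lambda>\<rho>. c (add_column k \<rho>)" "r \<mu>", rotated 5])
        show "k + (s - k) < k + s" using False size[OF \<mu>] by simp
        show "is_partition \<rho> \<and> length \<rho> \<le> k \<and> sum_list \<rho> \<le> s - k" if "\<rho> \<in> r ` V1" for \<rho>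
          using that r(2,3) size by (auto simp: partition_of_def intro!: diff_le_mono)
      qed (use \<mu> A f01 in auto)
      then show ?thesis using r(1)[OF \<mu>] by simp
    qed
    from V0 V1 VV less.prems(6) show ?thesis by blast
  qed
qed

lemma HL_Q_independent:
  assumes "finite V" "\<And>\<nu>. \<nu> \<in> V \<Longrightarrow> is_partition \<nu>" "(\<Sum>\<nu>\<in>V. mconst (c \<nu>) * HL_Q t \<nu>) = 0" "\<nu> \<in> V"
  shows "c \<nu> = 0"
proof -
  define k where "k = Max (length ` V)"
  define s where "s = Max (sum_list ` V)"
  have "represents (\<lambda>A. \<Sum>\<nu>\<in>V. fconst (c \<nu>) * (fconst (HL_b t \<nu>) * hl_p \<nu> A)) (\<Sum>\<nu>\<in>V. mconst (c \<nu>) * HL_Q t \<nu>)"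
    using assms(1,2) by (intro represents_sum represents_mult represents_const represents_HL_Q)
      (auto simp: is_partition_def)
  then have rep: "represents (\<lambda>A. \<Sum>\<nu>\<in>V. fconst (c \<nu>) * (fconst (HL_b t \<nu>) * hl_p \<nu> A)) 0"
    unfolding assms(3) .
  obtain F where F: "to_fract F = (\<Sum>\<nu>\<in>V. fconst (c \<nu>) * (fconst (HL_b t \<nu>) * hl_p \<nu> {..<k}))"
    "\<And>m. Poly_Mapping.lookup F m = (if Poly_Mapping.keys m \<subseteq> {..<k} then mcoeff 0 m else 0)"
    using representsE[OF rep finite_lessThan] by blast
  have "F = 0" by (rule poly_mapping_eqI) (simp add: F(2)[unfolded mcoeff_zero])
  with F(1) have "(\<Sum>\<nu>\<in>V. fconst (c \<nu> * HL_b t \<nu>) * hl_p \<nu> {..<k}) = 0" by (simp add: mult.assoc)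
  then have "c \<nu> * HL_b t \<nu> = 0"
    by (rule hl_p_independent[of V k s "{..<k}" "\<lambda>\<nu>. c \<nu> * HL_b t \<nu>", rotated 4])
       (use assms in \<open>auto simp: k_def s_def\<close>)
  then show ?thesis using HL_b_nonzero by simp
qed

end

section \<open>Algebraic independence of the power sums\<close>

definition mp_monom :: "(nat \<Rightarrow> 'a::comm_ring_1 mseries) \<Rightarrow> (nat \<Rightarrow>\<^sub>0 nat) \<Rightarrow> 'a mseries" where
  "mp_monom y m = (\<Prod>r\<in>Poly_Mapping.keys m. y r ^ Poly_Mapping.lookup m r)"

lemma mp_monom_superset:
  "finite B \<Longrightarrow> Poly_Mapping.keys m \<subseteq> B \<Longrightarrow> mp_monom y m = (\<Prod>r\<in>B. y r ^ Poly_Mapping.lookup m r)"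
  unfolding mp_monom_def by (rule prod.mono_neutral_left) (auto simp: in_keys_iff)

lemma mp_monom_add: "mp_monom y (a + b) = mp_monom y a * mp_monom y b"
proof -
  let ?B = "Poly_Mapping.keys a \<union> Poly_Mapping.keys b"
  have "mp_monom y (a + b) = (\<Prod>r\<in>?B. y r ^ Poly_Mapping.lookup (a + b) r)"
    by (rule mp_monom_superset) (auto simp: keys_plus_nat)
  then show ?thesis
    using mp_monom_superset[of ?B a y] mp_monom_superset[of ?B b y]
    by (simp add: lookup_add power_add prod.distrib)
qed

lemma mp_monom_single [simp]: "mp_monom y (Poly_Mapping.single r j) = y r ^ j"
  by (cases "j = 0") (simp_all add: mp_monom_def)

lemma mp_monom_0 [simp]: "mp_monom y 0 = 1"
  by (simp add: mp_monom_def)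

lemma mconst_add: "mconst (a + b) = mconst a + mconst (b :: 'a::comm_ring_1)"
  by (rule mseries_eqI) (simp add: mconst.rep_eq)

lemma mconst_0 [simp]: "mconst 0 = (0 :: 'a::comm_ring_1 mseries)"
  by (rule mseries_eqI) (simp add: mconst.rep_eq)

lemma mconst_1 [simp]: "mconst 1 = (1 :: 'a::comm_ring_1 mseries)"
  by (rule mseries_eqI) (simp add: mconst.rep_eq one_mseries.rep_eq)

lemma mconst_mult: "mconst (a * b) = mconst a * mconst (b :: 'a::comm_ring_1)"
  by (rule mseries_eqI) (simp add: mconst.rep_eq)

lemma mp_eval_superset:
  assumes "finite B" "Poly_Mapping.keys F \<subseteq> B"
  shows "mp_eval y F = (\<Sum>m\<in>B. mconst (Poly_Mapping.lookup F m) * mp_monom y m)"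
  unfolding mp_eval_def mp_monom_def
  by (rule sum.mono_neutral_left) (use assms in \<open>auto simp: in_keys_iff\<close>)

lemma mp_eval_add: "mp_eval y (F + G) = mp_eval y F + mp_eval y G"
proof -
  let ?B = "Poly_Mapping.keys F \<union> Poly_Mapping.keys G"
  have "mp_eval y (F + G) = (\<Sum>m\<in>?B. mconst (Poly_Mapping.lookup (F + G) m) * mp_monom y m)"
    by (rule mp_eval_superset) (auto simp: Poly_Mapping.keys_add)
  also have "\<dots> = (\<Sum>m\<in>?B. mconst (Poly_Mapping.lookup F m) * mp_monom y m) +
      (\<Sum>m\<in>?B. mconst (Poly_Mapping.lookup G m) * mp_monom y m)"
    by (simp add: lookup_add mconst_add distrib_right sum.distrib)
  also have "\<dots> = mp_eval y F + mp_eval y G"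
    using mp_eval_superset[of ?B F y] mp_eval_superset[of ?B G y] by simp
  finally show ?thesis .
qed

lemma mp_eval_0 [simp]: "mp_eval y 0 = 0"
  by (simp add: mp_eval_def)

lemma mp_eval_diff: "mp_eval y (F - G) = mp_eval y F - mp_eval y G"
  using mp_eval_add[of y "F - G" G] by simp

lemma mp_eval_sum: "mp_eval y (sum F I) = (\<Sum>i\<in>I. mp_eval y (F i))"
  by (induction I rule: infinite_finite_induct) (simp_all add: mp_eval_add)

lemma mp_eval_single: "mp_eval y (Poly_Mapping.single m c) = mconst c * mp_monom y m"
  using mp_eval_superset[of "{m}" "Poly_Mapping.single m c" y] by simp

lemma sum_single_lookup:
  "(\<Sum>m\<in>Poly_Mapping.keys F. Poly_Mapping.single m (Poly_Mapping.lookup F m)) = (F :: 'a::comm_ring_1 mpol)"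
proof (rule poly_mapping_eqI)
  fix k
  have "Poly_Mapping.lookup (\<Sum>m\<in>Poly_Mapping.keys F. Poly_Mapping.single m (Poly_Mapping.lookup F m)) k =
      (\<Sum>m\<in>Poly_Mapping.keys F. if m = k then Poly_Mapping.lookup F m else 0)"
    unfolding lookup_sum by (intro sum.cong refl) (simp add: lookup_single when_def)
  then show "Poly_Mapping.lookup (\<Sum>m\<in>Poly_Mapping.keys F. Poly_Mapping.single m (Poly_Mapping.lookup F m)) k =
      Poly_Mapping.lookup F k"
    by (simp add: in_keys_iff)
qed

lemma mp_eval_single_mult:
  "mp_eval y (Poly_Mapping.single k c * F) = mconst c * mp_monom y k * mp_eval y F"
proof -
  let ?K = "Poly_Mapping.keys F"
  have "mp_eval y (Poly_Mapping.single k c * F) =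
      mp_eval y (Poly_Mapping.single k c * (\<Sum>m\<in>?K. Poly_Mapping.single m (Poly_Mapping.lookup F m)))"
    by (simp only: sum_single_lookup)
  also have "\<dots> = (\<Sum>m\<in>?K. mconst (c * Poly_Mapping.lookup F m) * mp_monom y (k + m))"
    unfolding sum_distrib_left mult_single mp_eval_sum mp_eval_single ..
  also have "\<dots> = mconst c * mp_monom y k * (\<Sum>m\<in>?K. mconst (Poly_Mapping.lookup F m) * mp_monom y m)"
    unfolding sum_distrib_left by (intro sum.cong refl) (simp add: mconst_mult mp_monom_add ac_simps)
  finally show ?thesis by (simp add: mp_eval_superset[of ?K F y])
qed

lemma finite_le_lookup: "0 < s \<Longrightarrow> finite {i. s \<le> Poly_Mapping.lookup (m :: nat \<Rightarrow>\<^sub>0 nat) i}"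
  by (rule finite_subset[OF _ finite_keys[of m]]) (auto simp: in_keys_iff)

text \<open>The terms of the product that reach m correspond to the factors x_i^s of m. For s > 0
  different i give different monomials of the power sum.\<close>

lemma mcoeff_power_sum_mult:
  assumes "0 < s"
  shows "mcoeff (power_sum s * f) m = (\<Sum>i | s \<le> Poly_Mapping.lookup m i. mcoeff f (m - Poly_Mapping.single i s))"
proof -
  let ?I = "{i. s \<le> Poly_Mapping.lookup m i}"
  let ?h = "\<lambda>i. (Poly_Mapping.single i s, m - Poly_Mapping.single i s)"
  have split: "Poly_Mapping.single i s + (m - Poly_Mapping.single i s) = m" if "i \<in> ?I" for i
    by (rule poly_mapping_eqI) (use that in \<open>auto simp: lookup_add lookup_minus lookup_single when_def\<close>)
  have inj: "inj_on ?h ?I"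
  proof (rule inj_onI)
    fix i j assume "?h i = ?h j"
    then have "Poly_Mapping.keys (Poly_Mapping.single i s) = Poly_Mapping.keys (Poly_Mapping.single j s)" by simp
    then show "i = j" using assms by simp
  qed
  have "mcoeff (power_sum s * f) m = (\<Sum>p\<in>?h ` ?I. mcoeff (power_sum s) (fst p) * mcoeff f (snd p))"
    unfolding mcoeff_mult case_prod_unfold
  proof (rule sum.mono_neutral_right)
    show "finite {p. fst p + snd p = m}" using finite_splits[of m] by (simp only: case_prod_unfold)
    show "?h ` ?I \<subseteq> {p. fst p + snd p = m}" using split by auto
    show "\<forall>p\<in>{p. fst p + snd p = m} - ?h ` ?I. mcoeff (power_sum s) (fst p) * mcoeff f (snd p) = 0"
    proof
      fix p assume p: "p \<in> {p. fst p + snd p = m} - ?h ` ?I"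
      have "\<not> (\<exists>i. fst p = Poly_Mapping.single i s)"
      proof
        assume "\<exists>i. fst p = Poly_Mapping.single i s"
        then obtain i where i: "fst p = Poly_Mapping.single i s" by blast
        have m: "m = Poly_Mapping.single i s + snd p" using p i by simp
        have "s \<le> Poly_Mapping.lookup m i" unfolding m by (simp add: lookup_add)
        moreover have "m - Poly_Mapping.single i s = snd p" unfolding m by simp
        then have "p = ?h i" using i by (simp add: prod_eq_iff)
        ultimately have "p \<in> ?h ` ?I" by blast
        then show False using p by blast
      qed
      then show "mcoeff (power_sum s) (fst p) * mcoeff f (snd p) = 0"
        by (simp add: power_sum.rep_eq)
    qed
  qed
  also have "\<dots> = (\<Sum>i\<in>?I. mcoeff f (m - Poly_Mapping.single i s))"
    unfolding sum.reindex[OF inj] o_def by (intro sum.cong refl) (auto simp: power_sum.rep_eq)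
  finally show ?thesis .
qed

text \<open>The exponents of the monomial \<open>m\<close> form the partition with \<open>a r\<close> parts \<open>r + 1\<close>.\<close>

definition has_type :: "(nat \<Rightarrow>\<^sub>0 nat) \<Rightarrow> (nat \<Rightarrow>\<^sub>0 nat) \<Rightarrow> bool" where
  "has_type m a \<longleftrightarrow> card (Poly_Mapping.keys m) = mdegree a \<and>
     (\<forall>r. card {i. Poly_Mapping.lookup m i = Suc r} = Poly_Mapping.lookup a r)"

lemma has_type_unique: "has_type m a \<Longrightarrow> has_type m b \<Longrightarrow> a = b"
  by (intro poly_mapping_eqI) (simp add: has_type_def)

lemma finite_lookup_eq_Suc: "finite {i. Poly_Mapping.lookup (m :: nat \<Rightarrow>\<^sub>0 nat) i = Suc r}"
  by (rule finite_subset[OF _ finite_keys[of m]]) (auto simp: in_keys_iff)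

lemma exponent_induct [case_names zero add]:
  fixes a :: "nat \<Rightarrow>\<^sub>0 nat"
  assumes "P 0" "\<And>r a. P a \<Longrightarrow> P (Poly_Mapping.single r 1 + a)"
  shows "P a"
proof (induction "mdegree a" arbitrary: a)
  case 0
  then have "\<forall>i\<in>Poly_Mapping.keys a. Poly_Mapping.lookup a i = 0" by (simp add: mdegree_def)
  then have "a = 0" by (intro poly_mapping_eqI) (auto simp: in_keys_iff)
  then show ?case using assms(1) by simp
next
  case (Suc n)
  then have "a \<noteq> 0" by (auto simp: mdegree_def)
  then obtain r where r: "Poly_Mapping.lookup a r \<noteq> 0"
    by (metis poly_mapping_eqI lookup_zero)
  define b where "b = a - Poly_Mapping.single r 1"
  have ab: "a = Poly_Mapping.single r 1 + b"
    by (rule poly_mapping_eqI) (use r in \<open>auto simp: b_def lookup_add lookup_minus lookup_single when_def\<close>)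
  have "mdegree a = Suc (mdegree b)" by (subst ab) (simp add: mdegree_add)
  then have "P b" using Suc by simp
  then show ?case using assms(2) by (subst ab)
qed

lemma keys_minus_single:
  fixes m :: "nat \<Rightarrow>\<^sub>0 nat"
  shows "Poly_Mapping.keys (m - Poly_Mapping.single i s) =
    (if Poly_Mapping.lookup m i \<le> s then Poly_Mapping.keys m - {i} else Poly_Mapping.keys m)"
  by (auto simp: in_keys_iff lookup_minus lookup_single when_def split: if_splits)

text \<open>Taking out the whole power of x_i deletes one variable of m and one part r + 1 of its
  type.\<close>

lemma has_type_add_single:
  assumes "Poly_Mapping.lookup m i = Suc r"
  shows "has_type m (Poly_Mapping.single r 1 + a) \<longleftrightarrow> has_type (m - Poly_Mapping.single i (Suc r)) a"
proof -
  let ?m = "m - Poly_Mapping.single i (Suc r)"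
  have i: "i \<in> Poly_Mapping.keys m" using assms by (simp add: in_keys_iff)
  have k: "Poly_Mapping.keys ?m = Poly_Mapping.keys m - {i}" unfolding keys_minus_single using assms by simp
  have c1: "card (Poly_Mapping.keys m) = Suc (card (Poly_Mapping.keys ?m))"
    unfolding k using card_Suc_Diff1[OF finite_keys i] by simp
  have c2: "card {j. Poly_Mapping.lookup m j = Suc q} =
      (if q = r then 1 else 0) + card {j. Poly_Mapping.lookup ?m j = Suc q}" for q
  proof -
    have "{j. Poly_Mapping.lookup ?m j = Suc q} = {j. Poly_Mapping.lookup m j = Suc q} - {i}"
      using assms by (auto simp: lookup_minus lookup_single when_def)
    moreover have "i \<in> {j. Poly_Mapping.lookup m j = Suc q} \<longleftrightarrow> q = r" using assms by auto
    ultimately show ?thesis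
      using card_Suc_Diff1[OF finite_lookup_eq_Suc, of i m q] by (cases "q = r") auto
  qed
  have "(card {j. Poly_Mapping.lookup m j = Suc q} = Poly_Mapping.lookup (Poly_Mapping.single r 1 + a) q) \<longleftrightarrow>
      card {j. Poly_Mapping.lookup ?m j = Suc q} = Poly_Mapping.lookup a q" for q
    unfolding c2 by (simp add: lookup_add lookup_single when_def)
  then show ?thesis unfolding has_type_def c1 mdegree_add by simp
qed

lemma ex_has_type: "\<exists>m. has_type m a"
proof (induction a rule: exponent_induct)
  case zero
  show ?case by (rule exI[of _ 0]) (simp add: has_type_def mdegree_def)
next
  case (add r a)
  then obtain m where m: "has_type m a" by blast
  obtain i where i: "i \<notin> Poly_Mapping.keys m" using ex_new_if_finite[OF infinite_UNIV_nat finite_keys] by blast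
  let ?m = "m + Poly_Mapping.single i (Suc r)"
  have "Poly_Mapping.lookup ?m i = Suc r" using i by (simp add: lookup_add in_keys_iff)
  moreover have "?m - Poly_Mapping.single i (Suc r) = m" by simp
  ultimately have "has_type ?m (Poly_Mapping.single r 1 + a)"
    using m has_type_add_single[of ?m i r a] by simp
  then show ?case by blast
qed

text \<open>
  A product of \<open>l\<close> power sums contains only monomials in at most \<open>l\<close> variables, and those in
  exactly \<open>l\<close> variables determine the product.
\<close>

lemma mcoeff_power_sum_monomial:
  fixes a :: "nat \<Rightarrow>\<^sub>0 nat"
  defines "p \<equiv> (\<lambda>r. power_sum (Suc r) :: 'a::field_char_0 mseries)"
  shows "(mdegree a \<le> card (Poly_Mapping.keys m) \<longrightarrow> \<not> has_type m a \<longrightarrow> mcoeff (mp_monom p a) m = 0) \<and>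
    (has_type m a \<longrightarrow> (\<exists>c>0. mcoeff (mp_monom p a) m = of_nat c))"
proof (induction a arbitrary: m rule: exponent_induct)
  case zero
  have "has_type m 0 \<longleftrightarrow> m = 0"
    by (auto simp: has_type_def mdegree_def)
  then show ?case by (auto simp: one_mseries.rep_eq intro!: exI[of _ "1::nat"])
next
  case (add r a)
  define m' where "m' i = m - Poly_Mapping.single i (Suc r)" for i
  define I where "I = {i. Suc r \<le> Poly_Mapping.lookup m i}"
  define J where "J = {i. Poly_Mapping.lookup m i = Suc r}"
  have fin: "finite I" unfolding I_def by (rule finite_le_lookup) simp
  have JI: "J \<subseteq> I" by (auto simp: I_def J_def)
  have "mp_monom p (Poly_Mapping.single r 1 + a) = power_sum (Suc r) * mp_monom p a"
    by (simp add: mp_monom_add p_def)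
  then have c: "mcoeff (mp_monom p (Poly_Mapping.single r 1 + a)) m = (\<Sum>i\<in>I. mcoeff (mp_monom p a) (m' i))"
    by (simp add: mcoeff_power_sum_mult m'_def I_def)
  have deg: "mdegree (Poly_Mapping.single r 1 + a) = Suc (mdegree a)" by (simp add: mdegree_add)
  \<comment> \<open>If x_i divides m to a higher power than r + 1, it stays behind, and then more
    variables are left than the remaining product has factors.\<close>
  have IJ: "mcoeff (mp_monom p a) (m' i) = 0"
    if "Suc (mdegree a) \<le> card (Poly_Mapping.keys m)" "i \<in> I - J" for i
  proof -
    have "Poly_Mapping.keys (m' i) = Poly_Mapping.keys m"
      unfolding m'_def keys_minus_single using that by (auto simp: I_def J_def)
    then have "mdegree a < card (Poly_Mapping.keys (m' i))" using that by simp
    then have "mdegree a \<le> card (Poly_Mapping.keys (m' i))" "\<not> has_type (m' i) a" by (auto simp: has_type_def)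
    then show ?thesis using add.IH[of "m' i"] by blast
  qed
  have J: "mcoeff (mp_monom p (Poly_Mapping.single r 1 + a)) m = (\<Sum>i\<in>J. mcoeff (mp_monom p a) (m' i))"
    if "Suc (mdegree a) \<le> card (Poly_Mapping.keys m)"
    unfolding c by (rule sum.mono_neutral_right[OF fin JI]) (use IJ[OF that] in blast)
  have type: "has_type m (Poly_Mapping.single r 1 + a) \<longleftrightarrow> has_type (m' i) a" if "i \<in> J" for i
    unfolding m'_def by (rule has_type_add_single) (use that in \<open>simp add: J_def\<close>)
  show ?case
  proof (intro conjI impI)
    assume le: "mdegree (Poly_Mapping.single r 1 + a) \<le> card (Poly_Mapping.keys m)"
      and nt: "\<not> has_type m (Poly_Mapping.single r 1 + a)"
    have le': "Suc (mdegree a) \<le> card (Poly_Mapping.keys m)" using le deg by simp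
    have "mcoeff (mp_monom p a) (m' i) = 0" if i: "i \<in> J" for i
    proof -
      have "card (Poly_Mapping.keys m) - 1 \<le> card (Poly_Mapping.keys (m' i))"
        unfolding m'_def keys_minus_single by (auto simp: card_Diff_singleton_if)
      then have "mdegree a \<le> card (Poly_Mapping.keys (m' i))" using le' by simp
      then show ?thesis using add.IH[of "m' i"] nt type[OF i] by blast
    qed
    then show "mcoeff (mp_monom p (Poly_Mapping.single r 1 + a)) m = 0"
      unfolding J[OF le'] by (simp add: sum.neutral)
  next
    assume t: "has_type m (Poly_Mapping.single r 1 + a)"
    then have le': "Suc (mdegree a) \<le> card (Poly_Mapping.keys m)" using deg by (simp add: has_type_def)
    \<comment> \<open>The coefficients are tracked as positive integers, so that in characteristic 0
      their sum over J cannot cancel.\<close>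
    have "\<exists>c>0. mcoeff (mp_monom p a) (m' i) = of_nat c" if "i \<in> J" for i
      using add.IH[of "m' i"] t type[OF that] by blast
    then obtain d where d: "\<And>i. i \<in> J \<Longrightarrow> d i > (0::nat) \<and> mcoeff (mp_monom p a) (m' i) = of_nat (d i)" by metis
    have "card J = Poly_Mapping.lookup (Poly_Mapping.single r 1 + a) r" using t by (simp add: has_type_def J_def)
    then have "card J > 0" by (simp add: lookup_add)
    then have "finite J" "J \<noteq> {}" by (auto simp: card_gt_0_iff)
    then have "(\<Sum>i\<in>J. d i) > 0" using d by (intro sum_pos) auto
    moreover have "mcoeff (mp_monom p (Poly_Mapping.single r 1 + a)) m = of_nat (\<Sum>i\<in>J. d i)"
      unfolding J[OF le'] using d by simp
    ultimately show "\<exists>c>0. mcoeff (mp_monom p (Poly_Mapping.single r 1 + a)) m = of_nat c" by blast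
  qed
qed

text \<open>Let a be a term of F with the largest number of power sums and m a monomial of type a.
  Every other term of F has at most as many factors and a different type, so the coefficient at m
  sees the term a alone.\<close>

lemma power_sums_algebraically_independent:
  fixes F :: "'a::field_char_0 mpol"
  assumes "mp_eval (\<lambda>r. power_sum (Suc r)) F = 0"
  shows "F = 0"
proof (rule ccontr)
  assume "F \<noteq> 0"
  then have K: "Poly_Mapping.keys F \<noteq> {}" by simp
  define L where "L = Max (mdegree ` Poly_Mapping.keys F)"
  have "L \<in> mdegree ` Poly_Mapping.keys F" unfolding L_def using K by (intro Max_in) auto
  then obtain a where a: "a \<in> Poly_Mapping.keys F" "mdegree a = L" by blast
  have le: "mdegree b \<le> mdegree a" if "b \<in> Poly_Mapping.keys F" for b
    using that a(2) by (auto simp: L_def)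
  obtain m where m: "has_type m a" using ex_has_type by blast
  let ?p = "\<lambda>r. power_sum (Suc r) :: 'a mseries"
  obtain c where c: "c > 0" "mcoeff (mp_monom ?p a) m = of_nat c"
    using mcoeff_power_sum_monomial[of a m, where ?'a = 'a] m by blast
  have "0 = mcoeff (mp_eval ?p F) m" using assms by simp
  also have "\<dots> = (\<Sum>b\<in>Poly_Mapping.keys F. Poly_Mapping.lookup F b * mcoeff (mp_monom ?p b) m)"
    by (simp add: mp_eval_superset[of "Poly_Mapping.keys F"] mcoeff_sum)
  also have "\<dots> = (\<Sum>b\<in>{a}. Poly_Mapping.lookup F b * mcoeff (mp_monom ?p b) m)"
  proof (rule sum.mono_neutral_right)
    show "\<forall>b\<in>Poly_Mapping.keys F - {a}. Poly_Mapping.lookup F b * mcoeff (mp_monom ?p b) m = 0"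
    proof
      fix b assume b: "b \<in> Poly_Mapping.keys F - {a}"
      then have "\<not> has_type m b" using has_type_unique[OF m] by blast
      moreover have "mdegree b \<le> card (Poly_Mapping.keys m)" using le[of b] b m by (simp add: has_type_def)
      ultimately have "mcoeff (mp_monom ?p b) m = 0"
        using mcoeff_power_sum_monomial[of b m, where ?'a = 'a] by blast
      then show "Poly_Mapping.lookup F b * mcoeff (mp_monom ?p b) m = 0" by simp
    qed
  qed (use a in auto)
  also have "\<dots> = Poly_Mapping.lookup F a * of_nat c" using c by simp
  finally show False using c a by (simp add: in_keys_iff)
qed

section \<open>The substitution and the Schur function of a column\<close>

text \<open>\<open>e_coeff s j\<close> is the coefficient of \<open>x\<^sup>j\<close> in \<open>(1 + x) / (1 + s x)\<close>.\<close>

definition e_coeff :: "'a::field \<Rightarrow> nat \<Rightarrow> 'a" where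
  "e_coeff s j = (if j = 0 then 1 else (1 - s) * (- s) ^ (j - 1))"

lemma e_coeff_0 [simp]: "e_coeff s 0 = 1"
  by (simp add: e_coeff_def)

text \<open>The part of degree n of the product of (1 + x) / (1 + s x) over all variables. It is e_n
  for s = 0 and turns out to be e_n[(1 - t)X] for s = t, so that one recursion in s treats
  both.\<close>

definition e_mseries :: "'a::field \<Rightarrow> nat \<Rightarrow> 'a mseries" where
  "e_mseries s n = MSeries (\<lambda>m. if mdegree m = n
     then \<Prod>i\<in>Poly_Mapping.keys m. e_coeff s (Poly_Mapping.lookup m i) else 0)"

lemma mcoeff_e_mseries:
  "mcoeff (e_mseries s n) m = (if mdegree m = n
     then \<Prod>i\<in>Poly_Mapping.keys m. e_coeff s (Poly_Mapping.lookup m i) else 0)"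
  by (simp add: e_mseries_def MSeries_inverse)

text \<open>The recursion is the logarithmic derivative of \<open>(1 + x) / (1 + s x)\<close>.\<close>

lemma e_coeff_newton:
  "(\<Sum>r = 1..M. (-1) ^ (r - 1) * (1 - s ^ r) * e_coeff s (M - r)) = of_nat M * e_coeff s M"
proof (induction M)
  case (Suc M)
  let ?k = "\<lambda>r. (-1) ^ (r - 1) * (1 - s ^ r)"
  show ?case
  proof (cases "M = 0")
    case True
    then show ?thesis by (simp add: e_coeff_def)
  next
    case False
    \<comment> \<open>The coefficients are geometric with ratio -s from index 1 on; the correction
      at r = M accounts for the step from index 0 to 1.\<close>
    have e: "e_coeff s (Suc M - r) = - s * e_coeff s (M - r) + (if r = M then 1 else 0)"
      if "r \<in> {1..M}" for r
    proof (cases "r = M")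
      case True
      then show ?thesis by (simp add: e_coeff_def)
    next
      case False
      then have "M - r \<noteq> 0" using that by auto
      then obtain d where d: "M - r = Suc d" by (cases "M - r") auto
      then have "Suc M - r = Suc (Suc d)" using that by auto
      then show ?thesis using d False by (simp add: e_coeff_def)
    qed
    have "(\<Sum>r = 1..Suc M. ?k r * e_coeff s (Suc M - r)) =
        ?k (Suc M) + (\<Sum>r = 1..M. ?k r * e_coeff s (Suc M - r))"
      by simp
    also have "(\<Sum>r = 1..M. ?k r * e_coeff s (Suc M - r)) =
        (\<Sum>r = 1..M. - s * (?k r * e_coeff s (M - r)) + (if r = M then ?k M else 0))"
      by (rule sum.cong[OF refl]) (simp only: e, simp add: algebra_simps)
    also have "\<dots> = - s * (\<Sum>r = 1..M. ?k r * e_coeff s (M - r)) + ?k M"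
      unfolding sum.distrib sum_distrib_left using False by simp
    also have "?k (Suc M) + (- s * (\<Sum>r = 1..M. ?k r * e_coeff s (M - r)) + ?k M) =
        (?k (Suc M) + ?k M) - s * of_nat M * e_coeff s M"
      unfolding Suc by (simp add: algebra_simps)
    also have "?k (Suc M) + ?k M = (1 - s) * (- s) ^ M"
    proof -
      obtain d where d: "M = Suc d" using False by (cases M) auto
      have "(- s) ^ M = (-1) ^ M * s ^ M" using power_mult_distrib[of "-1" s M] by simp
      then show ?thesis unfolding d by (simp only:) (simp add: algebra_simps)
    qed
    also have "(1 - s) * (- s) ^ M - s * of_nat M * e_coeff s M = of_nat (Suc M) * e_coeff s (Suc M)"
      using False by (cases M) (simp_all add: e_coeff_def algebra_simps)
    finally show ?thesis .
  qed
qed simp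

text \<open>Taking x_i^r out of m changes the factor of the variable i only. For each i this leaves
  the recursion in one variable, and the resulting factors, the exponents of m, add up to n.\<close>

lemma e_mseries_newton:
  fixes s :: "'a::field"
  shows "mconst (of_nat n) * e_mseries s n =
    (\<Sum>r = 1..n. mconst ((-1) ^ (r - 1) * (1 - s ^ r)) * (power_sum r * e_mseries s (n - r)))"
proof (rule mseries_eqI)
  fix m :: "nat \<Rightarrow>\<^sub>0 nat"
  let ?k = "\<lambda>r. (-1) ^ (r - 1) * (1 - s ^ r)"
  let ?K = "Poly_Mapping.keys m"
  let ?l = "Poly_Mapping.lookup m"
  define E where "E i r = mcoeff (e_mseries s (n - r)) (m - Poly_Mapping.single i r)" for i r
  have "mcoeff (\<Sum>r = 1..n. mconst (?k r) * (power_sum r * e_mseries s (n - r))) m =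
      (\<Sum>r = 1..n. \<Sum>i | i \<in> ?K \<and> r \<le> ?l i. ?k r * E i r)"
    unfolding mcoeff_sum
  proof (rule sum.cong[OF refl])
    fix r assume r: "r \<in> {1..n}"
    have "{i. r \<le> ?l i} = {i. i \<in> ?K \<and> r \<le> ?l i}" using r by (auto simp: in_keys_iff)
    then show "mcoeff (mconst (?k r) * (power_sum r * e_mseries s (n - r))) m =
        (\<Sum>i | i \<in> ?K \<and> r \<le> ?l i. ?k r * E i r)"
      using r by (simp add: mcoeff_power_sum_mult E_def sum_distrib_left)
  qed
  also have "\<dots> = (\<Sum>i\<in>?K. \<Sum>r | r \<in> {1..n} \<and> r \<le> ?l i. ?k r * E i r)"
    by (rule sum.swap_restrict) auto
  also have "\<dots> = (\<Sum>i\<in>?K. of_nat (?l i) * mcoeff (e_mseries s n) m)"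
  proof (rule sum.cong[OF refl])
    fix i assume i: "i \<in> ?K"
    have deg: "mdegree (m - Poly_Mapping.single i r) + r = mdegree m" if "r \<le> ?l i" for r
    proof -
      have "m = (m - Poly_Mapping.single i r) + Poly_Mapping.single i r"
        by (rule poly_mapping_eqI) (use that in \<open>auto simp: lookup_add lookup_minus lookup_single when_def\<close>)
      then show ?thesis by (metis mdegree_add mdegree_single)
    qed
    have le: "?l i \<le> mdegree m" unfolding mdegree_def using i by (intro member_le_sum) auto
    show "(\<Sum>r | r \<in> {1..n} \<and> r \<le> ?l i. ?k r * E i r) = of_nat (?l i) * mcoeff (e_mseries s n) m"
    proof (cases "mdegree m = n")
      case False
      have "E i r = 0" if "r \<in> {1..n}" "r \<le> ?l i" for r
        unfolding E_def mcoeff_e_mseries using deg[OF that(2)] that False by auto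
      then show ?thesis using False by (simp add: mcoeff_e_mseries)
    next
      case True
      define R where "R = (\<Prod>j\<in>?K - {i}. e_coeff s (?l j))"
      have E: "E i r = e_coeff s (?l i - r) * R" if "r \<in> {1..?l i}" for r
      proof -
        let ?m = "m - Poly_Mapping.single i r"
        have d: "mdegree ?m = n - r" using deg[of r] that True by simp
        have "(\<Prod>j\<in>Poly_Mapping.keys ?m. e_coeff s (Poly_Mapping.lookup ?m j)) =
            (\<Prod>j\<in>?K. e_coeff s (Poly_Mapping.lookup ?m j))"
          by (rule prod.mono_neutral_left) (auto simp: in_keys_iff lookup_minus)
        also have "\<dots> = e_coeff s (Poly_Mapping.lookup ?m i) * (\<Prod>j\<in>?K - {i}. e_coeff s (Poly_Mapping.lookup ?m j))"
          using i by (simp add: prod.remove)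
        also have "\<dots> = e_coeff s (?l i - r) * R"
          unfolding R_def by (intro arg_cong2[of _ _ _ _ "(*)"] prod.cong refl)
            (auto simp: lookup_minus lookup_single when_def)
        finally show ?thesis unfolding E_def mcoeff_e_mseries d by simp
      qed
      have "{r. r \<in> {1..n} \<and> r \<le> ?l i} = {1..?l i}" using le True by auto
      then have "(\<Sum>r | r \<in> {1..n} \<and> r \<le> ?l i. ?k r * E i r) =
          (\<Sum>r = 1..?l i. ?k r * e_coeff s (?l i - r)) * R"
        unfolding sum_distrib_right by (auto simp: E intro!: sum.cong)
      also have "\<dots> = of_nat (?l i) * (e_coeff s (?l i) * R)"
        unfolding e_coeff_newton by simp
      also have "e_coeff s (?l i) * R = mcoeff (e_mseries s n) m"
        unfolding R_def mcoeff_e_mseries using i True by (simp add: prod.remove[of ?K i])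
      finally show ?thesis .
    qed
  qed
  also have "\<dots> = of_nat (mdegree m) * mcoeff (e_mseries s n) m"
    by (simp add: mdegree_def sum_distrib_right)
  also have "\<dots> = mcoeff (mconst (of_nat n) * e_mseries s n) m"
    by (simp add: mcoeff_e_mseries)
  finally show "mcoeff (mconst (of_nat n) * e_mseries s n) m =
    mcoeff (\<Sum>r = 1..n. mconst (?k r) * (power_sum r * e_mseries s (n - r))) m" by simp
qed

text \<open>The order of the quantifiers matters: the recursion, written in the quantities (1 - s^r)
  p_r, has the coefficients (-1)^(r-1) / n, which are free of s. So the polynomial that expresses
  e_n in power sums, found at s = 0, also computes its image under the substitution.\<close>

lemma ex_newton_polynomial:
  "\<exists>F :: 'a::field_char_0 mpol. \<forall>s. mp_eval (\<lambda>r. mconst (1 - s ^ Suc r) * power_sum (Suc r)) F = e_mseries s n"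
proof (induction n rule: less_induct)
  case (less n)
  show ?case
  proof (cases "n = 0")
    case True
    have "e_mseries s 0 = (1 :: 'a mseries)" for s
    proof (rule mseries_eqI)
      fix m :: "nat \<Rightarrow>\<^sub>0 nat"
      have "mdegree m = 0 \<longleftrightarrow> m = 0" by (auto simp: mdegree_def in_keys_iff intro: poly_mapping_eqI)
      then show "mcoeff (e_mseries s 0) m = mcoeff 1 m" by (simp add: mcoeff_e_mseries one_mseries.rep_eq)
    qed
    then show ?thesis using True by (intro exI[of _ "Poly_Mapping.single 0 1"]) (simp only: mp_eval_single, simp)
  next
    case False
    define y where "y s r = mconst (1 - s ^ Suc r) * (power_sum (Suc r) :: 'a mseries)" for s r
    obtain G where G: "\<And>k s. k < n \<Longrightarrow> mp_eval (y s) (G k) = e_mseries s k"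
      using less.IH unfolding y_def by metis
    define F where "F = (\<Sum>r = 1..n. Poly_Mapping.single (Poly_Mapping.single (r - 1) 1) ((-1) ^ (r - 1) / of_nat n) * G (n - r))"
    have "mp_eval (y s) F = e_mseries s n" for s
    proof -
      have "mp_eval (y s) F = (\<Sum>r = 1..n. mconst (1 / of_nat n) *
          (mconst ((-1) ^ (r - 1) * (1 - s ^ r)) * (power_sum r * e_mseries s (n - r))))"
        unfolding F_def mp_eval_sum mp_eval_single_mult
      proof (rule sum.cong[OF refl])
        fix r assume r: "r \<in> {1..n}"
        then have g: "mp_eval (y s) (G (n - r)) = e_mseries s (n - r)" by (intro G) auto
        have yr: "y s (r - 1) = mconst (1 - s ^ r) * power_sum r" using r by (simp add: y_def)
        have "(-1) ^ (r - 1) / of_nat n = 1 / of_nat n * (-1 :: 'a) ^ (r - 1)" by simp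
        then show "mconst ((-1) ^ (r - 1) / of_nat n) * mp_monom (y s) (Poly_Mapping.single (r - 1) 1) *
            mp_eval (y s) (G (n - r)) = mconst (1 / of_nat n) *
            (mconst ((-1) ^ (r - 1) * (1 - s ^ r)) * (power_sum r * e_mseries s (n - r)))"
          unfolding g mp_monom_single power_one_right yr by (simp only: mconst_mult mult.assoc)
      qed
      also have "\<dots> = mconst (1 / of_nat n) * (mconst (of_nat n) * e_mseries s n)"
        unfolding e_mseries_newton sum_distrib_left ..
      also have "\<dots> = mconst (1 / of_nat n * of_nat n) * e_mseries s n"
        by (simp only: mconst_mult mult.assoc)
      also have "1 / of_nat n * of_nat n = (1 :: 'a)" using False by simp
      finally show ?thesis by simp
    qed
    then show ?thesis unfolding y_def by blast
  qed
qed

text \<open>One polynomial F is evaluated at s = 0 and at s = t; algebraic independence shows that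
  no other F can occur in the definite description.\<close>

lemma pleth_1mt_e_mseries:
  fixes t :: "'a::field_char_0"
  shows "pleth_1mt t (e_mseries 0 n) = e_mseries t n"
proof -
  obtain F :: "'a mpol" where F: "\<And>s. mp_eval (\<lambda>r. mconst (1 - s ^ Suc r) * power_sum (Suc r)) F = e_mseries s n"
    using ex_newton_polynomial by blast
  have F0: "mp_eval (\<lambda>r. power_sum (Suc r)) F = e_mseries 0 n"
    using F[of 0] by simp
  show ?thesis unfolding pleth_1mt_def
  proof (rule the_equality)
    show "\<exists>F. e_mseries 0 n = mp_eval (\<lambda>r. power_sum (Suc r)) F \<and>
        e_mseries t n = mp_eval (\<lambda>r. mconst (1 - t ^ Suc r) * power_sum (Suc r)) F"
      using F[of t] F0 by metis
  next
    fix g assume "\<exists>F. e_mseries 0 n = mp_eval (\<lambda>r. power_sum (Suc r)) F \<and>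
        g = mp_eval (\<lambda>r. mconst (1 - t ^ Suc r) * power_sum (Suc r)) F"
    then obtain F' where F': "e_mseries 0 n = mp_eval (\<lambda>r. power_sum (Suc r)) F'"
      "g = mp_eval (\<lambda>r. mconst (1 - t ^ Suc r) * power_sum (Suc r)) F'" by blast
    have "mp_eval (\<lambda>r. power_sum (Suc r)) (F' - F) = 0"
      by (simp only: mp_eval_diff F0 F'(1)[symmetric] diff_self)
    then have "F' - F = 0" by (rule power_sums_algebraically_independent)
    then show "g = e_mseries t n" using F'(2) F[of t] by simp
  qed
qed

text \<open>A column tableau is a strictly increasing list, so its content determines it: all
  exponents are at most 1, and the entries are the variables of m in increasing order. There is one
  tableau of content m or none.\<close>

lemma schur_column: "schur (replicate n 1) = (e_mseries 0 n :: 'a::field_char_0 mseries)"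
proof (rule mseries_eqI)
  fix m :: "nat \<Rightarrow>\<^sub>0 nat"
  let ?K = "Poly_Mapping.keys m"
  let ?D = "diagram (replicate n 1)"
  let ?X = "{T \<in> ssyt (replicate n 1). \<forall>k. card {c \<in> ?D. T c = k} = Poly_Mapping.lookup m k}"
  have D: "?D = (\<lambda>i. (i, 0)) ` {..<n}" by (auto simp: diagram_def)
  have content: "card {c \<in> ?D. T c = k} = card {i \<in> {..<n}. T (i, 0) = k}" for T :: "nat \<times> nat \<Rightarrow> nat" and k
  proof -
    have "{c \<in> ?D. T c = k} = (\<lambda>i. (i, 0)) ` {i \<in> {..<n}. T (i, 0) = k}" unfolding D by auto
    then show ?thesis by (simp add: card_image inj_on_def)
  qed
  have strict: "strict_mono_on {..<n} (\<lambda>i. T (i, 0))" if "T \<in> ssyt (replicate n 1)" for T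
  proof (rule strict_mono_onI)
    fix i j assume "i \<in> {..<n}" "j \<in> {..<n}" "i < j"
    have step: "T (i, 0) < T (Suc i, 0)" if "Suc i < n" for i
      using \<open>T \<in> ssyt (replicate n 1)\<close> that unfolding ssyt_def D by blast
    from \<open>i < j\<close> \<open>j \<in> {..<n}\<close> show "T (i, 0) < T (j, 0)"
    proof (induction j)
      case (Suc j)
      then show ?case using step[of j] by (cases "i = j") auto
    qed simp
  qed
  have image: "(\<lambda>i. T (i, 0)) ` {..<n} = ?K" and one: "Poly_Mapping.lookup m k \<le> 1" if "T \<in> ?X" for T k
  proof -
    have c: "card {i \<in> {..<n}. T (i, 0) = k} = Poly_Mapping.lookup m k" for k
      using that unfolding content by auto
    show "(\<lambda>i. T (i, 0)) ` {..<n} = ?K"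
    proof (intro set_eqI iffI)
      fix k assume "k \<in> (\<lambda>i. T (i, 0)) ` {..<n}"
      then have "{i \<in> {..<n}. T (i, 0) = k} \<noteq> {}" by auto
      then have "card {i \<in> {..<n}. T (i, 0) = k} \<noteq> 0" by simp
      then show "k \<in> ?K" unfolding c by (simp add: in_keys_iff)
    next
      fix k assume "k \<in> ?K"
      then have "card {i \<in> {..<n}. T (i, 0) = k} \<noteq> 0" unfolding c by (simp add: in_keys_iff)
      then have "{i \<in> {..<n}. T (i, 0) = k} \<noteq> {}" by (metis card.empty)
      then show "k \<in> (\<lambda>i. T (i, 0)) ` {..<n}" by auto
    qed
    have "inj_on (\<lambda>i. T (i, 0)) {..<n}"
      by (rule strict_mono_on_imp_inj_on, rule strict) (use that in blast)
    then have "card {i \<in> {..<n}. T (i, 0) = k} \<le> card {k}"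
      by (intro card_inj_on_le[of "\<lambda>i. T (i, 0)"]) (auto simp: inj_on_def)
    then show "Poly_Mapping.lookup m k \<le> 1" unfolding c by simp
  qed
  have col: "map (\<lambda>i. T (i, 0)) [0..<n] = sorted_list_of_set ?K" if "T \<in> ?X" for T
  proof -
    have "sorted_wrt (<) (map (\<lambda>i. T (i, 0)) [0..<n])"
      using strict[of T] that by (auto simp: sorted_wrt_iff_nth_less strict_mono_on_def)
    moreover have "set (map (\<lambda>i. T (i, 0)) [0..<n]) = ?K"
      using image[OF that] by (simp add: atLeast0LessThan)
    ultimately show ?thesis
      by (metis sorted_list_of_set.idem_if_sorted_distinct strict_sorted_iff)
  qed
  have "mcoeff (schur (replicate n 1)) m = (of_nat (card ?X) :: 'a)" by (simp add: schur.rep_eq)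
  also have "\<dots> = mcoeff (e_mseries 0 n) m"
  proof (cases "(\<forall>k. Poly_Mapping.lookup m k \<le> 1) \<and> mdegree m = n")
    case True
    then have l1: "Poly_Mapping.lookup m k = 1" if "k \<in> ?K" for k
      using that by (metis in_keys_iff le_neq_implies_less less_one)
    have "mdegree m = (\<Sum>i\<in>?K. 1)" unfolding mdegree_def by (rule sum.cong) (auto simp: l1)
    then have cK: "card ?K = n" using True by simp
    define l where "l = sorted_list_of_set ?K"
    have l: "length l = n" "set l = ?K" "distinct l" "sorted_wrt (<) l"
      using cK by (auto simp: l_def)
    define T where "T c = (if c \<in> ?D then l ! fst c else 0)" for c
    have TD: "T (i, 0) = l ! i" if "i < n" for i
    proof -
      have "(i, 0) \<in> ?D" unfolding D using that by blast
      then show ?thesis by (simp add: T_def)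
    qed
    have "T \<in> ?X"
    proof (intro CollectI conjI allI)
      show "T \<in> ssyt (replicate n 1)"
        unfolding ssyt_def using l(1,4) by (auto simp: T_def D[unfolded One_nat_def] sorted_wrt_iff_nth_less)
      fix k
      have "{i \<in> {..<n}. T (i, 0) = k} = {i. i < length l \<and> l ! i = k}" using TD l(1) by auto
      moreover have "card {i. i < length l \<and> l ! i = k} = count_list l k"
        by (simp add: count_list_eq_length_filter length_filter_conv_card eq_commute)
      moreover have "count_list l k = (if k \<in> ?K then 1 else 0)"
      proof -
        have "count_list xs k = (if k \<in> set xs then 1 else 0)" if "distinct xs" for xs :: "nat list"
          using that by (induction xs) auto
        then show ?thesis using l(2,3) by metis
      qed
      ultimately show "card {c \<in> ?D. T c = k} = Poly_Mapping.lookup m k"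
        unfolding content using l1[of k] by (simp add: in_keys_iff split: if_splits)
    qed
    moreover have "S = T" if "S \<in> ?X" for S
    proof
      fix c
      show "S c = T c"
      proof (cases "c \<in> ?D")
        case True
        then obtain i where i: "c = (i, 0)" "i < n" unfolding D by auto
        have "map (\<lambda>i. S (i, 0)) [0..<n] ! i = l ! i" unfolding l_def using col[OF that] by simp
        then show ?thesis using i TD by simp
      next
        case False
        then have "S c = 0" using that unfolding ssyt_def by blast
        then show ?thesis using False by (simp add: T_def)
      qed
    qed
    ultimately have "?X = {T}" by blast
    then show ?thesis using True l1 by (simp add: mcoeff_e_mseries e_coeff_def)
  next
    case False
    have "?X = {}"
    proof (rule ccontr)
      assume "?X \<noteq> {}"
      then obtain T where T: "T \<in> ?X" by blast
      have "Poly_Mapping.lookup m i = 1" if "i \<in> ?K" for i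
        using one[OF T, of i] that by (simp add: in_keys_iff)
      then have "mdegree m = card ?K" by (simp add: mdegree_def)
      moreover have "length (map (\<lambda>i. T (i, 0)) [0..<n]) = card ?K" unfolding col[OF T] by simp
      ultimately show False using False one[OF T] by simp
    qed
    then have "of_nat (card ?X) = (0 :: 'a)" by (simp only: card.empty of_nat_0)
    moreover have "mcoeff (e_mseries 0 n) m = (0 :: 'a)"
    proof (cases "mdegree m = n")
      case True
      then obtain k where k: "\<not> Poly_Mapping.lookup m k \<le> 1" using False by blast
      then have "k \<in> ?K" "e_coeff 0 (Poly_Mapping.lookup m k) = (0 :: 'a)" by (auto simp: in_keys_iff e_coeff_def)
      then have "(\<Prod>i\<in>?K. e_coeff 0 (Poly_Mapping.lookup m i)) = (0 :: 'a)" by (intro prod_zero) auto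
      then show ?thesis by (simp add: mcoeff_e_mseries)
    qed (simp add: mcoeff_e_mseries)
    ultimately show ?thesis by simp
  qed
  finally show "mcoeff (schur (replicate n 1)) m = (mcoeff (e_mseries 0 n) m :: 'a)" .
qed

section \<open>The expansion in Hall--Littlewood functions\<close>

context hl_parameter
begin

text \<open>In degree n, replacing each variable x by -t x is multiplication by (-t)^n.\<close>

lemma e_mseries_eq_h_mseries: "e_mseries t n = mconst ((- t) ^ n) * h_mseries (1 / t) n"
proof (rule mseries_eqI)
  fix m :: "nat \<Rightarrow>\<^sub>0 nat"
  have e: "e_coeff t (Poly_Mapping.lookup m i) = (- t) ^ Poly_Mapping.lookup m i * (1 - 1 / t)"
    if "i \<in> Poly_Mapping.keys m" for i
    using that t_nonzero by (cases "Poly_Mapping.lookup m i") (auto simp: e_coeff_def in_keys_iff field_simps)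
  have "(\<Prod>i\<in>Poly_Mapping.keys m. e_coeff t (Poly_Mapping.lookup m i)) =
      (- t) ^ mdegree m * (1 - 1 / t) ^ card (Poly_Mapping.keys m)"
    by (simp add: e prod.distrib mdegree_def power_sum)
  then show "mcoeff (e_mseries t n) m = mcoeff (mconst ((- t) ^ n) * h_mseries (1 / t) n) m"
    by (simp add: mcoeff_e_mseries mcoeff_h_mseries)
qed

text \<open>Each factor t^j - 1/t is (-1/t) (1 - t^(j+1)); the shifted exponent makes the product
  over j < k a t-factorial of k.\<close>

lemma subset_coeff_inverse: "subset_coeff t (1 / t) k = (- 1 / t) ^ k * (1 - t) ^ k * t_fact t k"
proof (induction k)
  case (Suc k)
  have t1: "1 - t \<noteq> 0" using t_power_neq_1[of 1] by simp
  have "t ^ k - 1 / t = (- 1 / t) * (1 - t) * t_int t (Suc k)"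
    using t1 t_nonzero by (simp add: t_int_def field_simps)
  then show ?case by (simp add: subset_coeff_Suc Suc t_fact_Suc)
qed simp

definition K_column :: "nat \<Rightarrow> nat list \<Rightarrow> 'a" where
  "K_column n \<nu> = (- t) ^ (n - length \<nu>) * t ^ (n_stat \<nu> - (length \<nu> choose 2)) *
     (t_fact t (length \<nu>) / part_norm t \<nu>)"

lemma part_norm_t_nonzero: "part_norm t \<nu> \<noteq> 0"
  using part_norm_nonzero[of \<nu>] fconst_part_norm[of \<nu>] fconst_simps(1) by metis

text \<open>The factors (1 - t)^k and \<open>part_norm\<close> of b_\<nu> cancel against the
  numerator and the denominator, and (-t)^n (-1/t)^k leaves (-t)^(n-k), where k is the length of
  \<nu>.\<close>

lemma K_column_mult_HL_b:
  assumes "length \<nu> \<le> n"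
  shows "K_column n \<nu> * HL_b t \<nu> =
    (- t) ^ n * (subset_coeff t (1 / t) (length \<nu>) * t ^ (n_stat \<nu> - (length \<nu> choose 2)))"
proof -
  have "(- t) ^ n = (- t) ^ (n - length \<nu>) * (- t) ^ length \<nu>"
    using assms by (simp flip: power_add)
  moreover have "(- t) ^ length \<nu> * (- 1 / t) ^ length \<nu> = 1"
    using t_nonzero by (simp flip: power_mult_distrib)
  ultimately have "(- t) ^ n * (- 1 / t) ^ length \<nu> = (- t) ^ (n - length \<nu>)"
    by (simp add: mult.assoc)
  then show ?thesis
    using part_norm_t_nonzero[of \<nu>]
    by (simp add: K_column_def HL_b_eq subset_coeff_inverse flip: mult.assoc)
qed

lemma fconst_subset_coeff: "fconst (subset_coeff t y k) = subset_coeff (fconst t) (fconst y) k"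
  by (simp add: subset_coeff_def)

text \<open>For every finite set of variables both sides take the value of the generating function
  at y = 1/t, and a series is determined by these values.\<close>

lemma e_mseries_HL_Q_expansion:
  "e_mseries t n = (\<Sum>\<nu> | partition_of n \<nu>. mconst (K_column n \<nu>) * HL_Q t \<nu>)"
proof (rule represents_unique)
  show "represents (\<lambda>A. fconst ((- t) ^ n) * h_series (fconst (1 / t)) A $ n) (e_mseries t n)"
    unfolding e_mseries_eq_h_mseries by (intro represents_mult represents_const represents_h_series)
  have "represents (\<lambda>A. \<Sum>\<nu> | partition_of n \<nu>. fconst (K_column n \<nu>) * (fconst (HL_b t \<nu>) * hl_p \<nu> A))
      (\<Sum>\<nu> | partition_of n \<nu>. mconst (K_column n \<nu>) * HL_Q t \<nu>)"
    by (intro represents_sum finite_partition_of represents_mult represents_const represents_HL_Q)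
       (simp add: partition_of_def is_partition_def)
  then show "represents (\<lambda>A. fconst ((- t) ^ n) * h_series (fconst (1 / t)) A $ n)
      (\<Sum>\<nu> | partition_of n \<nu>. mconst (K_column n \<nu>) * HL_Q t \<nu>)"
  proof (rule represents_cong)
    fix A :: "nat set" assume A: "finite A"
    have "fconst (K_column n \<nu>) * (fconst (HL_b t \<nu>) * hl_p \<nu> A) = fconst ((- t) ^ n) *
        (subset_coeff (fconst t) (fconst (1 / t)) (length \<nu>) *
          fconst t ^ (n_stat \<nu> - (length \<nu> choose 2)) * hl_p \<nu> A)"
      if "partition_of n \<nu>" for \<nu>
    proof -
      have "fconst (K_column n \<nu> * HL_b t \<nu>) * hl_p \<nu> A = fconst ((- t) ^ n *
          (subset_coeff t (1 / t) (length \<nu>) * t ^ (n_stat \<nu> - (length \<nu> choose 2)))) * hl_p \<nu> A"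
        using K_column_mult_HL_b[OF partition_of_length_le[OF that]] by simp
      then show ?thesis by (simp only: fconst_simps(5) fconst_subset_coeff fconst_power mult.assoc)
    qed
    then show "(\<Sum>\<nu> | partition_of n \<nu>. fconst (K_column n \<nu>) * (fconst (HL_b t \<nu>) * hl_p \<nu> A)) =
        fconst ((- t) ^ n) * h_series (fconst (1 / t)) A $ n"
      unfolding sum_partitions_hl_p[OF A, where n = n, symmetric] sum_distrib_left
      by (intro sum.cong refl) simp
  qed
qed

lemma sum_HL_Q_coeff_unique:
  assumes c: "finite {\<nu>. c \<nu> \<noteq> 0}" "\<forall>\<nu>. c \<nu> \<noteq> 0 \<longrightarrow> is_partition \<nu>"
    and d: "finite {\<nu>. d \<nu> \<noteq> 0}" "\<forall>\<nu>. d \<nu> \<noteq> 0 \<longrightarrow> is_partition \<nu>"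
    and eq: "(\<Sum>\<nu> | c \<nu> \<noteq> 0. mconst (c \<nu>) * HL_Q t \<nu>) = (\<Sum>\<nu> | d \<nu> \<noteq> 0. mconst (d \<nu>) * HL_Q t \<nu>)"
  shows "c = d"
proof
  fix \<nu>
  define V where "V = {\<nu>. c \<nu> \<noteq> 0} \<union> {\<nu>. d \<nu> \<noteq> 0}"
  have fV: "finite V" using c(1) d(1) by (simp add: V_def)
  have "(\<Sum>\<nu> | c \<nu> \<noteq> 0. mconst (c \<nu>) * HL_Q t \<nu>) = (\<Sum>\<nu>\<in>V. mconst (c \<nu>) * HL_Q t \<nu>)"
    by (rule sum.mono_neutral_left[OF fV]) (auto simp: V_def)
  moreover have "(\<Sum>\<nu> | d \<nu> \<noteq> 0. mconst (d \<nu>) * HL_Q t \<nu>) = (\<Sum>\<nu>\<in>V. mconst (d \<nu>) * HL_Q t \<nu>)"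
    by (rule sum.mono_neutral_left[OF fV]) (auto simp: V_def)
  ultimately have e: "(\<Sum>\<nu>\<in>V. mconst (c \<nu>) * HL_Q t \<nu>) = (\<Sum>\<nu>\<in>V. mconst (d \<nu>) * HL_Q t \<nu>)"
    using eq by simp
  have cd: "mconst (c \<nu> - d \<nu>) = mconst (c \<nu>) - mconst (d \<nu>)" for \<nu>
    using mconst_add[of "c \<nu> - d \<nu>" "d \<nu>"] by simp
  have "(\<Sum>\<nu>\<in>V. mconst (c \<nu> - d \<nu>) * HL_Q t \<nu>) = 0"
    unfolding cd left_diff_distrib sum_subtractf e by simp
  then have "c \<nu> - d \<nu> = 0" if "\<nu> \<in> V"
    using HL_Q_independent[OF fV, of "\<lambda>\<nu>. c \<nu> - d \<nu>" \<nu>] c(2) d(2) that by (auto simp: V_def)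
  then show "c \<nu> = d \<nu>" by (cases "\<nu> \<in> V") (auto simp: V_def)
qed

end

lemma HL_K_column:
  fixes t :: "'a::field_char_0"
  assumes "hl_parameter t" "partition_of n \<nu>"
  shows "HL_K t (replicate n 1) \<nu> = hl_parameter.K_column t n \<nu>"
proof -
  interpret hl_parameter t by fact
  \<comment> \<open>The definite description asks for a family on all lists, so the coefficients are
    extended by 0.\<close>
  define d where "d \<nu> = (if partition_of n \<nu> then K_column n \<nu> else 0)" for \<nu>
  have sub: "{\<nu>. d \<nu> \<noteq> 0} \<subseteq> {\<nu>. partition_of n \<nu>}" by (auto simp: d_def split: if_splits)
  have d1: "finite {\<nu>. d \<nu> \<noteq> 0}" by (rule finite_subset[OF sub finite_partition_of])
  have d2: "\<forall>\<nu>. d \<nu> \<noteq> 0 \<longrightarrow> is_partition \<nu>" using sub by (auto simp: partition_of_def)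
  have "pleth_1mt t (schur (replicate n 1)) = (\<Sum>\<nu> | partition_of n \<nu>. mconst (K_column n \<nu>) * HL_Q t \<nu>)"
    unfolding schur_column pleth_1mt_e_mseries by (rule e_mseries_HL_Q_expansion)
  also have "\<dots> = (\<Sum>\<nu> | d \<nu> \<noteq> 0. mconst (d \<nu>) * HL_Q t \<nu>)"
    by (rule sum.mono_neutral_cong_right[OF finite_partition_of sub]) (auto simp: d_def)
  finally have d3: "pleth_1mt t (schur (replicate n 1)) = (\<Sum>\<nu> | d \<nu> \<noteq> 0. mconst (d \<nu>) * HL_Q t \<nu>)" .
  have "HL_K t (replicate n 1) = d"
    unfolding HL_K_def
  proof (rule the_equality)
    show "finite {\<nu>. d \<nu> \<noteq> 0} \<and> (\<forall>\<nu>. d \<nu> \<noteq> 0 \<longrightarrow> is_partition \<nu>) \<and>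
      pleth_1mt t (schur (replicate n 1)) = (\<Sum>\<nu> | d \<nu> \<noteq> 0. mconst (d \<nu>) * HL_Q t \<nu>)"
      using d1 d2 d3 by blast
  next
    fix c assume c: "finite {\<nu>. c \<nu> \<noteq> 0} \<and> (\<forall>\<nu>. c \<nu> \<noteq> 0 \<longrightarrow> is_partition \<nu>) \<and>
      pleth_1mt t (schur (replicate n 1)) = (\<Sum>\<nu> | c \<nu> \<noteq> 0. mconst (c \<nu>) * HL_Q t \<nu>)"
    then show "c = d" using d1 d2 d3 by (intro sum_HL_Q_coeff_unique) auto
  qed
  then show ?thesis using assms(2) by (simp add: d_def)
qed

lemma hl_parameter_t_var: "hl_parameter t_var"
proof
  show "t_var \<noteq> 0" by (simp add: t_var_def)
  fix i :: nat assume i: "0 < i"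
  have p: "t_var ^ i = to_fract ([:0, 1:] ^ i)"
  proof (induction i)
    case (Suc i)
    then show ?case unfolding power_Suc to_fract_mult by (simp only: t_var_def)
  qed simp
  have "degree ([:0, 1 :: rat:] ^ i) = i" by (simp add: degree_power_eq)
  then have "[:0, 1 :: rat:] ^ i \<noteq> 1" using i by (metis degree_1 less_irrefl)
  then show "t_var ^ i \<noteq> 1" unfolding p by (simp flip: to_fract_1)
qed

theorem corollary7p19:
  fixes n k :: nat and \<nu> :: "nat list"
  assumes "partition_of n \<nu>" and "length \<nu> = k"
  shows "HL_K t_var (replicate n 1) \<nu> =
    (- t_var) powi (int n - int k) * t_var powi (int (n_stat \<nu>) - int (k choose 2)) *
    (t_fact t_var k / (\<Prod>i=1..n. t_fact t_var (mult_part i \<nu>)))"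
proof -
  interpret hl_parameter t_var by (rule hl_parameter_t_var)
  have le: "k \<le> n" using partition_of_length_le[OF assms(1)] assms(2) by simp
  \<comment> \<open>The first column of \<nu> alone contributes k choose 2 to
    \<open>n_stat \<nu>\<close>.\<close>
  obtain \<mu> where "\<nu> = add_column (length \<nu>) \<mu>" "length \<mu> \<le> length \<nu>"
    using partition_eq_add_column[OF assms(1)] by blast
  then have le': "(k choose 2) \<le> n_stat \<nu>"
    using n_stat_add_column[of \<mu> "length \<nu>"] assms(2) by simp
  have "set \<nu> \<subseteq> {1..n}"
  proof
    fix i assume i: "i \<in> set \<nu>"
    then have "i \<noteq> 0" using assms(1) by (metis partition_of_def is_partition_def)
    moreover have "i \<le> n" using member_le_sum_list[OF i] assms(1) by (simp add: partition_of_def)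
    ultimately show "i \<in> {1..n}" by simp
  qed
  then have norm: "part_norm t_var \<nu> = (\<Prod>i=1..n. t_fact t_var (mult_part i \<nu>))"
    by (intro part_norm_superset) auto
  \<comment> \<open>Both differences are nonnegative, so the integer powers of the statement are the
    natural powers of \<open>K_column\<close>.\<close>
  have exps: "int n - int k = int (n - k)" "int (n_stat \<nu>) - int (k choose 2) = int (n_stat \<nu> - (k choose 2))"
    using le le' by simp_all
  show ?thesis
    unfolding HL_K_column[OF hl_parameter_t_var assms(1)] K_column_def assms(2) exps norm power_int_of_nat ..
qed

end
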